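(* Let $\theta<0$, let $u_1=u_1^n$ be given by either the i.i.d. or the orthonormalised model with $r=1$, and let $\widetilde\lambda_1^n\le\cdots\le\widetilde\lambda_n^n$ be the eigenvalues of $X_n+\theta u_1u_1^*$. Assume Assumption (A1) and Hypothesis (H1). Suppose that conditions (C1) and (C2) of Hypothesis (H3)$[p,\alpha,a]$ hold for some $\alpha\in(0,1)$ and some positive integer $p$. Then for any $\alpha'>\alpha$: (i) if $\theta<\underline\theta$, $\widetilde\lambda^n_1$ converges to $\rho_\theta<a$, whereas $n^{1-\alpha'}(\widetilde\lambda^n_{i+1}-\lambda^n_i)_{1\le i\le p-1}$ converges to $0$ in probability as $n\to\infty$; (ii) if $\theta\in(\underline\theta,0)$, $n^{1-\alpha'}(\widetilde\lambda^n_i-\lambda^n_i)_{1\le i\le p}$ converges to $0$ in probability as $n\to\infty$; (iii) if, instead of (C1) and (C2) of Hypothesis (H3)$[p,\alpha,a]$, one supposes that (C1') and (C2') of Hypothesis (H3)$[p,\alpha,b]$ hold, then $n^{1-\alpha'}(\widetilde\lambda^n_{n-i}-\lambda^n_{n-i})_{0\le i<p}$ converges to $0$ in probability as $n\to\infty$.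
   Context: For each $n$, $X_n$ is a deterministic $n\times n$ Hermitian (or real symmetric) matrix with eigenvalues $\lambda_1^n\le\cdots\le\lambda_n^n$, spectral measure $\mu_n=\frac1n\sum_l\delta_{\lambda_l^n}$. Hypothesis (H1): $\mu_n\to\mu_X$ weakly, $\mu_X$ deterministic compactly supported probability measure, $\lambda_1^n\to a$, $\lambda_n^n\to b$, the lower and upper bounds of the support of $\mu_X$. Assumption (A1): $\nu$ probability measure on $\mathbb R$ or $\mathbb C$ satisfying a logarithmic Sobolev inequality, centred, variance one; if not supported on $\mathbb R$, real and imaginary parts i.i.d. With $v^n=\frac1{\sqrt n}(x_1,\ldots,x_n)^T$, $x_i$ i.i.d. $\nu$: in the i.i.d. model $u_1^n=v^n$, in the orthonormalised model $u_1^n=v^n/\|v^n\|_2$. $G_{\mu_X}(z)=\int\frac{d\mu_X(x)}{z-x}$; $\overline\theta=1/\lim_{z\downarrow b}G_{\mu_X}(z)$, $\underline\theta=1/\lim_{z\uparrow a}G_{\mu_X}(z)$ ($1/\pm\infty=0$); $\rho_\theta=G_{\mu_X}^{-1}(1/\theta)$ if $\theta\in(-\infty,\underline\theta)\cup(\overline\theta,\infty)$, $a$ if $\theta\in[\underline\theta,0)$, $b$ if $\theta\in(0,\overline\theta]$. Conditions of Hypothesis (H3)$[p,\alpha,a]$: there is a sequence $m_n\to\infty$ of positive integers with $m_n=O(n^\alpha)$ such that (C1) $\liminf_n\frac1n\sum_{i=m_n+1}^n\frac1{\lambda_p^n-\lambda_i^n}\ge\frac1{\underline\theta}$ and (C2)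 there is $\eta_2>0$ with $\sum_{i=m_n+1}^n(\lambda_p^n-\lambda_i^n)^{-2}\le n^{2-\eta_2}$ for $n$ large. Conditions of Hypothesis (H3)$[p,\alpha,b]$: there is a sequence $m_n\to\infty$ with $m_n=O(n^\alpha)$ such that (C1') $\limsup_n\frac1n\sum_{i=m_n+1}^n\frac1{\lambda_{n-p+1}^n-\lambda_{n-i+1}^n}\le\frac1{\overline\theta}$ and (C2') there is $\eta_2>0$ with $\sum_{i=m_n+1}^n(\lambda_{n-p+1}^n-\lambda_{n-i+1}^n)^{-2}\le n^{2-\eta_2}$ for $n$ large. *)

theory Defs
  imports "HOL-Probability.Probability" "HOL-Library.Landau_Symbols"
    "Jordan_Normal_Form.Char_Poly"
begin

definition spec_mset :: "complex mat \<Rightarrow> complex multiset" where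
  "spec_mset A = (THE M. char_poly A = (\<Prod>z\<in>#M. [:- z, 1:]))"

text \<open>eig A k = k-th smallest eigenvalue (k = 1, ..., dim A) of a Hermitian matrix
  (whose eigenvalues are real).\<close>
definition eig :: "complex mat \<Rightarrow> nat \<Rightarrow> real" where
  "eig A k = sorted_list_of_multiset (image_mset Re (spec_mset A)) ! (k - 1)"

definition hermitian_n :: "nat \<Rightarrow> complex mat \<Rightarrow> bool" where
  "hermitian_n n A \<longleftrightarrow> A \<in> carrier_mat n n \<and>
     (\<forall>i<n. \<forall>j<n. A $$ (i, j) = cnj (A $$ (j, i)))"

definition rank_one :: "nat \<Rightarrow> real \<Rightarrow> (nat \<Rightarrow> complex) \<Rightarrow> complex mat" where
  "rank_one n \<theta> u = mat n n (\<lambda>(i, j). complex_of_real \<theta> * u i * cnj (u j))"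

text \<open>u_1^n from the entries x_1..x_n: v^n = x / sqrt n (i.i.d. model, orth = False),
  or v^n / norm v^n (orthonormalised model, orth = True).\<close>
definition model_vec :: "bool \<Rightarrow> nat \<Rightarrow> (nat \<Rightarrow> complex) \<Rightarrow> nat \<Rightarrow> complex" where
  "model_vec orth n xs =
     (let v = (\<lambda>i. xs i / complex_of_real (sqrt (real n)))
      in if orth then (\<lambda>i. v i / complex_of_real (sqrt (\<Sum>j<n. (cmod (v j))\<^sup>2))) else v)"

definition entropy_sq :: "complex measure \<Rightarrow> (complex \<Rightarrow> real) \<Rightarrow> real" where
  "entropy_sq \<nu> f =
     (\<integral>z. (f z)\<^sup>2 * ln ((f z)\<^sup>2) \<partial>\<nu>)
     - (\<integral>z. (f z)\<^sup>2 \<partial>\<nu>) * ln (\<integral>z. (f z)\<^sup>2 \<partial>\<nu>)"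

definition log_sobolev :: "complex measure \<Rightarrow> bool" where
  "log_sobolev \<nu> \<longleftrightarrow> (\<exists>c>0. \<forall>f f'.
      (\<forall>z. (f has_derivative f' z) (at z)) \<and> bounded (range f) \<and>
      (\<exists>B. \<forall>z. onorm (f' z) \<le> B) \<longrightarrow>
      entropy_sq \<nu> f \<le> 2 * c * (\<integral>z. (onorm (f' z))\<^sup>2 \<partial>\<nu>))"

definition assumption_A1 :: "complex measure \<Rightarrow> bool" where
  "assumption_A1 \<nu> \<longleftrightarrow> prob_space \<nu> \<and> sets \<nu> = sets borel \<and> log_sobolev \<nu> \<and>
     integrable \<nu> (\<lambda>z. z) \<and> (\<integral>z. z \<partial>\<nu>) = 0 \<and>
     integrable \<nu> (\<lambda>z. (cmod z)\<^sup>2) \<and> (\<integral>z. (cmod z)\<^sup>2 \<partial>\<nu>) = 1 \<and>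
     ((AE z in \<nu>. Im z = 0) \<or>
      (prob_space.indep_var \<nu> borel Re borel Im \<and> distr \<nu> borel Re = distr \<nu> borel Im))"

definition measure_support :: "real measure \<Rightarrow> real set" where
  "measure_support \<mu> = {x. \<forall>e>0. emeasure \<mu> (ball x e) > 0}"

definition stieltjes :: "real measure \<Rightarrow> real \<Rightarrow> real" where
  "stieltjes \<mu> z = (\<integral>x. 1 / (z - x) \<partial>\<mu>)"

text \<open>lim_{z \<down> b} G(z) and lim_{z \<up> a} G(z), as extended reals
  (G is monotone there, so the limit exists in the extended reals).\<close>
definition G_right :: "real measure \<Rightarrow> real \<Rightarrow> ereal" where
  "G_right \<mu> b = (if \<exists>L. (stieltjes \<mu> \<longlongrightarrow> L) (at_right b)
                   then ereal (Lim (at_right b) (stieltjes \<mu>)) else \<infinity>)"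

definition G_left :: "real measure \<Rightarrow> real \<Rightarrow> ereal" where
  "G_left \<mu> a = (if \<exists>L. (stieltjes \<mu> \<longlongrightarrow> L) (at_left a)
                   then ereal (Lim (at_left a) (stieltjes \<mu>)) else -\<infinity>)"

definition theta_bar :: "real measure \<Rightarrow> real \<Rightarrow> real" where
  "theta_bar \<mu> b = (if G_right \<mu> b = \<infinity> then 0 else 1 / real_of_ereal (G_right \<mu> b))"

definition theta_under :: "real measure \<Rightarrow> real \<Rightarrow> real" where
  "theta_under \<mu> a = (if G_left \<mu> a = -\<infinity> then 0 else 1 / real_of_ereal (G_left \<mu> a))"

definition rho :: "real measure \<Rightarrow> real \<Rightarrow> real \<Rightarrow> real \<Rightarrow> real" where
  "rho \<mu> a b \<theta> =
    (if \<theta> < theta_under \<mu> a \<or> \<theta> > theta_bar \<mu> b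
     then (THE z. (z < a \<or> z > b) \<and> stieltjes \<mu> z = 1 / \<theta>)
     else if \<theta> < 0 then a else b)"

text \<open>lam n i is the i-th smallest eigenvalue of X_n; Ga is lim_{z \<up> a} G(z) = 1/theta_under
  (with 1/0 = -\<infinity>), Gb is lim_{z \<down> b} G(z) = 1/theta_bar (with 1/0 = +\<infinity>).\<close>
definition H3_a :: "(nat \<Rightarrow> nat \<Rightarrow> real) \<Rightarrow> ereal \<Rightarrow> nat \<Rightarrow> real \<Rightarrow> bool" where
  "H3_a lam Ga p \<alpha> \<longleftrightarrow> (\<exists>m :: nat \<Rightarrow> nat.
     filterlim m at_top sequentially \<and> (\<forall>n. m n \<ge> 1) \<and>
     (\<lambda>n. real (m n)) \<in> O(\<lambda>n. real n powr \<alpha>) \<and>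
     liminf (\<lambda>n. ereal ((\<Sum>i\<in>{m n + 1..n}. 1 / (lam n p - lam n i)) / real n)) \<ge> Ga \<and>
     (\<exists>\<eta>>0. \<forall>\<^sub>F n in sequentially.
        (\<forall>i\<in>{m n + 1..n}. lam n p \<noteq> lam n i) \<and>
        (\<Sum>i\<in>{m n + 1..n}. 1 / (lam n p - lam n i)\<^sup>2) \<le> real n powr (2 - \<eta>)))"

definition H3_b :: "(nat \<Rightarrow> nat \<Rightarrow> real) \<Rightarrow> ereal \<Rightarrow> nat \<Rightarrow> real \<Rightarrow> bool" where
  "H3_b lam Gb p \<alpha> \<longleftrightarrow> (\<exists>m :: nat \<Rightarrow> nat.
     filterlim m at_top sequentially \<and> (\<forall>n. m n \<ge> 1) \<and>
     (\<lambda>n. real (m n)) \<in> O(\<lambda>n. real n powr \<alpha>) \<and>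
     limsup (\<lambda>n. ereal ((\<Sum>i\<in>{m n + 1..n}.
        1 / (lam n (n - p + 1) - lam n (n - i + 1))) / real n)) \<le> Gb \<and>
     (\<exists>\<eta>>0. \<forall>\<^sub>F n in sequentially.
        (\<forall>i\<in>{m n + 1..n}. lam n (n - p + 1) \<noteq> lam n (n - i + 1)) \<and>
        (\<Sum>i\<in>{m n + 1..n}. 1 / (lam n (n - p + 1) - lam n (n - i + 1))\<^sup>2)
          \<le> real n powr (2 - \<eta>)))"

definition conv_prob_zero :: "'a measure \<Rightarrow> (nat \<Rightarrow> 'a \<Rightarrow> real) \<Rightarrow> bool" where
  "conv_prob_zero M Y \<longleftrightarrow>
     (\<forall>\<epsilon>>0. (\<lambda>n. measure M {\<omega> \<in> space M. \<bar>Y n \<omega>\<bar> > \<epsilon>}) \<longlonglongrightarrow> 0)"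

end

theory Submission
  imports Defs "HOL-Real_Asymp.Real_Asymp" "Jordan_Normal_Form.Schur_Decomposition"
begin

text \<open>Let \<open>e\<^sub>k\<close> be an orthonormal eigenbasis of $X_n$, $v$ the random vector and $w_k = |\langle e_k, v\rangle|^2$.
  Comparing quadratic forms on subspaces that intersect for dimension reasons shows that the eigenvalues of
  $X_n + \theta v v^*$ and $X_n$ interlace, and that the position of $z$ relative to a perturbed eigenvalue is
  decided by comparing $\sum_k w_k / (\lambda_k - z)$ with $1/|\theta|$.

  Testing the logarithmic Sobolev inequality on truncations of powers of $|z|$ gives $\nu$ a finite eighth moment,
  hence $E |\sum_k c_k (w_k - 1/n)|^4 \le C (\sum_k c_k^2)^2 / n^4$. For bounded $c$ this is summable, so
  Borel-Cantelli gives $\sum_k w_k / (\lambda_k - z) \to - G(z)$ almost surely for $z < a$ and with it the limit of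
  the smallest eigenvalue. For the eigenvalues that stick, the resolvent sum is evaluated at distance
  $\epsilon n^{\alpha' - 1}$ of an eigenvalue: the nearest $O(n^\alpha)$ terms contribute $O(n^{\alpha - \alpha'})$ in
  probability, and the others are controlled by (C1) and (C2) in case (ii), while in cases (i) and (iii) monotonicity
  in $z$ suffices.\<close>

section \<open>The spectral theorem\<close>

text \<open>The comparison of quadratic forms replaces the secular equation
  \<open>sum_k w_k / (\<lambda>_k - z) = 1 / |\<theta>|\<close>, which makes sense only off the
  spectrum of X_n and needs separate care when eigenvalues coincide or weights vanish; the
  inequalities survive both. Nothing links the random vectors for different n, so no strong law
  along one sequence applies and almost sure limits must come from summable tail bounds. For bounded
  coefficients the variance of the weighted sum is only of order 1/n; its fourth moment is of order
  1/n^2, at the price of eight moments of the entries. Since \<theta> < 0, eigenvalues move down,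
  but not past the next unperturbed one. Each sticking claim therefore has a single nontrivial side,
  the other being interlacing: a bound from below when an eigenvalue sticks to the one of the same
  index, a bound from above when, the smallest one having left, it sticks to its lower neighbour.
  The perturbed eigenvalues are not shown to be measurable in \<open>\<omega>\<close>. Their
  exceptional events are covered by measurable events on which finitely many explicit weighted sums
  are large.\<close>

definition adj :: "complex mat \<Rightarrow> complex mat" where
  "adj A = mat (dim_col A) (dim_row A) (\<lambda>(i, j). cnj (A $$ (j, i)))"

lemma adj_carrier [simp]: "A \<in> carrier_mat n m \<Longrightarrow> adj A \<in> carrier_mat m n"
  by (auto simp: adj_def)

lemma adj_index [simp]: "A \<in> carrier_mat n m \<Longrightarrow> i < m \<Longrightarrow> j < n \<Longrightarrow> adj A $$ (i, j) = cnj (A $$ (j, i))"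
  by (auto simp: adj_def)

lemma adj_mult:
  assumes "A \<in> carrier_mat n m" "B \<in> carrier_mat m k"
  shows "adj (A * B) = adj B * adj A"
  using assms
  by (intro eq_matI) (auto simp: adj_def scalar_prod_def mult.commute)

lemma adj_adj [simp]: "adj (adj A) = A"
  by (intro eq_matI) (auto simp: adj_def)

text \<open>Complete v to a basis and apply Gram-Schmidt, which keeps v as first vector but returns
  vectors that are orthogonal without being normalised. Dividing by the norms \<open>N\<close>
  accounts for the scalar c in the conclusion.\<close>

lemma exists_unitary_with_first_column:
  fixes v :: "complex vec"
  assumes v: "v \<in> carrier_vec (Suc m)" and v0: "v \<noteq> 0\<^sub>v (Suc m)"
  shows "\<exists>U c. U \<in> carrier_mat (Suc m) (Suc m) \<and> adj U * U = 1\<^sub>m (Suc m) \<and> c \<noteq> 0 \<and> col U 0 = c \<cdot>\<^sub>v v"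
proof -
  let ?n = "Suc m"
  interpret cof_vec_space ?n "TYPE(complex)" .
  define b where "b = basis_completion v"
  define ws where "ws = gram_schmidt ?n b"
  from basis_completion[OF v v0, folded b_def]
  have dist_b: "distinct b" and indep: "\<not> lin_dep (set b)" and b: "set b \<subseteq> carrier_vec ?n"
    and hdb: "hd b = v" and len_b: "length b = ?n" by auto
  from hdb len_b obtain vs where bv: "b = v # vs" by (cases b, auto)
  from gram_schmidt_result[OF b dist_b indep refl, folded ws_def]
  have ws: "set ws \<subseteq> carrier_vec ?n" "corthogonal ws" "length ws = ?n"
    by (auto simp: len_b)
  from gram_schmidt_hd[OF v, of vs, folded bv] have hdws: "hd ws = v" unfolding ws_def .
  define N where "N j = sqrt (\<Sum>i<?n. (cmod (vec_index (ws ! j) i))\<^sup>2)" for j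
  have wsc: "ws ! j \<in> carrier_vec ?n" if "j < ?n" for j
    using ws that by (metis nth_mem subsetD)
  have ip: "(\<Sum>i<?n. vec_index (ws ! k) i * cnj (vec_index (ws ! j) i)) = ws ! k \<bullet>c ws ! j"
    if "j < ?n" "k < ?n" for j k
    using wsc[OF that(1)] wsc[OF that(2)] by (auto simp: scalar_prod_def lessThan_atLeast0)
  have NN: "(\<Sum>i<?n. vec_index (ws ! j) i * cnj (vec_index (ws ! j) i)) = (complex_of_real (N j))\<^sup>2" for j
  proof -
    have "(complex_of_real (N j))\<^sup>2 = complex_of_real ((N j)\<^sup>2)" by simp
    also have "(N j)\<^sup>2 = (\<Sum>i<?n. (cmod (vec_index (ws ! j) i))\<^sup>2)"
      unfolding N_def by (rule real_sqrt_pow2) (simp add: sum_nonneg del: sum.lessThan_Suc)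
    finally show ?thesis by (simp add: complex_norm_square del: of_real_power)
  qed
  have N0: "N j \<noteq> 0" if "j < ?n" for j
  proof
    assume "N j = 0"
    hence "ws ! j \<bullet>c ws ! j = 0" using NN[of j] ip[OF that that] by simp
    with corthogonalD[OF ws(2), of j j] that ws(3) show False by auto
  qed
  define U where "U = mat ?n ?n (\<lambda>(i, j). vec_index (ws ! j) i / complex_of_real (N j))"
  have U: "U \<in> carrier_mat ?n ?n" by (simp add: U_def)
  have "adj U * U = 1\<^sub>m ?n"
  proof (intro eq_matI)
    fix i j assume "i < dim_row (1\<^sub>m ?n :: complex mat)" "j < dim_col (1\<^sub>m ?n :: complex mat)"
    hence ij: "i < ?n" "j < ?n" by auto
    have "(adj U * U) $$ (i, j) = (\<Sum>k<?n. cnj (vec_index (ws ! i) k / complex_of_real (N i)) * (vec_index (ws ! j) k / complex_of_real (N j)))"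
      using ij U by (simp add: scalar_prod_def lessThan_atLeast0 adj_def) (simp add: U_def)
    also have "\<dots> = (\<Sum>k<?n. vec_index (ws ! j) k * cnj (vec_index (ws ! i) k)) / (N i * N j)"
      by (simp add: sum_divide_distrib mult.commute del: sum.lessThan_Suc)
    also have "\<dots> = (if i = j then 1 else 0)"
    proof (cases "i = j")
      case True
      then show ?thesis using NN[of j] N0[OF ij(2)] by (simp add: power2_eq_square)
    next
      case False
      then have "ws ! j \<bullet>c ws ! i = 0"
        using corthogonalD[OF ws(2), of j i] ij ws(3) by auto
      then show ?thesis using ip[OF ij] False by simp
    qed
    finally show "(adj U * U) $$ (i, j) = 1\<^sub>m ?n $$ (i, j)" using ij by simp
  qed (auto simp: U_def adj_def)
  moreover have "col U 0 = (1 / complex_of_real (N 0)) \<cdot>\<^sub>v v"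
  proof -
    have "ws ! 0 = v" using hdws ws(3) by (metis hd_conv_nth length_0_conv nat.distinct(1))
    then show ?thesis using v by (intro eq_vecI) (auto simp: U_def)
  qed
  ultimately show ?thesis using U N0[of 0] by (intro exI[of _ U] exI[of _ "1 / complex_of_real (N 0)"]) auto
qed

lemma exists_eigenvector_complex:
  fixes A :: "complex mat"
  assumes A: "A \<in> carrier_mat (Suc m) (Suc m)"
  shows "\<exists>v c. v \<in> carrier_vec (Suc m) \<and> v \<noteq> 0\<^sub>v (Suc m) \<and> A *\<^sub>v v = c \<cdot>\<^sub>v v"
proof -
  obtain as where as: "char_poly A = (\<Prod> a \<leftarrow> as. [:- a, 1:])" "length as = Suc m"
    using char_poly_factorized[OF A] by auto
  then obtain e es where "as = e # es" by (cases as) auto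
  hence "poly (char_poly A) e = 0" using as by simp
  hence "eigenvalue A e" using eigenvalue_root_char_poly[OF A] by simp
  thus ?thesis using A unfolding eigenvalue_def eigenvector_def by auto
qed

text \<open>Deflation: after conjugation by a unitary W whose first column is an eigenvector, the
  first column of B is c times a unit vector. Hermitian symmetry then clears the first row too and
  makes c real, so B is block diagonal and the induction hypothesis applies to the lower block
  C.\<close>

lemma unitary_diagonalization:
  assumes "A \<in> carrier_mat n n" "adj A = A"
  shows "\<exists>U d. U \<in> carrier_mat n n \<and> adj U * U = 1\<^sub>m n \<and>
           A * U = U * mat n n (\<lambda>(i, j). if i = j then complex_of_real (d i) else 0)"
  using assms
proof (induction n arbitrary: A)
  case 0
  show ?case
    by (rule exI[of _ "0\<^sub>m 0 0"], rule exI[of _ "\<lambda>_. 0"], insert 0) (auto simp: adj_def)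
next
  case (Suc m)
  let ?n = "Suc m"
  note A = Suc.prems(1) and herm = Suc.prems(2)
  obtain v c where v: "v \<in> carrier_vec ?n" "v \<noteq> 0\<^sub>v ?n" and Av: "A *\<^sub>v v = c \<cdot>\<^sub>v v"
    using exists_eigenvector_complex[OF A] by auto
  obtain W t where W: "W \<in> carrier_mat ?n ?n" and WW: "adj W * W = 1\<^sub>m ?n" and t: "t \<noteq> 0"
    and colW: "col W 0 = t \<cdot>\<^sub>v v"
    using exists_unitary_with_first_column[OF v] by auto
  have aW: "adj W \<in> carrier_mat ?n ?n" using W by simp
  have WW': "W * adj W = 1\<^sub>m ?n" using mat_mult_left_right_inverse[OF aW W WW] .
  define B where "B = adj W * A * W"
  have B: "B \<in> carrier_mat ?n ?n" unfolding B_def by (intro mult_carrier_mat[of _ ?n ?n] aW A W)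
  have Bh: "adj B = B" unfolding B_def
    using W A aW by (simp add: adj_mult[of _ ?n ?n _ ?n] herm assoc_mult_mat[of _ ?n ?n _ ?n _ ?n])
  have AWc: "A * W \<in> carrier_mat ?n ?n" using A W by (rule mult_carrier_mat)
  have "W * B = (W * adj W) * (A * W)" unfolding B_def assoc_mult_mat[OF aW A W]
    by (rule assoc_mult_mat[OF W aW AWc, symmetric])
  hence AW: "A * W = W * B" using left_mult_one_mat[OF AWc] by (simp add: WW')
  have "col B 0 = adj W *\<^sub>v (A *\<^sub>v col W 0)"
    unfolding B_def assoc_mult_mat[OF aW A W] col_mult2[OF aW AWc zero_less_Suc] col_mult2[OF A W zero_less_Suc] ..
  also have "A *\<^sub>v col W 0 = c \<cdot>\<^sub>v col W 0"
    unfolding colW using A v Av by (simp add: mult_mat_vec smult_smult_assoc mult.commute)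
  also have "adj W *\<^sub>v (c \<cdot>\<^sub>v col W 0) = c \<cdot>\<^sub>v (adj W *\<^sub>v col W 0)"
    by (rule mult_mat_vec[OF aW]) (use v in \<open>simp add: colW\<close>)
  also have "adj W *\<^sub>v col W 0 = col (adj W * W) 0"
    by (rule col_mult2[OF aW W zero_less_Suc, symmetric])
  also have "\<dots> = col (1\<^sub>m ?n) 0" by (simp add: WW)
  finally have colB: "col B 0 = c \<cdot>\<^sub>v col (1\<^sub>m ?n) 0" .
  have B0: "B $$ (i, 0) = (if i = 0 then c else 0)" if "i < ?n" for i
  proof -
    have "B $$ (i, 0) = vec_index (col B 0) i" using B that by simp
    thus ?thesis unfolding colB using that by simp
  qed
  have Bsym: "B $$ (i, j) = cnj (B $$ (j, i))" if "i < ?n" "j < ?n" for i j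
    using Bh adj_index[OF B that] by simp
  have c_real: "c = complex_of_real (Re c)"
    using Bsym[of 0 0] B0[of 0] by (simp add: complex_eq_iff)
  define C where "C = mat m m (\<lambda>(i, j). B $$ (Suc i, Suc j))"
  have C: "C \<in> carrier_mat m m" by (simp add: C_def)
  have Ch: "adj C = C" by (intro eq_matI) (auto simp: adj_def C_def intro!: Bsym[symmetric])
  obtain V d where V: "V \<in> carrier_mat m m" and VV: "adj V * V = 1\<^sub>m m"
    and CV: "C * V = V * mat m m (\<lambda>(i, j). if i = j then complex_of_real (d i) else 0)"
    using Suc.IH[OF C Ch] by auto
  let ?D = "mat m m (\<lambda>(i, j). if i = j then complex_of_real (d i) else 0)"
  define V' where "V' = four_block_mat (1\<^sub>m 1) (0\<^sub>m 1 m) (0\<^sub>m m 1) V"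
  define d' where "d' i = (case i of 0 \<Rightarrow> Re c | Suc k \<Rightarrow> d k)" for i
  let ?D' = "mat ?n ?n (\<lambda>(i, j). if i = j then complex_of_real (d' i) else 0)"
  have V': "V' \<in> carrier_mat ?n ?n" using V by (auto simp: V'_def)
  have Bblock: "B = four_block_mat (c \<cdot>\<^sub>m 1\<^sub>m 1) (0\<^sub>m 1 m) (0\<^sub>m m 1) C"
  proof (intro eq_matI)
    fix i j assume "i < dim_row (four_block_mat (c \<cdot>\<^sub>m 1\<^sub>m 1) (0\<^sub>m 1 m) (0\<^sub>m m 1) C)"
      "j < dim_col (four_block_mat (c \<cdot>\<^sub>m 1\<^sub>m 1) (0\<^sub>m 1 m) (0\<^sub>m m 1) C)"
    hence ij: "i < ?n" "j < ?n" using C by auto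
    show "B $$ (i, j) = four_block_mat (c \<cdot>\<^sub>m 1\<^sub>m 1) (0\<^sub>m 1 m) (0\<^sub>m m 1) C $$ (i, j)"
      using ij C B0[of i] B0[of j] Bsym[of i j]
      by (cases i; cases j) (auto simp: C_def)
  qed (use B C in auto)
  have Dblock: "?D' = four_block_mat (c \<cdot>\<^sub>m 1\<^sub>m 1) (0\<^sub>m 1 m) (0\<^sub>m m 1) ?D"
    using c_real by (intro eq_matI) (auto simp: d'_def split: nat.splits)
  have adjV': "adj V' = four_block_mat (1\<^sub>m 1) (0\<^sub>m 1 m) (0\<^sub>m m 1) (adj V)"
    using V by (intro eq_matI) (auto simp: V'_def adj_def)
  have BV: "B * V' = V' * ?D'"
    unfolding Bblock Dblock V'_def
    using C V CV by (subst (1 2) mult_four_block_mat[of _ 1 1 _ m _ m _ _ 1 _ m]) auto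
  have VV': "adj V' * V' = 1\<^sub>m ?n"
  proof -
    have aV: "adj V \<in> carrier_mat m m" using V by simp
    have "adj V' * V' = four_block_mat (1\<^sub>m 1) (0\<^sub>m 1 m) (0\<^sub>m m 1) (1\<^sub>m m)"
      unfolding adjV' unfolding V'_def using V aV VV right_mult_zero_mat[OF aV, of 1]
      by (subst mult_four_block_mat[of _ 1 1 _ m _ m _ _ 1 _ m]) auto
    thus ?thesis by simp
  qed
  define U where "U = W * V'"
  have U: "U \<in> carrier_mat ?n ?n" using W V' by (simp add: U_def)
  have aV': "adj V' \<in> carrier_mat ?n ?n" using V' by simp
  have WV: "W * V' \<in> carrier_mat ?n ?n" using W V' by (rule mult_carrier_mat)
  have "adj U * U = adj V' * (adj W * (W * V'))"
    unfolding U_def adj_mult[OF W V'] by (rule assoc_mult_mat[OF aV' aW WV])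
  also have "adj W * (W * V') = V'"
    unfolding assoc_mult_mat[OF aW W V', symmetric] WW by (rule left_mult_one_mat[OF V'])
  finally have UU: "adj U * U = 1\<^sub>m ?n" unfolding VV' .
  have D': "?D' \<in> carrier_mat ?n ?n" by simp
  have "A * U = (A * W) * V'" unfolding U_def by (rule assoc_mult_mat[OF A W V', symmetric])
  also have "\<dots> = W * (B * V')" unfolding AW by (rule assoc_mult_mat[OF W B V'])
  also have "\<dots> = U * ?D'" unfolding BV U_def by (rule assoc_mult_mat[OF W V' D', symmetric])
  finally show ?case using U UU by (intro exI[of _ U] exI[of _ d']) auto
qed

text \<open>\<open>spec_mset\<close> is a definite description; its uniqueness holds because a
  product of monic linear factors determines its multiset of roots, recovered by
  \<open>proots\<close>.\<close>

lemma spec_mset_eqI: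
  assumes "char_poly A = (\<Prod>z\<in>#M. [:- z, 1:])"
  shows "spec_mset A = M"
proof -
  have pr: "proots (\<Prod>z\<in>#N. [:- z, 1:]) = N" for N :: "complex multiset"
  proof (induction N)
    case (add x N)
    have "(\<Prod>z\<in>#N. [:- z, 1:]) \<noteq> (0 :: complex poly)" by (auto simp: prod_mset_zero_iff)
    with add show ?case by (simp add: proots_mult del: mult_pCons_left)
  qed simp
  show ?thesis unfolding spec_mset_def
  proof (rule the_equality)
    fix N assume "char_poly A = (\<Prod>z\<in>#N. [:- z, 1:])"
    with assms have "proots (\<Prod>z\<in>#N. [:- z, 1:]) = proots (\<Prod>z\<in>#M. [:- z, 1:])" by simp
    thus "N = M" by (simp only: pr)
  qed (fact assms)
qed

lemma prod_list_eq_prod_mset: "(\<Prod>a\<leftarrow>xs. f a) = (\<Prod>a\<in>#mset xs. f a :: 'b :: comm_monoid_mult)"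
  by (induction xs) auto

text \<open>The diagonal form shows that the sorted spectrum is a rearrangement of the diagonal d.
  The permutation \<pi> realising it is applied to the columns of U, so that column k belongs to the
  (k+1)-st smallest eigenvalue. The second orthogonality relation is \<open>U * adj U = 1\<close>, a
  left inverse of a square matrix being a right inverse.\<close>

lemma hermitian_spectral:
  assumes "hermitian_n n A"
  obtains e :: "nat \<Rightarrow> nat \<Rightarrow> complex"
  where "\<And>k l. k < n \<Longrightarrow> l < n \<Longrightarrow> (\<Sum>i<n. cnj (e k i) * e l i) = (if k = l then 1 else 0)"
    and "\<And>i j. i < n \<Longrightarrow> j < n \<Longrightarrow> (\<Sum>k<n. e k i * cnj (e k j)) = (if i = j then 1 else 0)"
    and "\<And>k i. k < n \<Longrightarrow> i < n \<Longrightarrow> (\<Sum>j<n. A $$ (i, j) * e k j) = complex_of_real (eig A (Suc k)) * e k i"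
    and "\<And>k l. k \<le> l \<Longrightarrow> l < n \<Longrightarrow> eig A (Suc k) \<le> eig A (Suc l)"
proof -
  have A: "A \<in> carrier_mat n n" using assms by (simp add: hermitian_n_def)
  have "adj A = A"
  proof (rule eq_matI)
    fix i j assume "i < dim_row A" "j < dim_col A"
    then have "i < n" "j < n" using A by auto
    with assms have "A $$ (i, j) = cnj (A $$ (j, i))" unfolding hermitian_n_def by blast
    with A show "adj A $$ (i, j) = A $$ (i, j)" using \<open>i < n\<close> \<open>j < n\<close> by simp
  qed (use A in \<open>auto simp: adj_def\<close>)
  then obtain U d where U: "U \<in> carrier_mat n n" and UU: "adj U * U = 1\<^sub>m n"
    and AU: "A * U = U * mat n n (\<lambda>(i, j). if i = j then complex_of_real (d i) else 0)"
    using unitary_diagonalization[OF A] by auto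
  let ?D = "mat n n (\<lambda>(i, j). if i = j then complex_of_real (d i) else 0)"
  have aU: "adj U \<in> carrier_mat n n" using U by simp
  have UU': "U * adj U = 1\<^sub>m n" using mat_mult_left_right_inverse[OF aU U UU] .
  have AUU: "A = U * ?D * adj U"
    unfolding AU[symmetric] assoc_mult_mat[OF A U aU] UU' by (rule right_mult_one_mat[OF A, symmetric])
  have "similar_mat A ?D"
    unfolding similar_mat_def similar_mat_wit_def Let_def
    by (rule exI[of _ U], rule exI[of _ "adj U"]) (use A U aU UU UU' AUU in auto)
  hence "char_poly A = char_poly ?D" by (rule char_poly_similar)
  also have "\<dots> = (\<Prod>a \<leftarrow> diag_mat ?D. [:- a, 1:])"
    by (rule char_poly_upper_triangular[of _ n]) (auto simp: upper_triangular_def)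
  also have "diag_mat ?D = map (complex_of_real \<circ> d) [0..<n]"
    by (auto simp: diag_mat_def)
  also have "(\<Prod>a \<leftarrow> map (complex_of_real \<circ> d) [0..<n]. [:- a, 1:]) =
      (\<Prod>z\<in>#mset (map (complex_of_real \<circ> d) [0..<n]). [:- z, 1:])"
    by (rule prod_list_eq_prod_mset)
  finally have spec: "spec_mset A = mset (map (complex_of_real \<circ> d) [0..<n])"
    by (rule spec_mset_eqI)
  have im: "image_mset Re (spec_mset A) = mset (map d [0..<n])"
    unfolding spec mset_map[symmetric] by (simp add: o_def)
  define L where "L = sorted_list_of_multiset (image_mset Re (spec_mset A))"
  have eig: "eig A k = L ! (k - 1)" for k by (simp add: eig_def L_def)
  have srt: "sorted L" by (simp add: L_def)
  have msL: "mset L = mset (map d [0..<n])" by (simp add: L_def im del: mset_map)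
  have lenL: "length L = n" using arg_cong[OF msL, of size] by simp
  from mset_eq_permutation[OF msL] obtain \<pi> where \<pi>: "\<pi> permutes {..<n}"
    and perm: "permute_list \<pi> (map d [0..<n]) = L" by auto
  have pin: "\<pi> k < n" if "k < n" for k using permutes_in_image[OF \<pi>, of k] that by simp
  have Lk: "L ! k = d (\<pi> k)" if "k < n" for k
  proof -
    have "permute_list \<pi> (map d [0..<n]) ! k = map d [0..<n] ! \<pi> k"
      by (rule permute_list_nth) (use that \<pi> in auto)
    thus ?thesis unfolding perm using pin[OF that] by simp
  qed
  show ?thesis
  proof (rule that[of "\<lambda>k i. U $$ (i, \<pi> k)"])
    fix k l assume kl: "k < n" "l < n"
    have "(\<Sum>i<n. cnj (U $$ (i, \<pi> k)) * U $$ (i, \<pi> l)) = (adj U * U) $$ (\<pi> k, \<pi> l)"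
      using U pin kl by (simp add: scalar_prod_def adj_def lessThan_atLeast0)
    also have "\<dots> = (if \<pi> k = \<pi> l then 1 else 0)" using pin kl by (simp add: UU)
    also have "\<pi> k = \<pi> l \<longleftrightarrow> k = l" using permutes_inj[OF \<pi>] by (auto dest: injD)
    finally show "(\<Sum>i<n. cnj (U $$ (i, \<pi> k)) * U $$ (i, \<pi> l)) = (if k = l then 1 else 0)" .
  next
    fix i j assume ij: "i < n" "j < n"
    have "(\<Sum>k<n. U $$ (i, \<pi> k) * cnj (U $$ (j, \<pi> k))) = (\<Sum>k<n. U $$ (i, k) * cnj (U $$ (j, k)))"
      by (rule sum.permute[OF \<pi>, of "\<lambda>k. U $$ (i, k) * cnj (U $$ (j, k))", unfolded o_def, symmetric])
    also have "\<dots> = (U * adj U) $$ (i, j)"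
      using U ij by (simp add: scalar_prod_def adj_def lessThan_atLeast0)
    finally show "(\<Sum>k<n. U $$ (i, \<pi> k) * cnj (U $$ (j, \<pi> k))) = (if i = j then 1 else 0)"
      using ij by (simp add: UU')
  next
    fix k i assume ki: "k < n" "i < n"
    have "(\<Sum>j<n. A $$ (i, j) * U $$ (j, \<pi> k)) = (A * U) $$ (i, \<pi> k)"
      using A U ki pin by (simp add: scalar_prod_def lessThan_atLeast0)
    also have "\<dots> = (\<Sum>j<n. U $$ (i, j) * (if j = \<pi> k then complex_of_real (d j) else 0))"
      unfolding AU using U ki pin by (simp add: scalar_prod_def lessThan_atLeast0)
    also have "\<dots> = (\<Sum>j<n. if j = \<pi> k then U $$ (i, j) * complex_of_real (d j) else 0)"
      by (intro sum.cong) auto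
    also have "\<dots> = complex_of_real (eig A (Suc k)) * U $$ (i, \<pi> k)"
      using pin[OF ki(1)] ki by (simp add: eig Lk)
    finally show "(\<Sum>j<n. A $$ (i, j) * U $$ (j, \<pi> k)) = complex_of_real (eig A (Suc k)) * U $$ (i, \<pi> k)" .
  next
    fix k l assume "k \<le> l" "l < n"
    thus "eig A (Suc k) \<le> eig A (Suc l)"
      using srt lenL by (auto simp: eig intro: sorted_nth_mono)
  qed
qed

section \<open>Coordinates and quadratic forms in an orthonormal eigenbasis\<close>

definition ip :: "nat \<Rightarrow> (nat \<Rightarrow> complex) \<Rightarrow> (nat \<Rightarrow> complex) \<Rightarrow> complex" where
  "ip n u y = (\<Sum>i<n. cnj (u i) * y i)"

definition qform :: "nat \<Rightarrow> complex mat \<Rightarrow> (nat \<Rightarrow> complex) \<Rightarrow> real" where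
  "qform n A y = Re (\<Sum>i<n. cnj (y i) * (\<Sum>j<n. A $$ (i, j) * y j))"

text \<open>Vectors are functions on \<open>nat\<close> read only below n. The second clause is
  completeness, put as the expansion of an arbitrary y, the form in which it is used later. Basis
  vectors are numbered from 0 while \<open>eig\<close> counts from 1.\<close>

definition eigenbasis :: "nat \<Rightarrow> complex mat \<Rightarrow> (nat \<Rightarrow> nat \<Rightarrow> complex) \<Rightarrow> bool" where
  "eigenbasis n A e \<longleftrightarrow>
     (\<forall>k<n. \<forall>l<n. ip n (e k) (e l) = (if k = l then 1 else 0)) \<and>
     (\<forall>y. \<forall>i<n. y i = (\<Sum>k<n. ip n (e k) y * e k i)) \<and>
     (\<forall>k<n. \<forall>i<n. (\<Sum>j<n. A $$ (i, j) * e k j) = complex_of_real (eig A (Suc k)) * e k i) \<and>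
     (\<forall>k l. k \<le> l \<longrightarrow> l < n \<longrightarrow> eig A (Suc k) \<le> eig A (Suc l))"

theorem hermitian_eigenbasis:
  assumes "hermitian_n n A"
  shows "\<exists>e. eigenbasis n A e"
proof -
  obtain e :: "nat \<Rightarrow> nat \<Rightarrow> complex"
  where e: "\<And>k l. k < n \<Longrightarrow> l < n \<Longrightarrow> (\<Sum>i<n. cnj (e k i) * e l i) = (if k = l then 1 else 0)"
    and c: "\<And>i j. i < n \<Longrightarrow> j < n \<Longrightarrow> (\<Sum>k<n. e k i * cnj (e k j)) = (if i = j then 1 else 0)"
    and A: "\<And>k i. k < n \<Longrightarrow> i < n \<Longrightarrow> (\<Sum>j<n. A $$ (i, j) * e k j) = complex_of_real (eig A (Suc k)) * e k i"
    and s: "\<And>k l. k \<le> l \<Longrightarrow> l < n \<Longrightarrow> eig A (Suc k) \<le> eig A (Suc l)"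
    using hermitian_spectral[OF assms] by blast
  have ex: "y i = (\<Sum>k<n. ip n (e k) y * e k i)" if "i < n" for y i
  proof -
    have "(\<Sum>k<n. ip n (e k) y * e k i) = (\<Sum>k<n. \<Sum>j<n. y j * (e k i * cnj (e k j)))"
      by (simp add: ip_def sum_distrib_left sum_distrib_right mult_ac)
    also have "\<dots> = (\<Sum>j<n. y j * (\<Sum>k<n. e k i * cnj (e k j)))"
      by (subst sum.swap) (simp add: sum_distrib_left)
    also have "\<dots> = (\<Sum>j<n. if j = i then y j else 0)"
      using that by (intro sum.cong) (auto simp: c)
    finally show ?thesis using that by simp
  qed
  show ?thesis unfolding eigenbasis_def
    by (intro exI[of _ e] conjI allI impI ex A s) (simp_all add: ip_def e)
qed

section \<open>Rank-one perturbations\<close>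

lemma ip_sum_right: "ip n u (\<lambda>i. \<Sum>j\<in>J. c j * f j i) = (\<Sum>j\<in>J. c j * ip n u (f j))"
proof -
  have "ip n u (\<lambda>i. \<Sum>j\<in>J. c j * f j i) = (\<Sum>i<n. \<Sum>j\<in>J. c j * (cnj (u i) * f j i))"
    by (simp add: ip_def sum_distrib_left mult_ac)
  also have "\<dots> = (\<Sum>j\<in>J. c j * ip n u (f j))"
    by (subst sum.swap) (simp add: ip_def sum_distrib_left)
  finally show ?thesis .
qed

lemma ip_cnj: "cnj (ip n u y) = ip n y u"
  by (simp add: ip_def mult.commute)

lemma ip_combination:
  assumes "\<And>k l. k < n \<Longrightarrow> l < n \<Longrightarrow> ip n (e k) (e l) = (if k = l then 1 else 0)"
    and J: "J \<subseteq> {..<n}" and "k < n"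
  shows "ip n (e k) (\<lambda>i. \<Sum>j\<in>J. c j * e j i) = (if k \<in> J then c k else 0)"
proof -
  have "(\<Sum>j\<in>J. c j * ip n (e k) (e j)) = (\<Sum>j\<in>J. if j = k then c j else 0)"
    using assms by (intro sum.cong) auto
  thus ?thesis using finite_subset[OF J] by (simp add: ip_sum_right)
qed

lemma eigenbasis_ip:
  assumes "eigenbasis n A e"
  shows "ip n u y = (\<Sum>k<n. cnj (ip n (e k) u) * ip n (e k) y)"
proof -
  have "ip n u y = (\<Sum>i<n. cnj (u i) * (\<Sum>k<n. ip n (e k) y * e k i))"
    unfolding ip_def[of n u y] using assms unfolding eigenbasis_def
    by (intro sum.cong refl arg_cong2[where f = "(*)"]) auto
  also have "\<dots> = ip n u (\<lambda>i. \<Sum>k<n. ip n (e k) y * e k i)" by (simp add: ip_def)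
  also have "\<dots> = (\<Sum>k<n. ip n (e k) y * ip n u (e k))" by (rule ip_sum_right)
  finally show ?thesis by (simp add: ip_cnj mult.commute)
qed

abbreviation sqnorm :: "nat \<Rightarrow> (nat \<Rightarrow> complex) \<Rightarrow> real" where
  "sqnorm n y \<equiv> \<Sum>k<n. (cmod (y k))\<^sup>2"

lemma sqnorm_ip: "complex_of_real (sqnorm n y) = ip n y y"
  by (simp add: ip_def complex_norm_square mult.commute del: of_real_power)

lemma eigenbasis_norm:
  assumes "eigenbasis n A e"
  shows "sqnorm n y = (\<Sum>k<n. (cmod (ip n (e k) y))\<^sup>2)"
proof -
  have "complex_of_real (sqnorm n y) = ip n y y" by (rule sqnorm_ip)
  also have "\<dots> = complex_of_real (\<Sum>k<n. (cmod (ip n (e k) y))\<^sup>2)"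
    unfolding eigenbasis_ip[OF assms, of y y]
    by (simp add: complex_norm_square mult.commute del: of_real_power)
  finally show ?thesis by (simp only: of_real_eq_iff)
qed

lemma eigenbasis_orthonormal:
  "eigenbasis n A e \<Longrightarrow> k < n \<Longrightarrow> l < n \<Longrightarrow> ip n (e k) (e l) = (if k = l then 1 else 0)"
  by (simp add: eigenbasis_def)

lemma eigenbasis_norm_pos:
  assumes g: "eigenbasis n B g" and j: "j < n" "ip n (g j) y \<noteq> 0"
  shows "0 < sqnorm n y"
proof -
  have "0 < (cmod (ip n (g j) y))\<^sup>2" using j by simp
  also have "\<dots> \<le> (\<Sum>k<n. (cmod (ip n (g k) y))\<^sup>2)" using j by (intro member_le_sum) auto
  finally show ?thesis by (simp add: eigenbasis_norm[OF g, of y])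
qed

lemma eigenbasis_qform:
  assumes "eigenbasis n A e"
  shows "qform n A y = (\<Sum>k<n. eig A (Suc k) * (cmod (ip n (e k) y))\<^sup>2)"
proof -
  have row: "(\<Sum>j<n. A $$ (i, j) * y j) = (\<Sum>k<n. (ip n (e k) y * complex_of_real (eig A (Suc k))) * e k i)"
    if "i < n" for i
  proof -
    have "(\<Sum>j<n. A $$ (i, j) * y j) = (\<Sum>j<n. A $$ (i, j) * (\<Sum>k<n. ip n (e k) y * e k j))"
      using assms unfolding eigenbasis_def by (intro sum.cong refl arg_cong2[where f = "(*)"]) auto
    also have "\<dots> = (\<Sum>j<n. \<Sum>k<n. ip n (e k) y * (A $$ (i, j) * e k j))"
      by (simp add: sum_distrib_left mult_ac)
    also have "\<dots> = (\<Sum>k<n. ip n (e k) y * (\<Sum>j<n. A $$ (i, j) * e k j))"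
      by (subst sum.swap) (simp add: sum_distrib_left)
    also have "\<dots> = (\<Sum>k<n. (ip n (e k) y * complex_of_real (eig A (Suc k))) * e k i)"
      using assms that unfolding eigenbasis_def by (intro sum.cong) (auto simp: mult_ac)
    finally show ?thesis .
  qed
  have "(\<Sum>i<n. cnj (y i) * (\<Sum>j<n. A $$ (i, j) * y j)) =
      ip n y (\<lambda>i. \<Sum>k<n. (ip n (e k) y * complex_of_real (eig A (Suc k))) * e k i)"
    unfolding ip_def[of n y] by (rule sum.cong) (simp_all add: row)
  also have "\<dots> = (\<Sum>k<n. ip n (e k) y * complex_of_real (eig A (Suc k)) * ip n y (e k))"
    by (rule ip_sum_right)
  also have "\<dots> = complex_of_real (\<Sum>k<n. eig A (Suc k) * (cmod (ip n (e k) y))\<^sup>2)"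
    by (simp add: complex_norm_square ip_cnj mult_ac del: of_real_power)
  finally show ?thesis unfolding qform_def by simp
qed

lemma qform_rank_one:
  assumes "A \<in> carrier_mat n n"
  shows "qform n (A + rank_one n \<tau> v) y = qform n A y + \<tau> * (cmod (ip n v y))\<^sup>2"
proof -
  have "(\<Sum>i<n. cnj (y i) * (\<Sum>j<n. (A + rank_one n \<tau> v) $$ (i, j) * y j)) =
     (\<Sum>i<n. cnj (y i) * (\<Sum>j<n. A $$ (i, j) * y j) + complex_of_real \<tau> * ip n v y * (cnj (y i) * v i))"
  proof (intro sum.cong refl)
    fix i assume i: "i \<in> {..<n}"
    have "(\<Sum>j<n. (A + rank_one n \<tau> v) $$ (i, j) * y j) =
      (\<Sum>j<n. A $$ (i, j) * y j + complex_of_real \<tau> * v i * (cnj (v j) * y j))"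
      using i assms by (intro sum.cong) (auto simp: rank_one_def algebra_simps)
    also have "\<dots> = (\<Sum>j<n. A $$ (i, j) * y j) + complex_of_real \<tau> * v i * ip n v y"
      by (simp add: sum.distrib ip_def sum_distrib_left)
    finally show "cnj (y i) * (\<Sum>j<n. (A + rank_one n \<tau> v) $$ (i, j) * y j) =
      cnj (y i) * (\<Sum>j<n. A $$ (i, j) * y j) + complex_of_real \<tau> * ip n v y * (cnj (y i) * v i)"
      by (simp add: algebra_simps)
  qed
  also have "\<dots> = (\<Sum>i<n. cnj (y i) * (\<Sum>j<n. A $$ (i, j) * y j)) + complex_of_real \<tau> * ip n v y * ip n y v"
    by (simp add: sum.distrib ip_def sum_distrib_left)
  also have "complex_of_real \<tau> * ip n v y * ip n y v = complex_of_real (\<tau> * (cmod (ip n v y))\<^sup>2)"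
    by (simp add: complex_norm_square ip_cnj mult_ac del: of_real_power)
  finally show ?thesis unfolding qform_def by simp
qed

lemma hermitian_n_carrier: "hermitian_n n A \<Longrightarrow> A \<in> carrier_mat n n"
  by (simp add: hermitian_n_def)

lemma eigenbasis_eig_mono:
  "eigenbasis n A e \<Longrightarrow> k \<le> l \<Longrightarrow> l < n \<Longrightarrow> eig A (Suc k) \<le> eig A (Suc l)"
  by (simp add: eigenbasis_def)

lemma hermitian_rank_one:
  assumes "hermitian_n n A"
  shows "hermitian_n n (A + rank_one n \<tau> v)"
  unfolding hermitian_n_def
proof (intro conjI allI impI)
  show "A + rank_one n \<tau> v \<in> carrier_mat n n" using assms by (auto simp: hermitian_n_def rank_one_def)
  fix i j assume ij: "i < n" "j < n"
  have "A \<in> carrier_mat n n" "A $$ (i, j) = cnj (A $$ (j, i))"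
    using assms ij unfolding hermitian_n_def by blast+
  thus "(A + rank_one n \<tau> v) $$ (i, j) = cnj ((A + rank_one n \<tau> v) $$ (j, i))"
    using ij by (simp add: rank_one_def mult_ac)
qed

section \<open>Dimension counts and variational bounds for perturbed eigenvalues\<close>

lemma underdetermined_system:
  fixes B :: "nat \<Rightarrow> nat \<Rightarrow> complex"
  assumes "m < K"
  obtains c where "\<exists>j<K. c j \<noteq> 0" "\<And>i. i < m \<Longrightarrow> (\<Sum>j<K. c j * B i j) = 0"
proof -
  define M where "M = mat K K (\<lambda>(i, j). if i < m then B i j else 0)"
  have M: "M \<in> carrier_mat K K" by (simp add: M_def)
  have "M = mat\<^sub>r K K (\<lambda>i. if i = m then 0\<^sub>v K else row M i)"
    using assms by (intro eq_matI) (auto simp: M_def)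
  moreover have "det (mat\<^sub>r K K (\<lambda>i. if i = m then 0\<^sub>v K else row M i)) = 0"
    by (rule det_row_0) (use assms M in auto)
  ultimately have "det M = 0" by simp
  then obtain v where v: "v \<in> carrier_vec K" "v \<noteq> 0\<^sub>v K" "M *\<^sub>v v = 0\<^sub>v K"
    using det_0_iff_vec_prod_zero[OF M] by auto
  show ?thesis
  proof (rule that[of "\<lambda>j. vec_index v j"])
    show "\<exists>j<K. vec_index v j \<noteq> 0" using v(1,2) by (metis carrier_vecD eq_vecI index_zero_vec(1) index_zero_vec(2))
    fix i assume i: "i < m"
    have "vec_index (M *\<^sub>v v) i = 0" using v(3) i assms by simp
    thus "(\<Sum>j<K. vec_index v j * B i j) = 0"
      using i assms v(1) by (simp add: M_def scalar_prod_def lessThan_atLeast0 mult.commute)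
  qed
qed

lemma weighted_cauchy_schwarz:
  fixes a b :: "nat \<Rightarrow> complex"
  assumes "\<And>k. k \<in> S \<Longrightarrow> t k > 0"
  shows "(cmod (\<Sum>k\<in>S. cnj (a k) * b k))\<^sup>2 \<le> (\<Sum>k\<in>S. (cmod (a k))\<^sup>2 / t k) * (\<Sum>k\<in>S. t k * (cmod (b k))\<^sup>2)"
proof -
  have "cmod (\<Sum>k\<in>S. cnj (a k) * b k) \<le> (\<Sum>k\<in>S. cmod (cnj (a k) * b k))" by (rule norm_sum)
  also have "\<dots> = (\<Sum>k\<in>S. (cmod (a k) / sqrt (t k)) * (sqrt (t k) * cmod (b k)))"
    using assms by (intro sum.cong) (auto simp: norm_mult less_imp_neq[symmetric])
  finally have "(cmod (\<Sum>k\<in>S. cnj (a k) * b k))\<^sup>2 \<le>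
    (\<Sum>k\<in>S. (cmod (a k) / sqrt (t k)) * (sqrt (t k) * cmod (b k)))\<^sup>2" by (intro power_mono) auto
  also have "\<dots> \<le> (\<Sum>k\<in>S. (cmod (a k) / sqrt (t k))\<^sup>2) * (\<Sum>k\<in>S. (sqrt (t k) * cmod (b k))\<^sup>2)"
    by (rule Cauchy_Schwarz_ineq_sum)
  also have "\<dots> = (\<Sum>k\<in>S. (cmod (a k))\<^sup>2 / t k) * (\<Sum>k\<in>S. t k * (cmod (b k))\<^sup>2)"
    using assms by (intro arg_cong2[where f = "(*)"] sum.cong) (auto simp: power_divide power_mult_distrib less_imp_le)
  finally show ?thesis .
qed

text \<open>One half of Courant-Fischer: i+1 coefficients suffice to make a combination of the f_j
  orthogonal to g_0, ..., g_(i-1), and on that orthogonal complement the form is at least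
  \<open>eig B (Suc i)\<close>. The f_j may be dependent, so only the coefficient vector is known to
  be nonzero; each use has to show that the resulting vector is nonzero as well.\<close>

lemma exists_combination_above:
  assumes g: "eigenbasis n B g" and "i < n"
  obtains c where "\<exists>j\<le>i. c j \<noteq> 0"
    "eig B (Suc i) * (\<Sum>k<n. (cmod (\<Sum>j\<le>i. c j * f j k))\<^sup>2) \<le> qform n B (\<lambda>k. \<Sum>j\<le>i. c j * f j k)"
proof -
  have gm: "eig B (Suc k) \<le> eig B (Suc l)" if "k \<le> l" "l < n" for k l
    using g that by (simp add: eigenbasis_def)
  obtain c where c: "\<exists>j<Suc i. c j \<noteq> 0" "\<And>l. l < i \<Longrightarrow> (\<Sum>j<Suc i. c j * ip n (g l) (f j)) = 0"
    using underdetermined_system[of i "Suc i" "\<lambda>l j. ip n (g l) (f j)"] by auto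
  let ?y = "\<lambda>k. \<Sum>j\<le>i. c j * f j k"
  have y0: "ip n (g l) ?y = 0" if "l < i" for l
    using c(2)[OF that] by (simp add: ip_sum_right lessThan_Suc_atMost)
  have "eig B (Suc i) * sqnorm n ?y = (\<Sum>k<n. eig B (Suc i) * (cmod (ip n (g k) ?y))\<^sup>2)"
    by (simp add: eigenbasis_norm[OF g, of ?y] sum_distrib_left)
  also have "\<dots> \<le> (\<Sum>k<n. eig B (Suc k) * (cmod (ip n (g k) ?y))\<^sup>2)"
  proof (intro sum_mono)
    fix k assume "k \<in> {..<n}"
    then show "eig B (Suc i) * (cmod (ip n (g k) ?y))\<^sup>2 \<le> eig B (Suc k) * (cmod (ip n (g k) ?y))\<^sup>2"
      using gm[of i k] y0[of k] by (cases "k < i") (auto intro: mult_right_mono)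
  qed
  finally show ?thesis using c(1) by (intro that[of c]) (auto simp: eigenbasis_qform[OF g] less_Suc_eq_le)
qed

text \<open>The other half: the span of g_0, ..., g_i, on which the form is at most
  \<open>eig B (Suc i)\<close>, has dimension exceeding the number m of linear conditions. Since the
  g_j are orthonormal, the vector found is nonzero, whatever the f_l are.\<close>

lemma exists_combination_below:
  assumes g: "eigenbasis n B g" and "i < n" and "m \<le> i"
  obtains y where "sqnorm n y > 0" "\<And>l. l < m \<Longrightarrow> ip n (f l) y = 0"
    "qform n B y \<le> eig B (Suc i) * sqnorm n y"
proof -
  have gm: "eig B (Suc k) \<le> eig B (Suc l)" if "k \<le> l" "l < n" for k l
    using g that by (simp add: eigenbasis_def)
  obtain c where c: "\<exists>j<Suc i. c j \<noteq> 0" "\<And>l. l < m \<Longrightarrow> (\<Sum>j<Suc i. c j * ip n (f l) (g j)) = 0"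
    using underdetermined_system[of m "Suc i" "\<lambda>l j. ip n (f l) (g j)"] \<open>m \<le> i\<close> by auto
  define y where "y = (\<lambda>k. \<Sum>j<Suc i. c j * g j k)"
  have y: "ip n (g k) y = (if k \<le> i then c k else 0)" if "k < n" for k
    unfolding y_def using that \<open>i < n\<close>
    by (subst ip_combination[OF eigenbasis_orthonormal[OF g]]) auto
  obtain j where j: "j < Suc i" "c j \<noteq> 0" using c(1) by auto
  have pos: "sqnorm n y > 0"
    by (rule eigenbasis_norm_pos[OF g, of j]) (use y[of j] j \<open>i < n\<close> in auto)
  have orth: "ip n (f l) y = 0" if "l < m" for l
    unfolding y_def ip_sum_right using c(2)[OF that] .
  have "qform n B y = (\<Sum>k<n. eig B (Suc k) * (cmod (ip n (g k) y))\<^sup>2)" by (rule eigenbasis_qform[OF g])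
  also have "\<dots> \<le> (\<Sum>k<n. eig B (Suc i) * (cmod (ip n (g k) y))\<^sup>2)"
  proof (intro sum_mono)
    fix k assume "k \<in> {..<n}"
    then show "eig B (Suc k) * (cmod (ip n (g k) y))\<^sup>2 \<le> eig B (Suc i) * (cmod (ip n (g k) y))\<^sup>2"
      using gm[of k i] y[of k] \<open>i < n\<close> by (cases "k \<le> i") (auto intro: mult_right_mono)
  qed
  also have "\<dots> = eig B (Suc i) * sqnorm n y"
    by (simp add: eigenbasis_norm[OF g, of y] sum_distrib_left)
  finally show ?thesis using pos orth by (intro that[of y]) auto
qed

context
  fixes n :: nat and A :: "complex mat" and e :: "nat \<Rightarrow> nat \<Rightarrow> complex"
    and \<tau> :: real and v :: "nat \<Rightarrow> complex"
  assumes A: "hermitian_n n A" and e: "eigenbasis n A e" and tau: "\<tau> \<le> 0"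
begin

lemma rank_one_eig_le:
  assumes "i < n"
  shows "eig (A + rank_one n \<tau> v) (Suc i) \<le> eig A (Suc i)"
proof -
  let ?B = "A + rank_one n \<tau> v"
  obtain g where g: "eigenbasis n ?B g" using hermitian_eigenbasis[OF hermitian_rank_one[OF A]] by auto
  obtain c where c: "\<exists>j\<le>i. c j \<noteq> 0"
    "eig ?B (Suc i) * (\<Sum>k<n. (cmod (\<Sum>j\<le>i. c j * e j k))\<^sup>2) \<le> qform n ?B (\<lambda>k. \<Sum>j\<le>i. c j * e j k)"
    by (rule exists_combination_above[OF g assms, where f = e]) (rule that)
  define y where "y = (\<lambda>k. \<Sum>j\<le>i. c j * e j k)"
  have y: "ip n (e k) y = (if k \<le> i then c k else 0)" if "k < n" for k
    unfolding y_def using that assms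
    by (subst ip_combination[OF eigenbasis_orthonormal[OF e]]) auto
  obtain j where j: "j \<le> i" "c j \<noteq> 0" using c(1) by auto
  have pos: "sqnorm n y > 0"
    by (rule eigenbasis_norm_pos[OF e, of j]) (use y[of j] j assms in auto)
  have "eig ?B (Suc i) * sqnorm n y \<le> qform n ?B y" using c(2) by (simp add: y_def)
  also have "\<dots> \<le> qform n A y"
    using tau by (simp add: qform_rank_one[OF hermitian_n_carrier[OF A]] mult_nonpos_nonneg)
  also have "\<dots> = (\<Sum>k<n. eig A (Suc k) * (cmod (ip n (e k) y))\<^sup>2)" by (rule eigenbasis_qform[OF e])
  also have "\<dots> \<le> (\<Sum>k<n. eig A (Suc i) * (cmod (ip n (e k) y))\<^sup>2)"
  proof (intro sum_mono)
    fix k assume "k \<in> {..<n}"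
    then show "eig A (Suc k) * (cmod (ip n (e k) y))\<^sup>2 \<le> eig A (Suc i) * (cmod (ip n (e k) y))\<^sup>2"
      using eigenbasis_eig_mono[OF e, of k i] y[of k] assms by (cases "k \<le> i") (auto intro: mult_right_mono)
  qed
  also have "\<dots> = eig A (Suc i) * sqnorm n y"
    by (simp add: eigenbasis_norm[OF e, of y] sum_distrib_left)
  finally show ?thesis using pos by simp
qed

lemma rank_one_eig_ge:
  assumes "Suc i < n"
  shows "eig A (Suc i) \<le> eig (A + rank_one n \<tau> v) (Suc (Suc i))"
proof -
  let ?B = "A + rank_one n \<tau> v"
  obtain g where g: "eigenbasis n ?B g" using hermitian_eigenbasis[OF hermitian_rank_one[OF A]] by auto
  obtain y where y: "sqnorm n y > 0"
      "\<And>l. l < Suc i \<Longrightarrow> ip n ((e(i := v)) l) y = 0"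
      "qform n ?B y \<le> eig ?B (Suc (Suc i)) * sqnorm n y"
    \<comment> \<open>The vector v takes slot i of the basis, so y is orthogonal to e_0, ...,
      e_(i-1) and to v; on such y the perturbation is invisible.\<close>
    by (rule exists_combination_below[OF g assms order.refl, where f = "e(i := v)"]) (rule that)
  have yv: "ip n v y = 0" using y(2)[of i] by simp
  have ye: "ip n (e k) y = 0" if "k < i" for k using y(2)[of k] that by simp
  have "eig A (Suc i) * sqnorm n y = (\<Sum>k<n. eig A (Suc i) * (cmod (ip n (e k) y))\<^sup>2)"
    by (simp add: eigenbasis_norm[OF e, of y] sum_distrib_left)
  also have "\<dots> \<le> (\<Sum>k<n. eig A (Suc k) * (cmod (ip n (e k) y))\<^sup>2)"
  proof (intro sum_mono)
    fix k assume "k \<in> {..<n}"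
    then show "eig A (Suc i) * (cmod (ip n (e k) y))\<^sup>2 \<le> eig A (Suc k) * (cmod (ip n (e k) y))\<^sup>2"
      using eigenbasis_eig_mono[OF e, of i k] ye[of k] by (cases "k < i") (auto intro: mult_right_mono)
  qed
  also have "\<dots> = qform n A y" by (rule eigenbasis_qform[OF e, symmetric])
  also have "\<dots> = qform n ?B y" by (simp add: qform_rank_one[OF hermitian_n_carrier[OF A]] yv)
  also note y(3)
  finally show ?thesis using y(1) by simp
qed

text \<open>For y orthogonal to e_0, ..., e_(i-1), Cauchy-Schwarz with weights \<lambda>_k - z
  bounds |<v, y>|^2 by the resolvent sum times the excess of the form of A over z times the squared
  norm. If the sum is at most 1/|\<tau>|, the perturbation cannot use up this excess. The
  orthogonality is why only indices from i on enter.\<close>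

lemma rank_one_eig_ge_of_resolvent:
  assumes "i < n" and z: "z < eig A (Suc i)"
    and f: "\<bar>\<tau>\<bar> * (\<Sum>k=i..<n. (cmod (ip n (e k) v))\<^sup>2 / (eig A (Suc k) - z)) \<le> 1"
  shows "z \<le> eig (A + rank_one n \<tau> v) (Suc i)"
proof -
  let ?B = "A + rank_one n \<tau> v"
  obtain g where g: "eigenbasis n ?B g" using hermitian_eigenbasis[OF hermitian_rank_one[OF A]] by auto
  obtain y where y: "sqnorm n y > 0"
      "\<And>l. l < i \<Longrightarrow> ip n (e l) y = 0"
      "qform n ?B y \<le> eig ?B (Suc i) * sqnorm n y"
    by (rule exists_combination_below[OF g assms(1) order.refl, where f = e]) (rule that)
  have split: "(\<Sum>k<n. h k) = (\<Sum>k=i..<n. h k)" if "\<And>k. k < i \<Longrightarrow> h k = 0" for h :: "nat \<Rightarrow> 'z::comm_monoid_add"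
    using that assms(1) by (intro sum.mono_neutral_right) auto
  have tpos: "eig A (Suc k) - z > 0" if "k \<in> {i..<n}" for k
    using eigenbasis_eig_mono[OF e, of i k] that z by auto
  define S where "S = (\<Sum>k=i..<n. (eig A (Suc k) - z) * (cmod (ip n (e k) y))\<^sup>2)"
  have S0: "S \<ge> 0" unfolding S_def by (intro sum_nonneg mult_nonneg_nonneg) (use tpos in \<open>auto intro: less_imp_le\<close>)
  have ipv: "ip n v y = (\<Sum>k=i..<n. cnj (ip n (e k) v) * ip n (e k) y)"
    unfolding eigenbasis_ip[OF e, of v y] by (rule split) (simp add: y(2))
  have "(cmod (ip n v y))\<^sup>2 \<le> (\<Sum>k=i..<n. (cmod (ip n (e k) v))\<^sup>2 / (eig A (Suc k) - z)) * S"
    unfolding ipv S_def by (rule weighted_cauchy_schwarz) (use tpos in auto)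
  hence "\<bar>\<tau>\<bar> * (cmod (ip n v y))\<^sup>2 \<le> \<bar>\<tau>\<bar> * ((\<Sum>k=i..<n. (cmod (ip n (e k) v))\<^sup>2 / (eig A (Suc k) - z)) * S)"
    by (rule mult_left_mono) simp
  also have "\<dots> \<le> 1 * S" unfolding mult.assoc[symmetric] by (rule mult_right_mono[OF f S0])
  finally have 1: "\<bar>\<tau>\<bar> * (cmod (ip n v y))\<^sup>2 \<le> S" by simp
  have "qform n A y - z * sqnorm n y = (\<Sum>k<n. (eig A (Suc k) - z) * (cmod (ip n (e k) y))\<^sup>2)"
    by (simp add: eigenbasis_qform[OF e] eigenbasis_norm[OF e, of y] sum_distrib_left sum_subtractf[symmetric] algebra_simps)
  also have "\<dots> = S" unfolding S_def by (rule split) (simp add: y(2))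
  finally have "z * sqnorm n y = qform n A y - S" by simp
  also have "\<dots> \<le> qform n A y + \<tau> * (cmod (ip n v y))\<^sup>2" using 1 tau by simp
  also have "\<dots> = qform n ?B y" by (simp add: qform_rank_one[OF hermitian_n_carrier[OF A]])
  also note y(3)
  finally show ?thesis using y(1) by simp
qed

text \<open>The trial space is spanned by e_0, ..., e_(i-1) and one vector \<open>y0\<close>, the
  part of (z - A)^(-1) v along the remaining e_k. This is the shape of an eigenvector of the
  perturbed matrix at z, hence nearly optimal. On that space the perturbed form is at most z times
  the squared norm.\<close>

lemma rank_one_eig_le_of_resolvent:
  assumes "i < n" and z: "z < eig A (Suc i)" and z': "\<And>k. k < i \<Longrightarrow> eig A (Suc k) < z"
    and tau0: "\<tau> < 0"
    and f: "1 / \<bar>\<tau>\<bar> + (\<Sum>k<i. (cmod (ip n (e k) v))\<^sup>2 / (z - eig A (Suc k))) \<le>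
            (\<Sum>k=i..<n. (cmod (ip n (e k) v))\<^sup>2 / (eig A (Suc k) - z))"
  shows "eig (A + rank_one n \<tau> v) (Suc i) \<le> z"
proof -
  let ?B = "A + rank_one n \<tau> v"
  define la where "la k = eig A (Suc k)" for k
  define w where "w k = ip n (e k) v" for k
  define P where "P = (\<Sum>k=i..<n. (cmod (w k))\<^sup>2 / (la k - z))"
  define R where "R = (\<Sum>k<i. (cmod (w k))\<^sup>2 / (z - la k))"
  have fP: "1 / \<bar>\<tau>\<bar> + R \<le> P" using f by (simp add: P_def R_def la_def w_def)
  have lo: "z - la k > 0" if "k < i" for k using z' that by (simp add: la_def)
  have hi: "la k - z > 0" if "i \<le> k" "k < n" for k using eigenbasis_eig_mono[OF e, of i k] that z by (simp add: la_def)
  have R0: "R \<ge> 0" unfolding R_def by (intro sum_nonneg divide_nonneg_nonneg) (use lo in \<open>auto intro: less_imp_le\<close>)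
  have "1 / \<bar>\<tau>\<bar> > 0" using tau0 by simp
  hence P0: "P > 0" using fP R0 by linarith
  obtain g where g: "eigenbasis n ?B g" using hermitian_eigenbasis[OF hermitian_rank_one[OF A]] by auto
  define y0 where "y0 = (\<lambda>i'. \<Sum>k=i..<n. (w k / complex_of_real (z - la k)) * e k i')"
  have y0: "ip n (e k) y0 = (if i \<le> k then w k / complex_of_real (z - la k) else 0)" if "k < n" for k
    unfolding y0_def using that by (subst ip_combination[OF eigenbasis_orthonormal[OF e]]) auto
  obtain c where c: "\<exists>j\<le>i. c j \<noteq> 0"
    "eig ?B (Suc i) * (\<Sum>k<n. (cmod (\<Sum>j\<le>i. c j * (e(i := y0)) j k))\<^sup>2) \<le> qform n ?B (\<lambda>k. \<Sum>j\<le>i. c j * (e(i := y0)) j k)"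
    by (rule exists_combination_above[OF g assms(1), where f = "e(i := y0)"]) (rule that)
  define y where "y = (\<lambda>k. \<Sum>j\<le>i. c j * (e(i := y0)) j k)"
  have y: "ip n (e k) y = (if k < i then c k else c i * (w k / complex_of_real (z - la k)))" if "k < n" for k
  proof -
    have "ip n (e k) y = (\<Sum>j\<le>i. c j * ip n (e k) ((e(i := y0)) j))" unfolding y_def by (rule ip_sum_right)
    also have "\<dots> = (\<Sum>j<i. c j * ip n (e k) (e j)) + c i * ip n (e k) y0"
      by (simp add: lessThan_Suc_atMost[symmetric])
    also have "(\<Sum>j<i. c j * ip n (e k) (e j)) = (\<Sum>j<i. if j = k then c j else 0)"
      using e that assms(1) by (intro sum.cong) (auto simp: eigenbasis_def)
    finally show ?thesis using y0[OF that] by auto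
  qed
  have splt: "(\<Sum>k<n. h k) = (\<Sum>k<i. h k) + (\<Sum>k=i..<n. h k)" for h :: "nat \<Rightarrow> 'z::comm_monoid_add"
    using assms(1) sum.atLeastLessThan_concat[of 0 i n h] by (simp add: lessThan_atLeast0)
  have pos: "sqnorm n y > 0"
  proof -
    \<comment> \<open>A nonzero coefficient vector could still produce the zero vector if
      \<open>y0\<close> were zero; P > 0 excludes this.\<close>
    have "\<exists>k<n. ip n (e k) y \<noteq> 0"
    proof (rule ccontr)
      assume "\<not> ?thesis"
      hence 0: "ip n (e k) y = 0" if "k < n" for k using that by auto
      have c0: "c k = 0" if "k < i" for k using 0[of k] y[of k] that assms(1) by simp
      with c(1) have "c i \<noteq> 0" by (metis le_neq_implies_less)
      hence "w k = 0" if "i \<le> k" "k < n" for k using 0[of k] y[of k] that hi[of k] by auto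
      hence "P = 0" unfolding P_def by simp
      with P0 show False by simp
    qed
    then obtain j where j: "j < n" "ip n (e j) y \<noteq> 0" by auto
    thus ?thesis by (rule eigenbasis_norm_pos[OF e])
  qed
  define D where "D = (\<Sum>k<i. (z - la k) * (cmod (c k))\<^sup>2)"
  have D0: "D \<ge> 0" unfolding D_def by (intro sum_nonneg mult_nonneg_nonneg) (use lo in \<open>auto intro: less_imp_le\<close>)
  have "qform n A y - z * sqnorm n y = (\<Sum>k<n. (la k - z) * (cmod (ip n (e k) y))\<^sup>2)"
    by (simp add: eigenbasis_qform[OF e] eigenbasis_norm[OF e, of y] sum_distrib_left sum_subtractf[symmetric] algebra_simps la_def)
  also have "\<dots> = (\<Sum>k<i. (la k - z) * (cmod (c k))\<^sup>2) + (\<Sum>k=i..<n. (cmod (c i))\<^sup>2 * ((cmod (w k))\<^sup>2 / (la k - z)))"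
  proof (subst splt, intro arg_cong2[where f = "(+)"] sum.cong refl)
    fix k assume "k \<in> {..<i}"
    then show "(la k - z) * (cmod (ip n (e k) y))\<^sup>2 = (la k - z) * (cmod (c k))\<^sup>2" using y[of k] assms(1) by simp
  next
    fix k assume k: "k \<in> {i..<n}"
    have "cmod (ip n (e k) y) = cmod (c i) * cmod (w k) / (la k - z)"
      using k y[of k] hi[of k] by (simp add: norm_mult norm_divide del: of_real_diff)
    thus "(la k - z) * (cmod (ip n (e k) y))\<^sup>2 = (cmod (c i))\<^sup>2 * ((cmod (w k))\<^sup>2 / (la k - z))"
      using k hi[of k] by (simp add: power_divide power_mult_distrib) (simp add: power2_eq_square)
  qed
  also have "\<dots> = - D + (cmod (c i))\<^sup>2 * P"
    by (simp add: D_def P_def sum_distrib_left sum_negf[symmetric] algebra_simps)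
  finally have qA: "qform n A y = z * sqnorm n y - D + (cmod (c i))\<^sup>2 * P" by simp
  define s where "s = (\<Sum>k<i. cnj (w k) * c k)"
  have "ip n v y = (\<Sum>k<i. cnj (w k) * ip n (e k) y) + (\<Sum>k=i..<n. cnj (w k) * ip n (e k) y)"
    unfolding eigenbasis_ip[OF e, of v y] w_def by (rule splt)
  also have "(\<Sum>k<i. cnj (w k) * ip n (e k) y) = s"
    unfolding s_def using assms(1) by (intro sum.cong) (auto simp: y)
  also have "(\<Sum>k=i..<n. cnj (w k) * ip n (e k) y) = (\<Sum>k=i..<n. - c i * complex_of_real ((cmod (w k))\<^sup>2 / (la k - z)))"
  proof (intro sum.cong refl)
    fix k assume k: "k \<in> {i..<n}"
    have "cnj (w k) * ip n (e k) y = c i * (cnj (w k) * w k) / complex_of_real (z - la k)"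
      using k y[of k] by simp
    also have "cnj (w k) * w k = complex_of_real ((cmod (w k))\<^sup>2)"
      by (simp only: complex_norm_square mult.commute)
    also have "complex_of_real (z - la k) = - complex_of_real (la k - z)" by simp
    finally show "cnj (w k) * ip n (e k) y = - c i * complex_of_real ((cmod (w k))\<^sup>2 / (la k - z))"
      by (simp only: of_real_divide divide_minus_right times_divide_eq_right mult_minus_left minus_divide_left)
  qed
  also have "\<dots> = - c i * complex_of_real P"
    by (simp only: sum_distrib_left[symmetric] P_def of_real_sum)
  finally have vy: "ip n v y = s + - c i * complex_of_real P" .
  define T where "T = cmod (ip n v y)"
  have "complex_of_real P * c i = s - ip n v y" using vy by simp
  hence "P * cmod (c i) = cmod (s - ip n v y)" using P0
    by (metis abs_of_pos norm_mult norm_of_real)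
  hence cP: "P * cmod (c i) \<le> cmod s + T" unfolding T_def by (simp add: norm_triangle_ineq4)
  have "(cmod s)\<^sup>2 \<le> (\<Sum>k<i. (cmod (w k))\<^sup>2 / (z - la k)) * (\<Sum>k<i. (z - la k) * (cmod (c k))\<^sup>2)"
    unfolding s_def by (rule weighted_cauchy_schwarz) (use lo in auto)
  hence s2: "(cmod s)\<^sup>2 \<le> R * D" by (simp add: R_def D_def)
  \<comment> \<open>Cauchy-Schwarz in the plane for the pairs (sqrt R, sqrt (1/|\<tau>|)) and (sqrt
    D, sqrt |\<tau>| T). The first pair has squared length 1/|\<tau>| + R, which the hypothesis
    bounds by P; one factor P then cancels against P |c_i| \<le> |s| + T.\<close>
  have "(cmod s + T)\<^sup>2 \<le> (1 / \<bar>\<tau>\<bar> + R) * (\<bar>\<tau>\<bar> * T\<^sup>2 + D)"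
  proof -
    have "cmod s \<le> sqrt R * sqrt D" using s2 R0 D0
      by (metis real_sqrt_le_iff real_sqrt_mult real_sqrt_abs abs_norm_cancel)
    moreover have "sqrt (1 / \<bar>\<tau>\<bar>) * sqrt \<bar>\<tau>\<bar> = 1"
      using tau0 unfolding real_sqrt_mult[symmetric] by simp
    hence "T = sqrt (1 / \<bar>\<tau>\<bar>) * (sqrt \<bar>\<tau>\<bar> * T)" by (simp only: mult.assoc[symmetric] mult_1)
    ultimately have "cmod s + T \<le> sqrt R * sqrt D + sqrt (1 / \<bar>\<tau>\<bar>) * (sqrt \<bar>\<tau>\<bar> * T)" by linarith
    hence "(cmod s + T)\<^sup>2 \<le> (sqrt R * sqrt D + sqrt (1 / \<bar>\<tau>\<bar>) * (sqrt \<bar>\<tau>\<bar> * T))\<^sup>2"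
      by (rule power_mono) (simp add: T_def)
    also have "\<dots> \<le> ((sqrt R)\<^sup>2 + (sqrt (1 / \<bar>\<tau>\<bar>))\<^sup>2) * ((sqrt D)\<^sup>2 + (sqrt \<bar>\<tau>\<bar> * T)\<^sup>2)"
    proof -
      have "(a * b + a' * b')\<^sup>2 \<le> (a\<^sup>2 + a'\<^sup>2) * (b\<^sup>2 + b'\<^sup>2)" for a a' b b' :: real
        using zero_le_power2[of "a * b' - a' * b"] by (simp add: power2_eq_square algebra_simps)
      thus ?thesis .
    qed
    also have "\<dots> = (1 / \<bar>\<tau>\<bar> + R) * (\<bar>\<tau>\<bar> * T\<^sup>2 + D)"
      using R0 D0 by (simp add: power_mult_distrib add.commute)
    finally show ?thesis .
  qed
  also have "\<dots> \<le> P * (\<bar>\<tau>\<bar> * T\<^sup>2 + D)" using fP D0 by (intro mult_right_mono) auto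
  finally have "(P * cmod (c i))\<^sup>2 \<le> P * (\<bar>\<tau>\<bar> * T\<^sup>2 + D)"
    using power_mono[OF cP, of 2] P0 by simp
  hence "P * ((cmod (c i))\<^sup>2 * P) \<le> P * (\<bar>\<tau>\<bar> * T\<^sup>2 + D)" by (simp add: power2_eq_square mult_ac)
  hence fin: "(cmod (c i))\<^sup>2 * P \<le> \<bar>\<tau>\<bar> * T\<^sup>2 + D" using P0 by simp
  have "eig ?B (Suc i) * sqnorm n y \<le> qform n ?B y" using c(2) by (simp add: y_def)
  also have "\<dots> = qform n A y + \<tau> * T\<^sup>2" by (simp add: qform_rank_one[OF hermitian_n_carrier[OF A]] T_def)
  also have "\<dots> \<le> z * sqnorm n y" using qA fin tau by simp
  finally show ?thesis using pos by simp
qed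

end

section \<open>Moments from the logarithmic Sobolev inequality\<close>

text \<open>A Poincare-type inequality obtained without linearising around constants: with m and A
  the means of f and f^2, the pointwise bound below integrates to 2 A - m^2 - A, the variance of f.
  The lower bound 1 keeps the logarithms nonnegative, the upper bound C makes everything
  integrable.\<close>

lemma variance_le_entropy_sq:
  fixes f :: "complex \<Rightarrow> real"
  assumes nu: "prob_space \<nu>" and meas: "f \<in> borel_measurable \<nu>"
    and ge1: "\<And>z. 1 \<le> f z" and le: "\<And>z. f z \<le> C"
  shows "(\<integral>z. (f z)\<^sup>2 \<partial>\<nu>) - (\<integral>z. f z \<partial>\<nu>)\<^sup>2 \<le> entropy_sq \<nu> f"
proof -
  interpret prob_space \<nu> by fact
  have C1: "1 \<le> C" using ge1[of 0] le[of 0] by linarith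
  have bd: "\<bar>(f z)\<^sup>2\<bar> \<le> C\<^sup>2" for z using ge1[of z] le[of z] by (simp add: power_mono)
  have i1: "integrable \<nu> f"
    by (rule integrable_const_bound[where B = C]) (use ge1 le meas in \<open>auto intro: AE_I2 simp: abs_of_nonneg order_trans[OF zero_le_one]\<close>)
  have i2: "integrable \<nu> (\<lambda>z. (f z)\<^sup>2)"
    by (rule integrable_const_bound[where B = "C\<^sup>2"]) (use bd meas in \<open>auto intro: AE_I2\<close>)
  have lnb: "0 \<le> ln ((f z)\<^sup>2)" "ln ((f z)\<^sup>2) \<le> ln (C\<^sup>2)" for z
  proof -
    have "1 \<le> (f z)\<^sup>2" using ge1[of z] by (simp add: one_le_power)
    moreover have "(f z)\<^sup>2 \<le> C\<^sup>2" using bd[of z] by simp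
    ultimately show "0 \<le> ln ((f z)\<^sup>2)" "ln ((f z)\<^sup>2) \<le> ln (C\<^sup>2)"
      by (simp_all del: ln_realpow) (subst ln_le_cancel_iff; linarith)
  qed
  have i3: "integrable \<nu> (\<lambda>z. (f z)\<^sup>2 * ln ((f z)\<^sup>2))"
  proof (rule integrable_const_bound[where B = "C\<^sup>2 * ln (C\<^sup>2)"])
    have "norm ((f z)\<^sup>2 * ln ((f z)\<^sup>2)) \<le> C\<^sup>2 * ln (C\<^sup>2)" for z
      unfolding norm_mult using bd[of z] lnb[of z] by (intro mult_mono) auto
    thus "AE z in \<nu>. norm ((f z)\<^sup>2 * ln ((f z)\<^sup>2)) \<le> C\<^sup>2 * ln (C\<^sup>2)" by simp
  qed (use meas in measurable)
  define A where "A = (\<integral>z. (f z)\<^sup>2 \<partial>\<nu>)"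
  define m where "m = (\<integral>z. f z \<partial>\<nu>)"
  have m1: "1 \<le> m" unfolding m_def using integral_mono[OF integrable_const i1, of 1] ge1 by (simp add: prob_space)
  have A1: "1 \<le> A" unfolding A_def using integral_mono[OF integrable_const i2, of 1] ge1 by (simp add: prob_space one_le_power)
  \<comment> \<open>\<open>ln (f\<^sup>2 / A) = ln (f / m) + ln (f m / A)\<close> and \<open>ln t \<ge> 1 - 1 / t\<close>\<close>
  have pt: "2 * (f z)\<^sup>2 - m * f z - A / m * f z \<le> (f z)\<^sup>2 * ln ((f z)\<^sup>2) - ln A * (f z)\<^sup>2" for z
  proof -
    have fp: "f z > 0" using ge1[of z] by linarith
    have "ln (m / f z) \<le> m / f z - 1" using fp m1 by (intro ln_le_minus_one) auto
    moreover have "ln (A / (f z * m)) \<le> A / (f z * m) - 1" using fp m1 A1 by (intro ln_le_minus_one) auto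
    moreover have "ln (m / f z) + ln (A / (f z * m)) = ln A - ln ((f z)\<^sup>2)"
      using fp m1 A1 by (simp add: ln_div ln_mult ln_realpow)
    ultimately have "2 - m / f z - A / (f z * m) \<le> ln ((f z)\<^sup>2) - ln A" by linarith
    hence "(f z)\<^sup>2 * (2 - m / f z - A / (f z * m)) \<le> (f z)\<^sup>2 * (ln ((f z)\<^sup>2) - ln A)"
      by (rule mult_left_mono) simp
    moreover have "(f z)\<^sup>2 * (2 - m / f z - A / (f z * m)) = 2 * (f z)\<^sup>2 - m * f z - A / m * f z"
      using fp m1 by (simp add: field_simps power2_eq_square)
    ultimately show ?thesis by (simp add: algebra_simps)
  qed
  have "(\<integral>z. 2 * (f z)\<^sup>2 - m * f z - A / m * f z \<partial>\<nu>) \<le> (\<integral>z. (f z)\<^sup>2 * ln ((f z)\<^sup>2) - ln A * (f z)\<^sup>2 \<partial>\<nu>)"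
    by (rule integral_mono) (use i1 i2 i3 pt in auto)
  also have "(\<integral>z. 2 * (f z)\<^sup>2 - m * f z - A / m * f z \<partial>\<nu>) = 2 * A - m * m - A / m * m"
    using i1 i2 by (simp add: A_def m_def)
  also have "(\<integral>z. (f z)\<^sup>2 * ln ((f z)\<^sup>2) - ln A * (f z)\<^sup>2 \<partial>\<nu>) = entropy_sq \<nu> f"
    using i2 i3 by (simp add: entropy_sq_def A_def)
  finally show ?thesis using m1 by (simp add: A_def m_def power2_eq_square)
qed

text \<open>Bounded substitutes for $1 + |z|^2$, since the logarithmic Sobolev inequality is available for bounded
  test functions only; the moment bounds below are uniform in \<open>\<epsilon>\<close>.\<close>

definition sat :: "real \<Rightarrow> complex \<Rightarrow> real" where
  "sat \<epsilon> z = (1 + (cmod z)\<^sup>2) / (1 + \<epsilon> * (cmod z)\<^sup>2)"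

lemma sat_bounds:
  assumes "0 < \<epsilon>" "\<epsilon> \<le> 1"
  shows "1 \<le> sat \<epsilon> z" "sat \<epsilon> z \<le> 1 / \<epsilon>" "sat \<epsilon> z \<le> 1 + (cmod z)\<^sup>2"
    "(cmod z)\<^sup>2 / (1 + \<epsilon> * (cmod z)\<^sup>2) \<le> sat \<epsilon> z"
proof -
  have p: "1 + \<epsilon> * (cmod z)\<^sup>2 > 0" using assms by (simp add: add_pos_nonneg)
  have "\<epsilon> * (cmod z)\<^sup>2 \<le> 1 * (cmod z)\<^sup>2" using assms by (intro mult_right_mono) auto
  thus "1 \<le> sat \<epsilon> z" unfolding sat_def using p by (simp add: le_divide_eq)
  show "sat \<epsilon> z \<le> 1 / \<epsilon>" unfolding sat_def using p assms by (simp add: field_simps)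
  have "(1 + (cmod z)\<^sup>2) * 1 \<le> (1 + (cmod z)\<^sup>2) * (1 + \<epsilon> * (cmod z)\<^sup>2)"
    using assms by (intro mult_left_mono) auto
  thus "sat \<epsilon> z \<le> 1 + (cmod z)\<^sup>2" unfolding sat_def using p by (simp add: divide_le_eq)
  show "(cmod z)\<^sup>2 / (1 + \<epsilon> * (cmod z)\<^sup>2) \<le> sat \<epsilon> z"
    unfolding sat_def using p by (intro divide_right_mono) auto
qed

definition sat_deriv :: "real \<Rightarrow> nat \<Rightarrow> complex \<Rightarrow> complex \<Rightarrow> real" where
  "sat_deriv \<epsilon> k z h = real k * (sat \<epsilon> z) ^ (k - 1) * ((1 - \<epsilon>) * (2 * inner z h) / (1 + \<epsilon> * (cmod z)\<^sup>2)\<^sup>2)"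

lemma has_derivative_sat_power:
  assumes "0 < \<epsilon>"
  shows "((\<lambda>z. sat \<epsilon> z ^ k) has_derivative sat_deriv \<epsilon> k z) (at z)"
proof -
  have p: "1 + \<epsilon> * (cmod z)\<^sup>2 > 0" using assms by (simp add: add_pos_nonneg)
  have q: "1 + \<epsilon> * inner z z > 0" using p by (simp add: power2_norm_eq_inner)
  have "((\<lambda>z. (1 + inner z z) / (1 + \<epsilon> * inner z z)) has_derivative
     (\<lambda>h. (1 - \<epsilon>) * (2 * inner z h) / (1 + \<epsilon> * inner z z)\<^sup>2)) (at z)"
  proof (rule has_derivative_eq_rhs)
    show "((\<lambda>z. (1 + inner z z) / (1 + \<epsilon> * inner z z)) has_derivative
      (\<lambda>h. ((inner z h + inner h z) * (1 + \<epsilon> * inner z z) - (1 + inner z z) * (\<epsilon> * (inner z h + inner h z))) / ((1 + \<epsilon> * inner z z) * (1 + \<epsilon> * inner z z)))) (at z)"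
      using q by (auto intro!: derivative_eq_intros simp: less_imp_neq[symmetric])
    show "(\<lambda>h. ((inner z h + inner h z) * (1 + \<epsilon> * inner z z) - (1 + inner z z) * (\<epsilon> * (inner z h + inner h z))) / ((1 + \<epsilon> * inner z z) * (1 + \<epsilon> * inner z z))) =
      (\<lambda>h. (1 - \<epsilon>) * (2 * inner z h) / (1 + \<epsilon> * inner z z)\<^sup>2)"
      by (rule ext) (simp add: inner_commute power2_eq_square algebra_simps)
  qed
  from has_derivative_power[OF this, of k] show ?thesis
    unfolding sat_def sat_deriv_def power2_norm_eq_inner by (simp add: mult_ac)
qed

lemma onorm_sat_deriv:
  assumes "0 < \<epsilon>" "\<epsilon> \<le> 1"
  shows "onorm (sat_deriv \<epsilon> k z) \<le> real k * (sat \<epsilon> z) ^ (k - 1) * (2 * cmod z / (1 + \<epsilon> * (cmod z)\<^sup>2)\<^sup>2)"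
proof (rule onorm_bound)
  have p: "1 + \<epsilon> * (cmod z)\<^sup>2 > 0" using assms by (simp add: add_pos_nonneg)
  have s: "0 \<le> sat \<epsilon> z" using sat_bounds(1)[OF assms, of z] by linarith
  show "0 \<le> real k * (sat \<epsilon> z) ^ (k - 1) * (2 * cmod z / (1 + \<epsilon> * (cmod z)\<^sup>2)\<^sup>2)" using s by simp
  fix h
  have "\<bar>(1 - \<epsilon>) * (2 * inner z h)\<bar> \<le> 1 * (2 * (cmod z * cmod h))"
    unfolding abs_mult using assms Cauchy_Schwarz_ineq2[of z h] by (intro mult_mono) auto
  hence "\<bar>(1 - \<epsilon>) * (2 * inner z h)\<bar> / (1 + \<epsilon> * (cmod z)\<^sup>2)\<^sup>2 \<le> 2 * cmod z / (1 + \<epsilon> * (cmod z)\<^sup>2)\<^sup>2 * cmod h"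
    by (simp add: divide_right_mono)
  hence "real k * (sat \<epsilon> z) ^ (k - 1) * (\<bar>(1 - \<epsilon>) * (2 * inner z h)\<bar> / (1 + \<epsilon> * (cmod z)\<^sup>2)\<^sup>2) \<le>
    real k * (sat \<epsilon> z) ^ (k - 1) * (2 * cmod z / (1 + \<epsilon> * (cmod z)\<^sup>2)\<^sup>2 * cmod h)"
    using s by (intro mult_left_mono) auto
  thus "norm (sat_deriv \<epsilon> k z h) \<le> real k * (sat \<epsilon> z) ^ (k - 1) * (2 * cmod z / (1 + \<epsilon> * (cmod z)\<^sup>2)\<^sup>2) * norm h"
    using s unfolding sat_deriv_def by (simp add: abs_mult mult_ac)
qed

text \<open>As for 1 + |z|^2 itself, the squared gradient of \<open>sat\<close> is at most 4
  \<open>sat\<close>. Hence the exponent is 2 k - 1 and not 2 k, and this drop by one closes the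
  moment recursion. The second claim, whose bound depends on \<epsilon>, is what admits these
  functions as test functions.\<close>

lemma onorm_sat_deriv_sq:
  assumes "0 < \<epsilon>" "\<epsilon> \<le> 1" "1 \<le> k"
  shows "(onorm (sat_deriv \<epsilon> k z))\<^sup>2 \<le> 4 * (real k)\<^sup>2 * (sat \<epsilon> z) ^ (2 * k - 1)"
    and "\<exists>B. \<forall>z. onorm (sat_deriv \<epsilon> k z) \<le> B"
proof -
  have p: "1 + \<epsilon> * (cmod z)\<^sup>2 \<ge> 1" for z using assms by simp
  have s: "0 \<le> sat \<epsilon> z" for z using sat_bounds(1)[OF assms(1,2), of z] by linarith
  have bl: "bounded_linear (sat_deriv \<epsilon> k z)" for z
    using has_derivative_sat_power[OF assms(1)] by (rule has_derivative_bounded_linear)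
  have *: "(onorm (sat_deriv \<epsilon> k z))\<^sup>2 \<le> 4 * (real k)\<^sup>2 * (sat \<epsilon> z) ^ (2 * k - 1)" for z
  proof -
    have "(onorm (sat_deriv \<epsilon> k z))\<^sup>2 \<le> (real k * (sat \<epsilon> z) ^ (k - 1) * (2 * cmod z / (1 + \<epsilon> * (cmod z)\<^sup>2)\<^sup>2))\<^sup>2"
      by (rule power_mono[OF onorm_sat_deriv[OF assms(1,2)] onorm_pos_le[OF bl]])
    also have "\<dots> = 4 * (real k)\<^sup>2 * (sat \<epsilon> z) ^ (2 * (k - 1)) * ((cmod z)\<^sup>2 / ((1 + \<epsilon> * (cmod z)\<^sup>2)\<^sup>2)\<^sup>2)"
      by (simp add: power_mult_distrib power_divide power_mult[symmetric] mult.commute)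
    also have "\<dots> \<le> 4 * (real k)\<^sup>2 * (sat \<epsilon> z) ^ (2 * (k - 1)) * sat \<epsilon> z"
    proof (rule mult_left_mono[OF order_trans[OF divide_left_mono sat_bounds(4)[OF assms(1,2)]]])
      show "1 + \<epsilon> * (cmod z)\<^sup>2 \<le> ((1 + \<epsilon> * (cmod z)\<^sup>2)\<^sup>2)\<^sup>2"
        using self_le_power[OF p[of z], of 4] by (simp add: power_mult[symmetric])
      have "0 < 1 + \<epsilon> * (cmod z)\<^sup>2" using p[of z] by linarith
      thus "0 < ((1 + \<epsilon> * (cmod z)\<^sup>2)\<^sup>2)\<^sup>2 * (1 + \<epsilon> * (cmod z)\<^sup>2)" by simp
      show "0 \<le> 4 * (real k)\<^sup>2 * (sat \<epsilon> z) ^ (2 * (k - 1))" using s[of z] by simp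
    qed simp
    finally have "(onorm (sat_deriv \<epsilon> k z))\<^sup>2 \<le> 4 * (real k)\<^sup>2 * (sat \<epsilon> z) ^ (2 * (k - 1)) * sat \<epsilon> z" by simp
    also have "4 * (real k)\<^sup>2 * (sat \<epsilon> z) ^ (2 * (k - 1)) * sat \<epsilon> z = 4 * (real k)\<^sup>2 * (sat \<epsilon> z) ^ (2 * k - 1)"
    proof -
      have "2 * k - 1 = Suc (2 * (k - 1))" using assms(3) by simp
      thus ?thesis by (simp add: mult_ac)
    qed
    finally show ?thesis .
  qed
  show "(onorm (sat_deriv \<epsilon> k z))\<^sup>2 \<le> 4 * (real k)\<^sup>2 * (sat \<epsilon> z) ^ (2 * k - 1)" by (rule *)
  show "\<exists>B. \<forall>z. onorm (sat_deriv \<epsilon> k z) \<le> B"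
  proof (intro exI allI)
    fix z
    have "(onorm (sat_deriv \<epsilon> k z))\<^sup>2 \<le> 4 * (real k)\<^sup>2 * (1 / \<epsilon>) ^ (2 * k - 1)"
      using *[of z] power_mono[OF sat_bounds(2)[OF assms(1,2), of z] s, of "2 * k - 1"]
      by (meson mult_left_mono order_trans zero_le_mult_iff zero_le_numeral zero_le_power2)
    thus "onorm (sat_deriv \<epsilon> k z) \<le> sqrt (4 * (real k)\<^sup>2 * (1 / \<epsilon>) ^ (2 * k - 1))"
      by (rule real_le_rsqrt)
  qed
qed

text \<open>With s = \<open>sat \<epsilon>\<close>, testing s^k gives E s^(2k) \<le> (E s^k)^2 + 8 c
  k^2 E s^(2k-1). Starting from E s \<le> 2, the case k = 1 bounds the second moment of s and k = 2
  the fourth, uniformly in \<epsilon>; four moments of 1 + |z|^2 are eight of |z|.\<close>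

lemma assumption_A1_moment8:
  assumes A1: "assumption_A1 \<nu>"
  shows "integrable \<nu> (\<lambda>z. (cmod z) ^ 8)"
proof -
  interpret prob_space \<nu> using A1 by (simp add: assumption_A1_def)
  have sets: "sets \<nu> = sets borel" and ls: "log_sobolev \<nu>"
    and i2: "integrable \<nu> (\<lambda>z. (cmod z)\<^sup>2)" and v1: "(\<integral>z. (cmod z)\<^sup>2 \<partial>\<nu>) = 1"
    using A1 by (auto simp: assumption_A1_def)
  obtain c where c: "c > 0" and LS: "\<And>f f'. (\<And>z. (f has_derivative f' z) (at z)) \<Longrightarrow> bounded (range f) \<Longrightarrow>
      (\<exists>B. \<forall>z. onorm (f' z) \<le> B) \<Longrightarrow> entropy_sq \<nu> f \<le> 2 * c * (\<integral>z. (onorm (f' z))\<^sup>2 \<partial>\<nu>)"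
    using ls unfolding log_sobolev_def by meson
  \<comment> \<open>\<open>M2\<close> is 2^2 + 8 c * 2, the recursion at k = 1. \<open>M4\<close> is
    twice the bound left at k = 2 after half of the fourth moment has moved to the left.\<close>
  define M2 where "M2 = 4 + 16 * c"
  define M4 where "M4 = 2 * M2\<^sup>2 + (32 * c)\<^sup>2 * M2"
  have bnd: "(\<integral>z. sat \<epsilon> z ^ 4 \<partial>\<nu>) \<le> M4" "integrable \<nu> (\<lambda>z. sat \<epsilon> z ^ 4)" if e: "0 < \<epsilon>" "\<epsilon> \<le> 1" for \<epsilon>
  proof -
    have meas: "sat \<epsilon> \<in> borel_measurable \<nu>"
      unfolding measurable_cong_sets[OF sets refl] sat_def by measurable
    have s: "1 \<le> sat \<epsilon> z" "sat \<epsilon> z \<le> 1 / \<epsilon>" for z using sat_bounds[OF e] by auto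
    have s0: "0 \<le> sat \<epsilon> z" for z using s(1)[of z] by linarith
    have int: "integrable \<nu> (\<lambda>z. sat \<epsilon> z ^ k)" for k
      by (rule integrable_const_bound[where B = "(1 / \<epsilon>) ^ k"])
         (use meas s s0 in \<open>auto intro!: AE_I2 power_mono simp: power_abs\<close>)
    have main: "(\<integral>z. sat \<epsilon> z ^ (2 * k) \<partial>\<nu>) \<le> (\<integral>z. sat \<epsilon> z ^ k \<partial>\<nu>)\<^sup>2 + 8 * c * (real k)\<^sup>2 * (\<integral>z. sat \<epsilon> z ^ (2 * k - 1) \<partial>\<nu>)"
      if k: "1 \<le> k" for k
    proof -
      have "(\<integral>z. (sat \<epsilon> z ^ k)\<^sup>2 \<partial>\<nu>) - (\<integral>z. sat \<epsilon> z ^ k \<partial>\<nu>)\<^sup>2 \<le> entropy_sq \<nu> (\<lambda>z. sat \<epsilon> z ^ k)"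
        by (rule variance_le_entropy_sq[where C = "(1 / \<epsilon>) ^ k"])
           (use meas s s0 in \<open>auto intro!: power_mono one_le_power prob_space_axioms\<close>)
      also have "\<dots> \<le> 2 * c * (\<integral>z. (onorm (sat_deriv \<epsilon> k z))\<^sup>2 \<partial>\<nu>)"
      proof (rule LS)
        show "bounded (range (\<lambda>z. sat \<epsilon> z ^ k))"
          by (rule boundedI[where B = "(1 / \<epsilon>) ^ k"]) (use s s0 in \<open>auto intro!: power_mono simp: power_abs\<close>)
      qed (use has_derivative_sat_power[OF e(1)] onorm_sat_deriv_sq(2)[OF e k] in auto)
      also have "\<dots> \<le> 2 * c * (\<integral>z. 4 * (real k)\<^sup>2 * sat \<epsilon> z ^ (2 * k - 1) \<partial>\<nu>)"
        using c s0 by (intro mult_left_mono integral_mono' integrable_mult_right int onorm_sat_deriv_sq(1)[OF e k]) auto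
      also have "\<dots> = 8 * c * (real k)\<^sup>2 * (\<integral>z. sat \<epsilon> z ^ (2 * k - 1) \<partial>\<nu>)" by simp
      also have "(\<lambda>z. (sat \<epsilon> z ^ k)\<^sup>2) = (\<lambda>z. sat \<epsilon> z ^ (2 * k))"
        by (simp add: power_mult[symmetric] mult.commute)
      finally show ?thesis by linarith
    qed
    have "(\<integral>z. sat \<epsilon> z ^ 1 \<partial>\<nu>) \<le> (\<integral>z. 1 + (cmod z)\<^sup>2 \<partial>\<nu>)"
      by (rule integral_mono[OF int]) (use i2 sat_bounds(3)[OF e] in auto)
    also have "\<dots> = 2" using i2 v1 by (simp add: prob_space)
    finally have m1: "(\<integral>z. sat \<epsilon> z \<partial>\<nu>) \<le> 2" by simp
    have m10: "0 \<le> (\<integral>z. sat \<epsilon> z \<partial>\<nu>)" using s0 by simp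
    have m2: "(\<integral>z. sat \<epsilon> z ^ 2 \<partial>\<nu>) \<le> M2"
    proof -
      have "8 * c * (\<integral>z. sat \<epsilon> z \<partial>\<nu>) \<le> 8 * c * 2" by (rule mult_left_mono[OF m1]) (use c in simp)
      with main[of 1] power_mono[OF m1 m10, of 2] show ?thesis by (simp add: M2_def)
    qed
    have m20: "0 \<le> (\<integral>z. sat \<epsilon> z ^ 2 \<partial>\<nu>)" by simp
    \<comment> \<open>The third moment is absorbed by completing a square; subtracting half of the
      fourth moment afterwards is legitimate because s is bounded, so that moment is finite.\<close>
    have "(\<integral>z. 32 * c * sat \<epsilon> z ^ 3 \<partial>\<nu>) \<le> (\<integral>z. sat \<epsilon> z ^ 4 / 2 + (32 * c)\<^sup>2 / 2 * sat \<epsilon> z ^ 2 \<partial>\<nu>)"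
    proof (rule integral_mono)
      fix z
      have "0 \<le> (sat \<epsilon> z ^ 2 - 32 * c * sat \<epsilon> z)\<^sup>2" by simp
      thus "32 * c * sat \<epsilon> z ^ 3 \<le> sat \<epsilon> z ^ 4 / 2 + (32 * c)\<^sup>2 / 2 * sat \<epsilon> z ^ 2"
        by (simp add: power2_eq_square power3_eq_cube power4_eq_xxxx algebra_simps)
    qed (use int in auto)
    also have "\<dots> = (\<integral>z. sat \<epsilon> z ^ 4 \<partial>\<nu>) / 2 + (32 * c)\<^sup>2 / 2 * (\<integral>z. sat \<epsilon> z ^ 2 \<partial>\<nu>)"
      using int by simp
    finally have m3: "32 * c * (\<integral>z. sat \<epsilon> z ^ 3 \<partial>\<nu>) \<le> (\<integral>z. sat \<epsilon> z ^ 4 \<partial>\<nu>) / 2 + (32 * c)\<^sup>2 / 2 * (\<integral>z. sat \<epsilon> z ^ 2 \<partial>\<nu>)"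
      by simp
    have "(\<integral>z. sat \<epsilon> z ^ 4 \<partial>\<nu>) \<le> (\<integral>z. sat \<epsilon> z ^ 2 \<partial>\<nu>)\<^sup>2 + 32 * c * (\<integral>z. sat \<epsilon> z ^ 3 \<partial>\<nu>)"
      using main[of 2] by simp
    moreover have "(\<integral>z. sat \<epsilon> z ^ 2 \<partial>\<nu>)\<^sup>2 \<le> M2\<^sup>2" by (rule power_mono[OF m2 m20])
    moreover have "(32 * c)\<^sup>2 / 2 * (\<integral>z. sat \<epsilon> z ^ 2 \<partial>\<nu>) \<le> (32 * c)\<^sup>2 / 2 * M2" by (rule mult_left_mono[OF m2]) simp
    ultimately show "(\<integral>z. sat \<epsilon> z ^ 4 \<partial>\<nu>) \<le> M4" using m3 unfolding M4_def by linarith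
    show "integrable \<nu> (\<lambda>z. sat \<epsilon> z ^ 4)" by (rule int)
  qed
  \<comment> \<open>The truncation is removed by Fatou's lemma along a sequence tending to 0, on
    which \<open>sat\<close> tends pointwise to 1 + |z|^2.\<close>
  define \<epsilon> where "\<epsilon> n = 1 / (real n + 1)" for n
  have e: "0 < \<epsilon> n" "\<epsilon> n \<le> 1" for n by (auto simp: \<epsilon>_def)
  have m: "(\<lambda>z. ennreal (sat (\<epsilon> n) z ^ 4)) \<in> borel_measurable \<nu>" for n
    unfolding measurable_cong_sets[OF sets refl] sat_def by measurable
  have lim: "(\<lambda>n. ennreal (sat (\<epsilon> n) z ^ 4)) \<longlonglongrightarrow> ennreal ((1 + (cmod z)\<^sup>2) ^ 4)" for z
  proof -
    have "\<epsilon> \<longlonglongrightarrow> 0" unfolding \<epsilon>_def by real_asymp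
    hence "(\<lambda>n. (1 + (cmod z)\<^sup>2) / (1 + \<epsilon> n * (cmod z)\<^sup>2)) \<longlonglongrightarrow> (1 + (cmod z)\<^sup>2) / (1 + 0 * (cmod z)\<^sup>2)"
      by (intro tendsto_intros) auto
    thus ?thesis unfolding sat_def by (intro tendsto_ennrealI tendsto_power) simp
  qed
  have "(\<integral>\<^sup>+z. ennreal ((1 + (cmod z)\<^sup>2) ^ 4) \<partial>\<nu>) = (\<integral>\<^sup>+z. liminf (\<lambda>n. ennreal (sat (\<epsilon> n) z ^ 4)) \<partial>\<nu>)"
    using lim by (intro nn_integral_cong lim_imp_Liminf[symmetric]) auto
  also have "\<dots> \<le> liminf (\<lambda>n. \<integral>\<^sup>+z. ennreal (sat (\<epsilon> n) z ^ 4) \<partial>\<nu>)"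
    by (rule nn_integral_liminf[OF m])
  also have "\<dots> \<le> liminf (\<lambda>n. ennreal M4)"
  proof (rule Liminf_mono, rule always_eventually, rule allI)
    fix n
    have "(\<integral>\<^sup>+z. ennreal (sat (\<epsilon> n) z ^ 4) \<partial>\<nu>) = ennreal (\<integral>z. sat (\<epsilon> n) z ^ 4 \<partial>\<nu>)"
      by (rule nn_integral_eq_integral[OF bnd(2)[OF e]]) auto
    also have "\<dots> \<le> ennreal M4" by (rule ennreal_leI[OF bnd(1)[OF e]])
    finally show "(\<integral>\<^sup>+z. ennreal (sat (\<epsilon> n) z ^ 4) \<partial>\<nu>) \<le> ennreal M4" .
  qed
  also have "\<dots> = ennreal M4" by (simp add: Liminf_const)
  finally have fin: "(\<integral>\<^sup>+z. ennreal ((1 + (cmod z)\<^sup>2) ^ 4) \<partial>\<nu>) \<le> ennreal M4" .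
  have "(\<integral>\<^sup>+z. ennreal (norm ((1 + (cmod z)\<^sup>2) ^ 4)) \<partial>\<nu>) = (\<integral>\<^sup>+z. ennreal ((1 + (cmod z)\<^sup>2) ^ 4) \<partial>\<nu>)"
    by (intro nn_integral_cong) (simp add: abs_of_nonneg)
  also have "\<dots> < \<infinity>" using fin by (simp add: le_less_trans)
  finally have "integrable \<nu> (\<lambda>z. (1 + (cmod z)\<^sup>2) ^ 4)"
    by (intro integrableI_bounded) (simp add: measurable_cong_sets[OF sets refl])
  then show ?thesis
  proof (rule Bochner_Integration.integrable_bound)
    show "(\<lambda>z. cmod z ^ 8) \<in> borel_measurable \<nu>"
      unfolding measurable_cong_sets[OF sets refl] by measurable
    have "cmod z ^ 8 \<le> (1 + (cmod z)\<^sup>2) ^ 4" for z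
    proof -
      have "cmod z ^ 8 = ((cmod z)\<^sup>2) ^ 4" by (simp add: power_mult[symmetric])
      also have "\<dots> \<le> (1 + (cmod z)\<^sup>2) ^ 4" by (rule power_mono) auto
      finally show ?thesis .
    qed
    thus "AE z in \<nu>. norm (cmod z ^ 8) \<le> norm ((1 + (cmod z)\<^sup>2) ^ 4)" by (simp add: abs_of_nonneg)
  qed
qed

section \<open>Fourth moments of quadratic forms\<close>

definition linf :: "(nat \<Rightarrow> complex) \<Rightarrow> nat \<Rightarrow> (nat \<Rightarrow> complex) \<Rightarrow> complex" where
  "linf l n x = (\<Sum>j<n. l j * x j)"

lemma linf_Suc: "linf l (Suc n) (x(n := \<xi>)) = linf l n x + l n * \<xi>"
  by (simp add: linf_def)

lemma cmod_add_square: "(cmod (p + q))\<^sup>2 = (cmod p)\<^sup>2 + 2 * Re (cnj p * q) + (cmod q)\<^sup>2"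
  unfolding cmod_power2 by (simp add: power2_eq_square algebra_simps)

text \<open>The form x* A x minus its expectation: for independent centred coordinates with E
  |x_i|^2 = 1 the expectation is the trace of A. No value of E x_i^2 enters, so real and complex
  laws are treated alike.\<close>

definition qdev :: "(nat \<Rightarrow> nat \<Rightarrow> complex) \<Rightarrow> nat \<Rightarrow> (nat \<Rightarrow> complex) \<Rightarrow> real" where
  "qdev A n x = Re (\<Sum>i<n. \<Sum>j<n. A i j * cnj (x i) * x j) - (\<Sum>i<n. Re (A i i))"

text \<open>The increment has mean zero in \<xi> for fixed x, as \<xi> is centred with E |\<xi>|^2 =
  1: adding coordinates one by one is a martingale. The new row and column contribute conjugate
  terms, whence the doubled real part.\<close>

lemma qdev_Suc:
  assumes "\<And>i j. A i j = cnj (A j i)"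
  shows "qdev A (Suc n) (x(n := \<xi>)) = qdev A n x + (Re (A n n) * ((cmod \<xi>)\<^sup>2 - 1) + 2 * Re (cnj \<xi> * linf (A n) n x))"
proof -
  have "(\<Sum>i<n. A i n * cnj (x i)) = cnj (linf (A n) n x)"
    unfolding linf_def cnj_sum by (intro sum.cong refl) (subst assms, simp)
  hence c: "(\<Sum>i<n. A i n * cnj (x i) * \<xi>) = cnj (linf (A n) n x) * \<xi>"
    by (simp add: sum_distrib_right[symmetric])
  have r: "(\<Sum>j<n. A n j * cnj \<xi> * x j) = cnj \<xi> * linf (A n) n x"
    by (simp add: linf_def sum_distrib_left mult_ac)
  have "Im (A n n) = 0" using assms[of n n] by (simp add: complex_eq_iff)
  hence d: "Re (A n n * cnj \<xi> * \<xi>) = Re (A n n) * (cmod \<xi>)\<^sup>2"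
    unfolding cmod_power2 by (simp add: power2_eq_square algebra_simps)
  have "(\<Sum>i<Suc n. \<Sum>j<Suc n. A i j * cnj ((x(n := \<xi>)) i) * (x(n := \<xi>)) j) =
    (\<Sum>i<n. \<Sum>j<n. A i j * cnj (x i) * x j) + (\<Sum>i<n. A i n * cnj (x i) * \<xi>)
     + ((\<Sum>j<n. A n j * cnj \<xi> * x j) + A n n * cnj \<xi> * \<xi>)"
    by (simp add: sum.distrib)
  moreover have "Re (cnj (linf (A n) n x) * \<xi>) = Re (cnj \<xi> * linf (A n) n x)" by (simp add: mult_ac)
  ultimately show ?thesis unfolding qdev_def c r
    by (simp only: sum.lessThan_Suc plus_complex.sel d right_diff_distrib)
qed

text \<open>The term 4 q d^3 is split as 2 q^2 d^2 + 2 d^4. The term 4 q^3 d is kept exact, because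
  it integrates to zero for a martingale increment d.\<close>

lemma fourth_power_add_le:
  fixes q d :: real
  shows "(q + d) ^ 4 \<le> q ^ 4 + 4 * q ^ 3 * d + 8 * q\<^sup>2 * d\<^sup>2 + 3 * d ^ 4"
proof -
  have "0 \<le> 2 * (d * (q - d))\<^sup>2" by simp
  thus ?thesis by (simp add: power2_eq_square power3_eq_cube power4_eq_xxxx algebra_simps)
qed

section \<open>Fourth moments under the product law, one coordinate at a time\<close>

locale standardized_law = prob_space \<nu> for \<nu> :: "complex measure" +
  assumes sets_borel: "sets \<nu> = sets borel"
    and centred: "(\<integral>z. z \<partial>\<nu>) = 0"
    and unit_variance: "(\<integral>z. (cmod z)\<^sup>2 \<partial>\<nu>) = 1"
    and moment8: "integrable \<nu> (\<lambda>z. (cmod z) ^ 8)"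
begin

sublocale P: product_sigma_finite "\<lambda>_ :: nat. \<nu>"
  by unfold_locales

abbreviation iid :: "nat \<Rightarrow> (nat \<Rightarrow> complex) measure" (\<open>\<P>\<close>) where
  "\<P> n \<equiv> PiM {..<n} (\<lambda>_. \<nu>)"

sublocale Pn: prob_space "\<P> n" for n :: nat
  by (rule prob_space_PiM) (rule prob_space_axioms)

lemma borel_law: "f \<in> borel_measurable borel \<Longrightarrow> f \<in> borel_measurable \<nu>"
  by (simp add: measurable_cong_sets[OF sets_borel refl])

lemma integrable_cmod_power: "k \<le> 8 \<Longrightarrow> integrable \<nu> (\<lambda>z. (cmod z) ^ k)"
proof (rule Bochner_Integration.integrable_bound)
  assume k: "k \<le> 8"
  show "integrable \<nu> (\<lambda>z. 1 + (cmod z) ^ 8)" using moment8 by simp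
  show "(\<lambda>z. cmod z ^ k) \<in> borel_measurable \<nu>" by (rule borel_law) measurable
  have "cmod z ^ k \<le> 1 + (cmod z) ^ 8" for z
  proof (cases "cmod z \<le> 1")
    case True
    hence "cmod z ^ k \<le> 1" by (simp add: power_le_one)
    thus ?thesis by (simp add: add_increasing2)
  next
    case False
    hence "cmod z ^ k \<le> cmod z ^ 8" using k by (intro power_increasing) auto
    thus ?thesis by simp
  qed
  thus "AE z in \<nu>. norm (cmod z ^ k) \<le> norm (1 + cmod z ^ 8)" by simp
qed

lemma integrable_id: "integrable \<nu> (\<lambda>z. z)"
proof (rule iffD1[OF integrable_norm_iff])
  show "(\<lambda>z. z) \<in> borel_measurable \<nu>" by (rule borel_law) simp
  show "integrable \<nu> (\<lambda>z. norm z)" using integrable_cmod_power[of 1] by simp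
qed

lemma integral_Re_Im: "integrable \<nu> Re" "integrable \<nu> Im" "(\<integral>z. Re z \<partial>\<nu>) = 0" "(\<integral>z. Im z \<partial>\<nu>) = 0"
  using integrable_id centred by (simp_all add: integral_Re integral_Im)

text \<open>Induction step for moment bounds: Tonelli for the nonnegative F gives integrability and
  the estimate together, from a bound on the integral over the last coordinate.\<close>

lemma PiM_step:
  fixes F G :: "(nat \<Rightarrow> complex) \<Rightarrow> real"
  assumes F: "F \<in> borel_measurable (\<P> (Suc n))" and F0: "\<And>x. 0 \<le> F x"
    and G: "integrable (\<P> n) G"
    and inner: "\<And>x. integrable \<nu> (\<lambda>\<xi>. F (x(n := \<xi>)))" "\<And>x. (\<integral>\<xi>. F (x(n := \<xi>)) \<partial>\<nu>) \<le> G x"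
  shows "integrable (\<P> (Suc n)) F"
    "(\<integral>x. F x \<partial>\<P> (Suc n)) \<le> (\<integral>x. G x \<partial>\<P> n)"
proof -
  have G0: "0 \<le> G x" for x
    by (rule order_trans[OF _ inner(2)]) (simp add: F0)
  have "(\<integral>\<^sup>+x. ennreal (F x) \<partial>\<P> (Suc n)) =
    (\<integral>\<^sup>+x. (\<integral>\<^sup>+\<xi>. ennreal (F (x(n := \<xi>))) \<partial>\<nu>) \<partial>\<P> n)"
    unfolding lessThan_Suc
    by (rule P.product_nn_integral_insert) (use F in \<open>auto simp: lessThan_Suc\<close>)
  also have "\<dots> \<le> (\<integral>\<^sup>+x. ennreal (G x) \<partial>\<P> n)"
  proof (rule nn_integral_mono)
    fix x
    have "(\<integral>\<^sup>+\<xi>. ennreal (F (x(n := \<xi>))) \<partial>\<nu>) = ennreal (\<integral>\<xi>. F (x(n := \<xi>)) \<partial>\<nu>)"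
      by (rule nn_integral_eq_integral[OF inner(1)]) (simp add: F0)
    also have "\<dots> \<le> ennreal (G x)" by (rule ennreal_leI[OF inner(2)])
    finally show "(\<integral>\<^sup>+\<xi>. ennreal (F (x(n := \<xi>))) \<partial>\<nu>) \<le> ennreal (G x)" .
  qed
  also have "\<dots> = ennreal (\<integral>x. G x \<partial>\<P> n)"
    by (rule nn_integral_eq_integral[OF G]) (simp add: G0)
  finally have le: "(\<integral>\<^sup>+x. ennreal (F x) \<partial>\<P> (Suc n)) \<le> ennreal (\<integral>x. G x \<partial>\<P> n)" .
  show i: "integrable (\<P> (Suc n)) F"
  proof (rule integrableI_bounded[OF F])
    have "(\<integral>\<^sup>+x. ennreal (norm (F x)) \<partial>\<P> (Suc n)) = (\<integral>\<^sup>+x. ennreal (F x) \<partial>\<P> (Suc n))"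
      by (simp add: F0)
    also have "\<dots> < \<infinity>" using le by (simp add: le_less_trans)
    finally show "(\<integral>\<^sup>+x. ennreal (norm (F x)) \<partial>\<P> (Suc n)) < \<infinity>" .
  qed
  have "ennreal (\<integral>x. F x \<partial>\<P> (Suc n)) \<le> ennreal (\<integral>x. G x \<partial>\<P> n)"
    using le by (subst nn_integral_eq_integral[OF i, symmetric]) (simp_all add: F0)
  thus "(\<integral>x. F x \<partial>\<P> (Suc n)) \<le> (\<integral>x. G x \<partial>\<P> n)"
    by (simp add: ennreal_le_iff integral_nonneg_AE G0)
qed

lemma measurable_coord: "i < n \<Longrightarrow> (\<lambda>x. x i) \<in> borel_measurable (\<P> n)"
  using measurable_component_singleton[of i "{..<n}" "\<lambda>_. \<nu>"]
  by (simp add: measurable_cong_sets[OF refl sets_borel])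

lemma measurable_linf [measurable]: "linf l n \<in> borel_measurable (\<P> n)"
  unfolding linf_def by (intro borel_measurable_sum borel_measurable_times measurable_coord) auto

lemma linf_second_moment:
  "integrable (\<P> n) (\<lambda>x. (cmod (linf l n x))\<^sup>2)"
  "(\<integral>x. (cmod (linf l n x))\<^sup>2 \<partial>\<P> n) \<le> (\<Sum>j<n. (cmod (l j))\<^sup>2)"
proof (induction n)
  case 0
  { case 1 show ?case by (simp add: linf_def) next case 2 show ?case by (simp add: linf_def) }
next
  case (Suc n)
  have ex: "(cmod (linf l (Suc n) (x(n := \<xi>))))\<^sup>2 = (cmod (linf l n x))\<^sup>2
     + 2 * (Re (cnj (linf l n x) * l n) * Re \<xi> - Im (cnj (linf l n x) * l n) * Im \<xi>) + (cmod (l n))\<^sup>2 * (cmod \<xi>)\<^sup>2" for x \<xi>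
    unfolding linf_Suc cmod_add_square by (simp add: norm_mult power_mult_distrib algebra_simps)
  have i: "integrable \<nu> (\<lambda>\<xi>. (cmod (linf l (Suc n) (x(n := \<xi>))))\<^sup>2)" for x
    unfolding ex using integral_Re_Im integrable_cmod_power[of 2] by simp
  have e: "(\<integral>\<xi>. (cmod (linf l (Suc n) (x(n := \<xi>))))\<^sup>2 \<partial>\<nu>) \<le> (cmod (linf l n x))\<^sup>2 + (cmod (l n))\<^sup>2" for x
    unfolding ex using integral_Re_Im integrable_cmod_power[of 2] by (simp add: unit_variance prob_space)
  have G: "integrable (\<P> n) (\<lambda>x. (cmod (linf l n x))\<^sup>2 + (cmod (l n))\<^sup>2)"
    using Suc.IH(1) by simp
  have F: "(\<lambda>x. (cmod (linf l (Suc n) x))\<^sup>2) \<in> borel_measurable (\<P> (Suc n))" by measurable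
  note st = PiM_step[OF F _ G i e]
  { case 1 show ?case by (rule st(1)) simp
  next
    case 2
    have "(\<integral>x. (cmod (linf l (Suc n) x))\<^sup>2 \<partial>\<P> (Suc n)) \<le>
       (\<integral>x. (cmod (linf l n x))\<^sup>2 + (cmod (l n))\<^sup>2 \<partial>\<P> n)" by (rule st(2)) simp
    also have "\<dots> = (\<integral>x. (cmod (linf l n x))\<^sup>2 \<partial>\<P> n) + (cmod (l n))\<^sup>2"
      using Suc.IH(1) by (simp add: Pn.prob_space)
    finally show ?case using Suc.IH(2) by simp }
qed

definition m4 :: real where "m4 = (\<integral>z. (cmod z) ^ 4 \<partial>\<nu>)"

lemma m4_nonneg: "0 \<le> m4" by (simp add: m4_def)

text \<open>Write p and q for the squared moduli of the old sum and the new term and r for the real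
  part of their cross term. From r^2 \<le> p q and 4 r q \<le> 4 r^2 + q^2, the only signed term
  left is 4 p r, linear in \<xi> and removed by centring. In the constant, 5 is half the coefficient
  10 of p q, and 2 \<open>m4\<close> covers the q^2 term.\<close>

lemma linf_fourth_moment:
  "integrable (\<P> n) (\<lambda>x. (cmod (linf l n x)) ^ 4)"
  "(\<integral>x. (cmod (linf l n x)) ^ 4 \<partial>\<P> n) \<le> (5 + 2 * m4) * (\<Sum>j<n. (cmod (l j))\<^sup>2)\<^sup>2"
proof (induction n)
  case 0
  { case 1 show ?case by (simp add: linf_def) next case 2 show ?case by (simp add: linf_def) }
next
  case (Suc n)
  let ?P = "\<lambda>x. (cmod (linf l n x))\<^sup>2"
  let ?b = "(cmod (l n))\<^sup>2"
  have ex: "(cmod (linf l (Suc n) (x(n := \<xi>)))) ^ 4 \<le> (?P x)\<^sup>2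
     + 4 * ?P x * (Re (cnj (linf l n x) * l n) * Re \<xi> - Im (cnj (linf l n x) * l n) * Im \<xi>)
     + 10 * ?P x * ?b * (cmod \<xi>)\<^sup>2 + 2 * ?b\<^sup>2 * (cmod \<xi>) ^ 4" for x \<xi>
  proof -
    define p where "p = ?P x"
    define r where "r = Re (cnj (linf l n x) * l n) * Re \<xi> - Im (cnj (linf l n x) * l n) * Im \<xi>"
    define q where "q = ?b * (cmod \<xi>)\<^sup>2"
    have pq: "0 \<le> p" "0 \<le> q" by (auto simp: p_def q_def)
    have "r = Re (cnj (linf l n x) * (l n * \<xi>))" by (simp add: r_def algebra_simps)
    hence "\<bar>r\<bar> \<le> cmod (cnj (linf l n x) * (l n * \<xi>))" by (simp only: abs_Re_le_cmod)
    hence "r\<^sup>2 \<le> (cmod (cnj (linf l n x) * (l n * \<xi>)))\<^sup>2" using abs_le_square_iff by fastforce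
    also have "\<dots> = p * q" by (simp add: norm_mult power_mult_distrib p_def q_def)
    finally have rr: "r\<^sup>2 \<le> p * q" .
    have "cmod (linf l (Suc n) (x(n := \<xi>))) ^ 4 = ((cmod (linf l (Suc n) (x(n := \<xi>))))\<^sup>2)\<^sup>2" by simp
    also have "(cmod (linf l (Suc n) (x(n := \<xi>))))\<^sup>2 = p + 2 * r + q"
      unfolding linf_Suc cmod_add_square p_def q_def r_def by (simp add: norm_mult power_mult_distrib algebra_simps)
    also have "(p + 2 * r + q)\<^sup>2 \<le> p\<^sup>2 + 4 * p * r + 10 * (p * q) + 2 * q\<^sup>2"
    proof -
      have "0 \<le> (2 * r - q)\<^sup>2" by simp
      thus ?thesis using rr by (simp add: power2_eq_square algebra_simps)
    qed
    also have "\<dots> = (?P x)\<^sup>2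
     + 4 * ?P x * (Re (cnj (linf l n x) * l n) * Re \<xi> - Im (cnj (linf l n x) * l n) * Im \<xi>)
     + 10 * ?P x * ?b * (cmod \<xi>)\<^sup>2 + 2 * ?b\<^sup>2 * (cmod \<xi>) ^ 4"
      by (simp add: p_def q_def r_def power_mult_distrib mult_ac)
    finally show ?thesis .
  qed
  define D where "D x \<xi> = (?P x)\<^sup>2
     + 4 * ?P x * (Re (cnj (linf l n x) * l n) * Re \<xi> - Im (cnj (linf l n x) * l n) * Im \<xi>)
     + 10 * ?P x * ?b * (cmod \<xi>)\<^sup>2 + 2 * ?b\<^sup>2 * (cmod \<xi>) ^ 4" for x \<xi>
  have iD: "integrable \<nu> (D x)" for x
    unfolding D_def using integral_Re_Im integrable_cmod_power[of 2] integrable_cmod_power[of 4] by simp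
  have exD: "(cmod (linf l (Suc n) (x(n := \<xi>)))) ^ 4 \<le> D x \<xi>" for x \<xi>
    unfolding D_def by (rule ex)
  have i: "integrable \<nu> (\<lambda>\<xi>. (cmod (linf l (Suc n) (x(n := \<xi>)))) ^ 4)" for x
  proof (rule Bochner_Integration.integrable_bound[OF iD[of x]])
    show "(\<lambda>\<xi>. (cmod (linf l (Suc n) (x(n := \<xi>)))) ^ 4) \<in> borel_measurable \<nu>"
      unfolding linf_Suc by (rule borel_law) measurable
    show "AE \<xi> in \<nu>. norm ((cmod (linf l (Suc n) (x(n := \<xi>)))) ^ 4) \<le> norm (D x \<xi>)"
      using exD[of x] by (intro AE_I2) (simp only: real_norm_def power_abs abs_norm_cancel order_trans[OF _ abs_ge_self])
  qed
  have e: "(\<integral>\<xi>. (cmod (linf l (Suc n) (x(n := \<xi>)))) ^ 4 \<partial>\<nu>) \<le> (cmod (linf l n x)) ^ 4 + 10 * ?b * ?P x + 2 * m4 * ?b\<^sup>2" for x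
  proof -
    have "(\<integral>\<xi>. (cmod (linf l (Suc n) (x(n := \<xi>)))) ^ 4 \<partial>\<nu>) \<le> (\<integral>\<xi>. D x \<xi> \<partial>\<nu>)"
      by (rule integral_mono[OF i iD exD])
    also have "\<dots> = (cmod (linf l n x)) ^ 4 + 10 * ?b * ?P x + 2 * m4 * ?b\<^sup>2"
      unfolding D_def using integral_Re_Im integrable_cmod_power[of 2] integrable_cmod_power[of 4]
      by (simp add: unit_variance prob_space m4_def)
    finally show ?thesis .
  qed
  have G: "integrable (\<P> n) (\<lambda>x. (cmod (linf l n x)) ^ 4 + 10 * ?b * ?P x + 2 * m4 * ?b\<^sup>2)"
    using Suc.IH(1) linf_second_moment(1)[of n l] by simp
  have F: "(\<lambda>x. (cmod (linf l (Suc n) x)) ^ 4) \<in> borel_measurable (\<P> (Suc n))" by measurable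
  note st = PiM_step[OF F _ G i e]
  { case 1 show ?case by (rule st(1)) simp
  next
    case 2
    define \<sigma> where "\<sigma> = (\<Sum>j<n. (cmod (l j))\<^sup>2)"
    have s0: "0 \<le> \<sigma>" by (simp add: \<sigma>_def sum_nonneg)
    have "(\<integral>x. (cmod (linf l (Suc n) x)) ^ 4 \<partial>\<P> (Suc n)) \<le>
       (\<integral>x. (cmod (linf l n x)) ^ 4 + 10 * ?b * ?P x + 2 * m4 * ?b\<^sup>2 \<partial>\<P> n)" by (rule st(2)) simp
    also have "\<dots> = (\<integral>x. (cmod (linf l n x)) ^ 4 \<partial>\<P> n) + 10 * ?b * (\<integral>x. ?P x \<partial>\<P> n) + 2 * m4 * ?b\<^sup>2"
      using Suc.IH(1) linf_second_moment(1)[of n l] by (simp add: Pn.prob_space)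
    also have "\<dots> \<le> (5 + 2 * m4) * \<sigma>\<^sup>2 + 10 * ?b * \<sigma> + 2 * m4 * ?b\<^sup>2"
      using Suc.IH(2) linf_second_moment(2)[of n l] m4_nonneg unfolding \<sigma>_def by (intro add_mono mult_left_mono) auto
    also have "\<dots> \<le> (5 + 2 * m4) * (\<sigma> + ?b)\<^sup>2"
    proof -
      have "0 \<le> m4 * \<sigma> * ?b" "0 \<le> 5 * ?b\<^sup>2" using m4_nonneg s0 by auto
      moreover have "(5 + 2 * m4) * (\<sigma> + ?b)\<^sup>2 - ((5 + 2 * m4) * \<sigma>\<^sup>2 + 10 * ?b * \<sigma> + 2 * m4 * ?b\<^sup>2) = 4 * (m4 * \<sigma> * ?b) + 5 * ?b\<^sup>2"
        by (simp add: power2_eq_square algebra_simps)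
      ultimately show ?thesis by linarith
    qed
    finally show ?case by (simp add: \<sigma>_def) }
qed

lemma measurable_qdev [measurable]: "qdev A n \<in> borel_measurable (\<P> n)"
proof -
  have cnj: "(cnj :: complex \<Rightarrow> complex) \<in> borel_measurable borel"
    by (intro borel_measurable_continuous_onI continuous_intros)
  show ?thesis unfolding qdev_def
    by (intro borel_measurable_diff borel_measurable_const measurable_compose[OF _ borel_measurable_Re]
      borel_measurable_sum borel_measurable_times measurable_compose[OF _ cnj] measurable_coord) auto
qed

text \<open>Increments of the quadratic form are bounded by a multiple of g = 2 (1 + |\<xi>|^2).
  Since g \<ge> 1, its lower powers are bounded by g^4, so this single moment of order eight serves
  for all terms.\<close>

definition kap :: real where "kap = (\<integral>z. (2 * (1 + (cmod z)\<^sup>2)) ^ 4 \<partial>\<nu>)"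

lemma integrable_kap: "integrable \<nu> (\<lambda>z. (2 * (1 + (cmod z)\<^sup>2)) ^ 4)"
proof -
  have eq: "(2 * (1 + (cmod z)\<^sup>2)) ^ 4 = 16 * (1 + 4 * cmod z ^ 2 + 6 * cmod z ^ 4 + 4 * cmod z ^ 6 + cmod z ^ 8)" for z
  proof -
    have "(2 * (1 + u)) ^ 4 = 16 * (1 + 4 * u + 6 * u\<^sup>2 + 4 * u ^ 3 + u ^ 4)" for u :: real
      by (simp add: power2_eq_square power3_eq_cube power4_eq_xxxx algebra_simps)
    from this[of "(cmod z)\<^sup>2"] show ?thesis by (simp add: power_mult[symmetric])
  qed
  show ?thesis unfolding eq
    by (intro Bochner_Integration.integrable_add integrable_mult_right integrable_cmod_power integrable_const) auto
qed

lemma kap_ge_1: "1 \<le> kap"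
proof -
  have "(\<integral>z. 1 \<partial>\<nu>) \<le> kap" unfolding kap_def
    by (rule integral_mono[OF _ integrable_kap]) (auto intro!: one_le_power simp: add_increasing2)
  thus ?thesis by (simp add: prob_space)
qed

text \<open>One coordinate is integrated out. The third-order term vanishes by centring; the remaining mixed term
  is split by Young's inequality, whose parameter $t$ is chosen in the induction below.\<close>

lemma qdev_step:
  fixes q a t :: real and L :: complex
  assumes t: "t > 0"
  defines "d \<equiv> \<lambda>\<xi>. a * ((cmod \<xi>)\<^sup>2 - 1) + 2 * Re (cnj \<xi> * L)"
  shows "integrable \<nu> (\<lambda>\<xi>. (q + d \<xi>) ^ 4)"
    "(\<integral>\<xi>. (q + d \<xi>) ^ 4 \<partial>\<nu>) \<le> (1 + t / 2) * q ^ 4 + (32 * kap\<^sup>2 / t + 3 * kap) * (128 * (a ^ 4 + (cmod L) ^ 4))"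
proof -
  define \<beta> where "\<beta> = \<bar>a\<bar> + 2 * cmod L"
  define g where "g \<xi> = 2 * (1 + (cmod \<xi>)\<^sup>2)" for \<xi> :: complex
  have b0: "0 \<le> \<beta>" by (simp add: \<beta>_def)
  have g1: "1 \<le> g \<xi>" for \<xi> by (simp add: g_def add_increasing2)
  have dg: "\<bar>d \<xi>\<bar> \<le> \<beta> * g \<xi>" for \<xi>
  proof -
    have "\<bar>d \<xi>\<bar> \<le> \<bar>a\<bar> * \<bar>(cmod \<xi>)\<^sup>2 - 1\<bar> + 2 * \<bar>Re (cnj \<xi> * L)\<bar>"
      unfolding d_def abs_mult[symmetric] by linarith
    also have "\<dots> \<le> \<bar>a\<bar> * g \<xi> + 2 * (cmod L * g \<xi>)"
    proof (intro add_mono mult_left_mono)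
      show "\<bar>(cmod \<xi>)\<^sup>2 - 1\<bar> \<le> g \<xi>" by (simp add: g_def abs_le_iff)
      have re: "\<bar>Re (cnj \<xi> * L)\<bar> \<le> cmod L * cmod \<xi>" using abs_Re_le_cmod[of "cnj \<xi> * L"] by (simp add: norm_mult mult.commute)
      have "cmod \<xi> \<le> g \<xi>"
      proof -
        have "0 \<le> (cmod \<xi> - 1)\<^sup>2" by simp
        also have "(cmod \<xi> - 1)\<^sup>2 = (cmod \<xi>)\<^sup>2 - 2 * cmod \<xi> + 1" by (simp add: power2_diff)
        finally have "2 * cmod \<xi> \<le> 1 + (cmod \<xi>)\<^sup>2" by linarith
        moreover have "0 \<le> cmod \<xi>" by simp
        moreover have "0 \<le> (cmod \<xi>)\<^sup>2" by simp
        moreover have "g \<xi> = 2 + 2 * (cmod \<xi>)\<^sup>2" by (simp add: g_def)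
        ultimately show ?thesis by linarith
      qed
      hence *: "cmod L * cmod \<xi> \<le> cmod L * g \<xi>" by (rule mult_left_mono) simp
      show "\<bar>Re (cnj \<xi> * L)\<bar> \<le> cmod L * g \<xi>" by (rule order_trans[OF re *])
    qed auto
    finally show ?thesis by (simp add: \<beta>_def algebra_simps)
  qed
  have d2: "(d \<xi>)\<^sup>2 \<le> \<beta>\<^sup>2 * g \<xi> ^ 4" for \<xi>
  proof -
    have "(d \<xi>)\<^sup>2 \<le> (\<beta> * g \<xi>)\<^sup>2" using power_mono[OF dg[of \<xi>], of 2] by simp
    also have "\<dots> \<le> \<beta>\<^sup>2 * g \<xi> ^ 4" unfolding power_mult_distrib
      using power_increasing[OF _ g1[of \<xi>], of 2 4] by (intro mult_left_mono) auto
    finally show ?thesis .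
  qed
  have d4: "(d \<xi>) ^ 4 \<le> \<beta> ^ 4 * g \<xi> ^ 4" for \<xi>
    using power_mono[OF dg[of \<xi>], of 4] by (simp add: power_mult_distrib power_abs)
  have ig: "integrable \<nu> (\<lambda>\<xi>. g \<xi> ^ 4)" unfolding g_def by (rule integrable_kap)
  have Eg: "(\<integral>\<xi>. g \<xi> ^ 4 \<partial>\<nu>) = kap" by (simp add: g_def kap_def)
  have d_eq: "d = (\<lambda>\<xi>. a * ((cmod \<xi>)\<^sup>2 - 1) + 2 * (Re L * Re \<xi> + Im L * Im \<xi>))"
    by (auto simp: d_def algebra_simps)
  have id: "integrable \<nu> d" unfolding d_eq using integral_Re_Im integrable_cmod_power[of 2] by simp
  have Ed: "(\<integral>\<xi>. d \<xi> \<partial>\<nu>) = 0"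
    unfolding d_eq using integral_Re_Im integrable_cmod_power[of 2] by (simp add: unit_variance prob_space)
  define H where "H \<xi> = q ^ 4 + 4 * q ^ 3 * d \<xi> + 8 * q\<^sup>2 * (\<beta>\<^sup>2 * g \<xi> ^ 4) + 3 * (\<beta> ^ 4 * g \<xi> ^ 4)" for \<xi>
  have H: "(q + d \<xi>) ^ 4 \<le> H \<xi>" for \<xi>
  proof -
    have "8 * q\<^sup>2 * (d \<xi>)\<^sup>2 \<le> 8 * q\<^sup>2 * (\<beta>\<^sup>2 * g \<xi> ^ 4)" by (rule mult_left_mono[OF d2]) simp
    thus ?thesis using fourth_power_add_le[of q "d \<xi>"] d4[of \<xi>] unfolding H_def by linarith
  qed
  have iH: "integrable \<nu> H" unfolding H_def using id ig by simp
  have dm: "d \<in> borel_measurable \<nu>" unfolding d_eq by (rule borel_law) measurable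
  show i: "integrable \<nu> (\<lambda>\<xi>. (q + d \<xi>) ^ 4)"
  proof (rule Bochner_Integration.integrable_bound[OF iH])
    show "(\<lambda>\<xi>. (q + d \<xi>) ^ 4) \<in> borel_measurable \<nu>" using dm by measurable
    show "AE \<xi> in \<nu>. norm ((q + d \<xi>) ^ 4) \<le> norm (H \<xi>)"
      using H by (intro AE_I2) (simp add: order_trans[OF _ abs_ge_self])
  qed
  have "(\<integral>\<xi>. (q + d \<xi>) ^ 4 \<partial>\<nu>) \<le> (\<integral>\<xi>. H \<xi> \<partial>\<nu>)" by (rule integral_mono[OF i iH H])
  also have "\<dots> = q ^ 4 + 8 * q\<^sup>2 * (\<beta>\<^sup>2 * kap) + 3 * (\<beta> ^ 4 * kap)"
    unfolding H_def using id ig by (simp add: Ed Eg prob_space)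
  also have "\<dots> \<le> (1 + t / 2) * q ^ 4 + (32 * kap\<^sup>2 / t + 3 * kap) * \<beta> ^ 4"
  proof -
    \<comment> \<open>Young's inequality as a completed square: it trades 8 kap q^2 \<beta>^2 for
      t/2 q^4 plus 32 kap^2/t \<beta>^4.\<close>
    have "0 \<le> (t * q\<^sup>2 - 8 * kap * \<beta>\<^sup>2)\<^sup>2 / (2 * t)" using t by simp
    also have "\<dots> = t / 2 * q ^ 4 - 8 * q\<^sup>2 * (\<beta>\<^sup>2 * kap) + 32 * kap\<^sup>2 / t * \<beta> ^ 4"
      using t by (simp add: power2_eq_square power4_eq_xxxx field_simps)
    finally show ?thesis by (simp add: algebra_simps)
  qed
  also have "\<dots> \<le> (1 + t / 2) * q ^ 4 + (32 * kap\<^sup>2 / t + 3 * kap) * (128 * (a ^ 4 + (cmod L) ^ 4))"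
  proof (intro add_left_mono mult_left_mono)
    have two: "(u + v) ^ 4 \<le> 8 * (u ^ 4 + v ^ 4)" for u v :: real
    proof -
      have "(u + v)\<^sup>2 \<le> 2 * (u\<^sup>2 + v\<^sup>2)" using zero_le_power2[of "u - v"] by (simp add: power2_eq_square algebra_simps)
      hence "((u + v)\<^sup>2)\<^sup>2 \<le> (2 * (u\<^sup>2 + v\<^sup>2))\<^sup>2" by (rule power_mono) simp
      also have "\<dots> \<le> 8 * ((u\<^sup>2)\<^sup>2 + (v\<^sup>2)\<^sup>2)" using zero_le_power2[of "u\<^sup>2 - v\<^sup>2"] by (simp add: power2_eq_square algebra_simps)
      finally show ?thesis by simp
    qed
    \<comment> \<open>128 = 8 * 2^4, the factor 2 being that of the cross term in \<beta>.\<close>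
    have "\<beta> ^ 4 \<le> 8 * (\<bar>a\<bar> ^ 4 + (2 * cmod L) ^ 4)" unfolding \<beta>_def by (rule two)
    hence "\<beta> ^ 4 \<le> 8 * a ^ 4 + 128 * cmod L ^ 4" by (simp add: power_mult_distrib power_abs)
    moreover have "0 \<le> a ^ 4" by simp
    ultimately show "\<beta> ^ 4 \<le> 128 * (a ^ 4 + (cmod L) ^ 4)" unfolding distrib_left by linarith
    show "0 \<le> 32 * kap\<^sup>2 / t + 3 * kap" using t kap_ge_1 by simp
  qed
  finally show "(\<integral>\<xi>. (q + d \<xi>) ^ 4 \<partial>\<nu>) \<le> (1 + t / 2) * q ^ 4 + (32 * kap\<^sup>2 / t + 3 * kap) * (128 * (a ^ 4 + (cmod L) ^ 4))" .
qed

abbreviation frob :: "(nat \<Rightarrow> nat \<Rightarrow> complex) \<Rightarrow> nat \<Rightarrow> real" where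
  "frob A n \<equiv> \<Sum>i<n. \<Sum>j<n. (cmod (A i j))\<^sup>2"

text \<open>8960 = 2 * 35 * 128: for t \<le> 1 the factor 32 kap^2/t + 3 kap is at most 35 kap^2/t,
  128 comes from the one-coordinate step, and the 2 makes the new terms use only half of the
  available increase; Young's term uses the other half.\<close>

definition qconst :: real where "qconst = 8960 * kap\<^sup>2 * (5 + 2 * m4)"

lemma qconst_pos: "0 < qconst"
  unfolding qconst_def using kap_ge_1 m4_nonneg by (intro mult_pos_pos) auto

text \<open>The bound is kept linear in the Frobenius norm of the leading block, with the other factor frozen at \<open>S\<close>,
  so that it adds up along the induction.\<close>

lemma qdev_fourth_moment_aux:
  assumes herm: "\<And>i j. A i j = cnj (A j i)"
    and S: "frob A n \<le> S" and S0: "0 < S"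
  shows "integrable (\<P> n) (\<lambda>x. (qdev A n x) ^ 4) \<and>
    (\<integral>x. (qdev A n x) ^ 4 \<partial>\<P> n) \<le> qconst * S * frob A n"
  using S
proof (induction n)
  case 0
  show ?case by (simp add: qdev_def)
next
  case (Suc n)
  define \<sigma> where "\<sigma> = (\<Sum>j<n. (cmod (A n j))\<^sup>2)"
  define a where "a = Re (A n n)"
  define s where "s = a\<^sup>2 + \<sigma>"
  define T where "T = frob A n"
  have T0: "0 \<le> T" and s0: "0 \<le> \<sigma>" by (auto simp: T_def \<sigma>_def sum_nonneg)
  have "(\<Sum>i<n. (cmod (A i n))\<^sup>2) = \<sigma>"
    unfolding \<sigma>_def by (intro sum.cong refl) (subst herm, simp)
  moreover have "(cmod (A n n))\<^sup>2 \<ge> a\<^sup>2" unfolding a_def cmod_power2 by simp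
  ultimately have TS: "T + s \<le> frob A (Suc n)"
    using s0 by (simp add: sum.distrib T_def s_def \<sigma>_def[symmetric])
  have TsS: "T + s \<le> S" using TS Suc.prems by linarith
  have ss: "0 \<le> s" using s0 by (simp add: s_def)
  have TS': "T \<le> S" and sS: "s \<le> S" using TsS ss T0 by auto
  note IH = Suc.IH[folded T_def, OF TS']
  \<comment> \<open>The Young parameter is the share of the new row in S. Then t/2 times the old
    bound qconst S T equals qconst s T / 2, and the new terms cost qconst S s / 2; as T \<le> S,
    both fit into the increase qconst S s. The value 1 only keeps t positive when s = 0; there the
    new row vanishes and \<open>qdev\<close> does not change.\<close>
  define t where "t = (if s = 0 then 1 else s / S)"
  define L where "L = linf (A n) n"
  have t0: "0 < t" using ss S0 by (auto simp: t_def)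
  define G where "G x = (1 + t / 2) * qdev A n x ^ 4 + (32 * kap\<^sup>2 / t + 3 * kap) * (128 * (a ^ 4 + (cmod (L x)) ^ 4))" for x
  have up: "qdev A (Suc n) (x(n := \<xi>)) = qdev A n x + (a * ((cmod \<xi>)\<^sup>2 - 1) + 2 * Re (cnj \<xi> * L x))" for x \<xi>
    unfolding L_def a_def by (rule qdev_Suc[OF herm])
  have F: "(\<lambda>x. qdev A (Suc n) x ^ 4) \<in> borel_measurable (\<P> (Suc n))" by measurable
  show ?case
  proof (cases "s = 0")
    case True
    hence z: "a = 0" "\<sigma> = 0" using s0 unfolding s_def by (auto simp: add_nonneg_eq_0_iff)
    have "A n j = 0" if "j < n" for j
      using z(2) that unfolding \<sigma>_def by (subst (asm) sum_nonneg_eq_0_iff) auto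
    hence L0: "L x = 0" for x by (simp add: L_def linf_def)
    have up0: "qdev A (Suc n) (x(n := \<xi>)) = qdev A n x" for x \<xi> using up z L0 by simp
    have i: "integrable \<nu> (\<lambda>\<xi>. qdev A (Suc n) (x(n := \<xi>)) ^ 4)" for x unfolding up0 by simp
    have e: "(\<integral>\<xi>. qdev A (Suc n) (x(n := \<xi>)) ^ 4 \<partial>\<nu>) \<le> qdev A n x ^ 4" for x unfolding up0 by (simp add: prob_space)
    note st = PiM_step[OF F _ conjunct1[OF IH] i e]
    have "(\<integral>x. qdev A (Suc n) x ^ 4 \<partial>\<P> (Suc n)) \<le> (\<integral>x. qdev A n x ^ 4 \<partial>\<P> n)"
      by (rule st(2)) simp
    also have "\<dots> \<le> qconst * S * T" using IH by simp
    also have "\<dots> \<le> qconst * S * frob A (Suc n)"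
      using TS ss qconst_pos S0 by (intro mult_left_mono) auto
    finally show ?thesis using st(1) by auto
  next
    case False
    hence sp: "0 < s" and tS: "t = s / S" using ss by (auto simp: t_def)
    have L4: "integrable (\<P> n) (\<lambda>x. cmod (L x) ^ 4)"
        "(\<integral>x. cmod (L x) ^ 4 \<partial>\<P> n) \<le> (5 + 2 * m4) * \<sigma>\<^sup>2"
      unfolding L_def \<sigma>_def by (rule linf_fourth_moment)+
    have i: "integrable \<nu> (\<lambda>\<xi>. qdev A (Suc n) (x(n := \<xi>)) ^ 4)" for x
      unfolding up by (rule qdev_step(1)[OF t0])
    have e: "(\<integral>\<xi>. qdev A (Suc n) (x(n := \<xi>)) ^ 4 \<partial>\<nu>) \<le> G x" for x
      unfolding up G_def by (rule qdev_step(2)[OF t0])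
    have G: "integrable (\<P> n) G" unfolding G_def using IH L4 by simp
    note st = PiM_step[OF F _ G i e]
    have "(\<integral>x. qdev A (Suc n) x ^ 4 \<partial>\<P> (Suc n)) \<le> (\<integral>x. G x \<partial>\<P> n)"
      by (rule st(2)) simp
    also have "\<dots> = (1 + t / 2) * (\<integral>x. qdev A n x ^ 4 \<partial>\<P> n) +
        (32 * kap\<^sup>2 / t + 3 * kap) * (128 * (a ^ 4 + (\<integral>x. cmod (L x) ^ 4 \<partial>\<P> n)))"
      unfolding G_def using IH L4(1) by (simp add: Pn.prob_space)
    also have "\<dots> \<le> (1 + t / 2) * (qconst * S * T) + (35 * kap\<^sup>2 / t) * (128 * ((5 + 2 * m4) * s\<^sup>2))"
    proof (intro add_mono mult_mono)
      show "(\<integral>x. qdev A n x ^ 4 \<partial>\<P> n) \<le> qconst * S * T" using IH by simp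
      have "t \<le> 1" using sS S0 by (simp add: tS)
      have "3 * kap * t \<le> 3 * kap\<^sup>2 * 1"
        using kap_ge_1 \<open>t \<le> 1\<close> t0 by (intro mult_mono) (auto simp: power2_eq_square)
      thus "32 * kap\<^sup>2 / t + 3 * kap \<le> 35 * kap\<^sup>2 / t" using t0 by (simp add: field_simps)
      have "a ^ 4 \<le> (5 + 2 * m4) * a ^ 4" using m4_nonneg by (simp add: mult_le_cancel_right1)
      moreover have "(5 + 2 * m4) * (a ^ 4 + \<sigma>\<^sup>2) \<le> (5 + 2 * m4) * s\<^sup>2"
        using m4_nonneg s0 by (intro mult_left_mono) (auto simp: s_def power2_eq_square power4_eq_xxxx algebra_simps)
      ultimately have "a ^ 4 + (5 + 2 * m4) * \<sigma>\<^sup>2 \<le> (5 + 2 * m4) * s\<^sup>2" unfolding distrib_left by linarith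
      thus "a ^ 4 + (\<integral>x. cmod (L x) ^ 4 \<partial>\<P> n) \<le> (5 + 2 * m4) * s\<^sup>2" using L4(2) by linarith
    qed (use t0 kap_ge_1 m4_nonneg T0 S0 qconst_pos in \<open>auto intro!: integral_nonneg_AE add_nonneg_nonneg\<close>)
    also have "(35 * kap\<^sup>2 / t) * (128 * ((5 + 2 * m4) * s\<^sup>2)) = qconst * S * s / 2"
      using sp S0 unfolding tS qconst_def by (simp add: power2_eq_square field_simps)
    also have "(1 + t / 2) * (qconst * S * T) + qconst * S * s / 2 = qconst * S * (T + (s * (T / S) + s) / 2)"
      using S0 unfolding tS by (simp add: field_simps)
    also have "\<dots> \<le> qconst * S * (T + s)"
    proof (rule mult_left_mono)
      have "s * (T / S) \<le> s * 1" using TS' S0 ss by (intro mult_left_mono) auto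
      thus "T + (s * (T / S) + s) / 2 \<le> T + s" by simp
    qed (use qconst_pos S0 in auto)
    also have "\<dots> \<le> qconst * S * frob A (Suc n)"
      using TS qconst_pos S0 by (intro mult_left_mono) auto
    finally show ?thesis using st(1) by auto
  qed
qed

lemma qdev_fourth_moment:
  assumes herm: "\<And>i j. A i j = cnj (A j i)"
  shows "integrable (\<P> n) (\<lambda>x. (qdev A n x) ^ 4)"
    "(\<integral>x. (qdev A n x) ^ 4 \<partial>\<P> n) \<le> qconst * (frob A n)\<^sup>2"
proof -
  define T where "T = frob A n"
  have T0: "0 \<le> T" by (simp add: T_def sum_nonneg)
  show "integrable (\<P> n) (\<lambda>x. (qdev A n x) ^ 4)"
    using qdev_fourth_moment_aux[where A = A and n = n and S = "T + 1", OF herm] T0 by (simp add: T_def)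
  show "(\<integral>x. (qdev A n x) ^ 4 \<partial>\<P> n) \<le> qconst * (frob A n)\<^sup>2"
  proof (cases "T = 0")
    case True
    thus ?thesis using qdev_fourth_moment_aux[where A = A and n = n and S = 1, OF herm] by (simp add: T_def)
  next
    case False
    thus ?thesis using qdev_fourth_moment_aux[where A = A and n = n and S = T, OF herm] T0 by (simp add: T_def power2_eq_square mult.assoc)
  qed
qed

end

section \<open>The Stieltjes transform\<close>

lemma standardized_law_of_A1:
  assumes "assumption_A1 \<nu>"
  shows "standardized_law \<nu>"
proof -
  interpret N: prob_space \<nu> using assms by (simp add: assumption_A1_def)
  show ?thesis
    using assms assumption_A1_moment8[OF assms] by unfold_locales (auto simp: assumption_A1_def)
qed

context
  fixes \<mu> :: "real measure" and a :: real
  assumes mu: "prob_space \<mu>" "sets \<mu> = sets borel" and above: "AE t in \<mu>. a \<le> t"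
begin

interpretation prob_space \<mu> by (rule mu(1))

lemma stieltjes_minus: "stieltjes \<mu> z = - (\<integral>t. 1 / (t - z) \<partial>\<mu>)"
proof -
  have "1 / (z - t) = - (1 / (t - z))" for t :: real
    by (metis minus_diff_eq minus_divide_right)
  thus ?thesis by (simp add: stieltjes_def)
qed

lemma kernel_measurable [measurable]: "(\<lambda>t. 1 / (t - z)) \<in> borel_measurable \<mu>"
  by (simp add: measurable_cong_sets[OF mu(2) refl])

lemma integrable_kernel:
  assumes "z < a"
  shows "integrable \<mu> (\<lambda>t. 1 / (t - z))"
proof (rule integrable_const_bound[where B = "1 / (a - z)"])
  show "AE t in \<mu>. norm (1 / (t - z)) \<le> 1 / (a - z)"
    using above by eventually_elim (use assms in \<open>auto intro!: divide_left_mono mult_pos_pos\<close>)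
qed measurable

lemma stieltjes_strict_antimono:
  assumes "z < z'" "z' < a"
  shows "stieltjes \<mu> z' < stieltjes \<mu> z"
proof -
  have "(\<integral>t. 1 / (t - z) \<partial>\<mu>) < (\<integral>t. 1 / (t - z') \<partial>\<mu>)"
  proof (rule integral_less_AE_space)
    show "integrable \<mu> (\<lambda>t. 1 / (t - z))" "integrable \<mu> (\<lambda>t. 1 / (t - z'))"
      using assms by (auto intro: integrable_kernel)
    show "AE t in \<mu>. 1 / (t - z) < 1 / (t - z')"
      using above by eventually_elim (use assms in \<open>auto intro!: divide_strict_left_mono mult_pos_pos\<close>)
    show "emeasure \<mu> (space \<mu>) \<noteq> 0" by (simp add: emeasure_space_1)
  qed
  thus ?thesis by (simp add: stieltjes_minus)
qed

lemma stieltjes_bounds: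
  assumes "z < a"
  shows "stieltjes \<mu> z < 0" "- (1 / (a - z)) \<le> stieltjes \<mu> z"
proof -
  have "(\<integral>t. 0 \<partial>\<mu>) < (\<integral>t. 1 / (t - z) \<partial>\<mu>)"
  proof (rule integral_less_AE_space)
    show "AE t in \<mu>. 0 < 1 / (t - z)" using above by eventually_elim (use assms in auto)
  qed (use assms integrable_kernel in \<open>auto simp: emeasure_space_1\<close>)
  thus "stieltjes \<mu> z < 0" by (simp add: stieltjes_minus)
  have "(\<integral>t. 1 / (t - z) \<partial>\<mu>) \<le> (\<integral>t. 1 / (a - z) \<partial>\<mu>)"
  proof (rule integral_mono_AE)
    show "AE t in \<mu>. 1 / (t - z) \<le> 1 / (a - z)"
      using above by eventually_elim (use assms in \<open>auto intro!: divide_left_mono mult_pos_pos\<close>)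
  qed (use assms integrable_kernel in auto)
  thus "- (1 / (a - z)) \<le> stieltjes \<mu> z" by (simp add: stieltjes_minus prob_space)
qed

lemma continuous_on_stieltjes:
  assumes "z2 < a"
  shows "continuous_on {z1..z2} (stieltjes \<mu>)"
proof (rule lipschitz_on_continuous_on[where L = "1 / (a - z2)\<^sup>2"], rule lipschitz_onI)
  fix z z' assume z: "z \<in> {z1..z2}" "z' \<in> {z1..z2}"
  have za: "z < a" "z' < a" using z assms by auto
  have "stieltjes \<mu> z - stieltjes \<mu> z' = (\<integral>t. 1 / (t - z') - 1 / (t - z) \<partial>\<mu>)"
    using za by (simp add: stieltjes_minus integrable_kernel)
  also have "\<bar>\<dots>\<bar> \<le> (\<integral>t. \<bar>1 / (t - z') - 1 / (t - z)\<bar> \<partial>\<mu>)"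
    using integral_norm_bound[of \<mu> "\<lambda>t. 1 / (t - z') - 1 / (t - z)"] by simp
  also have "\<dots> \<le> (\<integral>t. 1 / (a - z2)\<^sup>2 * \<bar>z - z'\<bar> \<partial>\<mu>)"
  proof (rule integral_mono_AE)
    show "AE t in \<mu>. \<bar>1 / (t - z') - 1 / (t - z)\<bar> \<le> 1 / (a - z2)\<^sup>2 * \<bar>z - z'\<bar>"
      using above
    proof eventually_elim
      case (elim t)
      have p: "0 < a - z2" "a - z2 \<le> t - z" "a - z2 \<le> t - z'" using elim z assms by auto
      hence "0 < t - z" "0 < t - z'" by linarith+
      hence "1 / (t - z') - 1 / (t - z) = (z' - z) / ((t - z') * (t - z))"
        by (simp add: field_simps)
      also have "\<bar>\<dots>\<bar> = \<bar>z - z'\<bar> / ((t - z') * (t - z))" using \<open>0 < t - z\<close> \<open>0 < t - z'\<close>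
        by (simp add: abs_mult abs_minus_commute)
      also have "\<dots> \<le> \<bar>z - z'\<bar> / (a - z2)\<^sup>2"
        unfolding power2_eq_square using p by (intro divide_left_mono mult_mono mult_pos_pos) auto
      finally show ?case by simp
    qed
  qed (use za integrable_kernel in auto)
  finally show "dist (stieltjes \<mu> z) (stieltjes \<mu> z') \<le> 1 / (a - z2)\<^sup>2 * dist z z'"
    by (simp add: dist_real_def prob_space)
qed (use assms in simp)

text \<open>If G has a finite limit L at a from the left, then L < 0 and the hypothesis says L <
  1/\<theta>, so points near a will do. If it has none, G cannot stay above 1/\<theta>, for a
  monotone function bounded below would converge to its infimum.\<close>

lemma theta_under_less_imp:
  assumes th: "\<theta> < theta_under \<mu> a" and neg: "\<theta> < 0"
  shows "\<exists>z<a. stieltjes \<mu> z < 1 / \<theta>"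
proof (cases "\<exists>L. (stieltjes \<mu> \<longlongrightarrow> L) (at_left a)")
  case True
  then obtain L where L: "(stieltjes \<mu> \<longlongrightarrow> L) (at_left a)" by auto
  have "Lim (at_left a) (stieltjes \<mu>) = L" by (rule tendsto_Lim[OF _ L]) simp
  hence tu: "theta_under \<mu> a = 1 / L" using True by (simp add: theta_under_def G_left_def)
  have "L \<le> stieltjes \<mu> (a - 1)"
  proof (rule tendsto_upperbound[OF L])
    have "eventually (\<lambda>z. z \<in> {a - 1<..<a}) (at_left a)" by (rule eventually_at_leftI[of "a - 1"]) auto
    thus "eventually (\<lambda>z. stieltjes \<mu> z \<le> stieltjes \<mu> (a - 1)) (at_left a)"
      by eventually_elim (auto intro: less_imp_le stieltjes_strict_antimono)
  qed simp
  hence L0: "L < 0" using stieltjes_bounds(1)[of "a - 1"] by simp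
  have "L < 1 / \<theta>" using th neg L0 unfolding tu by (simp add: field_simps)
  from order_tendstoD(2)[OF L this] have "eventually (\<lambda>z. stieltjes \<mu> z < 1 / \<theta> \<and> z < a) (at_left a)"
    by (intro eventually_conj) (auto intro: eventually_at_leftI[of "a - 1"])
  thus ?thesis using eventually_happens[of _ "at_left a"] by (auto simp: trivial_limit_at_left_real)
next
  case False
  show ?thesis
  proof (rule ccontr)
    assume "\<not> ?thesis"
    hence lb: "1 / \<theta> \<le> stieltjes \<mu> z" if "z < a" for z using that by force
    define L where "L = Inf (stieltjes \<mu> ` {..<a})"
    have bdd: "bdd_below (stieltjes \<mu> ` {..<a})" using lb by (auto intro!: bdd_belowI[of _ "1 / \<theta>"])
    have "(stieltjes \<mu> \<longlongrightarrow> L) (at_left a)"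
    proof (rule order_tendstoI)
      fix y assume y: "y < L"
      have "L \<le> stieltjes \<mu> z" if "z < a" for z unfolding L_def using bdd that by (auto intro: cInf_lower)
      thus "eventually (\<lambda>z. y < stieltjes \<mu> z) (at_left a)"
        using y by (intro eventually_at_leftI[of "a - 1"]) (auto intro: less_le_trans)
    next
      fix y assume "L < y"
      then obtain z0 where z0: "z0 < a" "stieltjes \<mu> z0 < y"
        unfolding L_def using bdd by (subst (asm) cInf_less_iff) auto
      show "eventually (\<lambda>z. stieltjes \<mu> z < y) (at_left a)"
        by (rule eventually_at_leftI[OF _ z0(1)]) (auto intro: less_trans[OF stieltjes_strict_antimono z0(2)])
    qed
    with False show False by auto
  qed
qed

text \<open>An infinite limit would give \<open>theta_under\<close> the value 0, which is not below
  a negative \<theta>. Otherwise inverting 1/L < \<theta> between negative numbers yields the form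
  of the inequality that the spacing condition is compared with.\<close>

lemma less_theta_under_imp:
  assumes "theta_under \<mu> a < \<theta>" and neg: "\<theta> < 0"
  shows "\<exists>L. G_left \<mu> a = ereal L \<and> 1 / \<theta> < L"
proof (cases "G_left \<mu> a = -\<infinity>")
  case True
  thus ?thesis using assms by (simp add: theta_under_def)
next
  case False
  hence "G_left \<mu> a = ereal (Lim (at_left a) (stieltjes \<mu>))"
    unfolding G_left_def by (metis (no_types, lifting))
  then obtain L where L: "G_left \<mu> a = ereal L" by blast
  hence "1 / L < \<theta>" using assms by (simp add: theta_under_def)
  moreover have "L < 0"
  proof (rule ccontr)
    assume "\<not> L < 0"
    hence "0 \<le> 1 / L" by simp
    with \<open>1 / L < \<theta>\<close> neg show False by linarith
  qed
  ultimately have "1 / \<theta> < L" using neg by (simp add: field_simps)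
  with L show ?thesis by auto
qed

lemma rho_properties:
  assumes th: "\<theta> < theta_under \<mu> a" and neg: "\<theta> < 0" and below: "AE t in \<mu>. t \<le> b"
  shows "rho \<mu> a b \<theta> < a" "stieltjes \<mu> (rho \<mu> a b \<theta>) = 1 / \<theta>"
proof -
  obtain z2 where z2: "z2 < a" "stieltjes \<mu> z2 < 1 / \<theta>" using theta_under_less_imp[OF th neg] by auto
  \<comment> \<open>Going down by at least |\<theta>| below a makes G(z1) \<ge> -1/(a - z1) \<ge>
    1/\<theta>, the second endpoint for the intermediate value theorem. Solutions above b are
    excluded later by sign, G being nonnegative there.\<close>
  define z1 where "z1 = min z2 (a + \<theta>)"
  have z1: "z1 \<le> z2" "z1 < a" using z2 neg by (auto simp: z1_def)
  have "- \<theta> \<le> a - z1" by (simp add: z1_def min_def)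
  hence "1 / (a - z1) \<le> 1 / (- \<theta>)" using neg z1 by (intro divide_left_mono mult_pos_pos) auto
  hence "1 / \<theta> \<le> stieltjes \<mu> z1" using stieltjes_bounds(2)[OF z1(2)] by simp
  from IVT2'[OF less_imp_le[OF z2(2)] this z1(1) continuous_on_stieltjes[OF z2(1)]]
  obtain r where r: "r \<le> z2" "stieltjes \<mu> r = 1 / \<theta>" by auto
  have ra: "r < a" using r z2 by simp
  have "(THE z. (z < a \<or> z > b) \<and> stieltjes \<mu> z = 1 / \<theta>) = r"
  proof (rule the_equality)
    show "(r < a \<or> r > b) \<and> stieltjes \<mu> r = 1 / \<theta>" using r ra by simp
    fix z assume z: "(z < a \<or> z > b) \<and> stieltjes \<mu> z = 1 / \<theta>"
    have "\<not> z > b"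
    proof
      assume "z > b"
      have "0 \<le> stieltjes \<mu> z" unfolding stieltjes_def
        by (rule integral_nonneg_AE) (use below \<open>z > b\<close> in \<open>auto elim!: eventually_mono\<close>)
      moreover have "1 / \<theta> < 0" using neg by simp
      ultimately show False using z by linarith
    qed
    hence za: "z < a" using z by auto
    show "z = r"
    proof (rule ccontr)
      assume "z \<noteq> r"
      with stieltjes_strict_antimono[of z r] stieltjes_strict_antimono[of r z] za ra z r
      show False by (cases "z < r") auto
    qed
  qed
  hence "rho \<mu> a b \<theta> = r" using th by (simp add: rho_def)
  thus "rho \<mu> a b \<theta> < a" "stieltjes \<mu> (rho \<mu> a b \<theta>) = 1 / \<theta>" using ra r by auto
qed

end

section \<open>Concentration of weighted sums of squared coordinates\<close>

context standardized_law
begin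

text \<open>The weighted sum is the quadratic form of A = sum_k c_k e_k e_k*. Orthonormality gives A
  the trace sum c_k and the squared Frobenius norm sum c_k^2, so the fourth-moment bound and
  Markov's inequality for the fourth power apply.\<close>

lemma weights_concentration:
  fixes M :: "'s measure" and x :: "nat \<Rightarrow> 's \<Rightarrow> complex" and e :: "nat \<Rightarrow> nat \<Rightarrow> complex" and c :: "nat \<Rightarrow> real"
  assumes M: "prob_space M" and n: "0 < n"
    and indep: "prob_space.indep_vars M (\<lambda>_. borel) x {..<n}"
    and distr: "\<And>i. i < n \<Longrightarrow> distr M borel (x i) = \<nu>"
    and orth: "\<And>k l. k < n \<Longrightarrow> l < n \<Longrightarrow> ip n (e k) (e l) = (if k = l then 1 else 0)"
    and \<delta>: "0 < \<delta>"
  shows "measure M {\<omega>\<in>space M. \<delta> \<le> \<bar>(\<Sum>k<n. c k * (cmod (ip n (e k) (\<lambda>i. x i \<omega>)))\<^sup>2) - (\<Sum>k<n. c k)\<bar>}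
     \<le> qconst * (\<Sum>k<n. (c k)\<^sup>2)\<^sup>2 / \<delta> ^ 4"
proof -
  interpret M: prob_space M by fact
  define A where "A i j = (\<Sum>k<n. complex_of_real (c k) * (e k i * cnj (e k j)))" for i j
  have herm: "A i j = cnj (A j i)" for i j by (simp add: A_def mult_ac)
  have tr: "(\<Sum>i<n. Re (A i i)) = (\<Sum>k<n. c k)"
  proof -
    have "(\<Sum>i<n. A i i) = (\<Sum>k<n. complex_of_real (c k) * ip n (e k) (e k))"
      unfolding A_def by (subst sum.swap) (simp add: ip_def sum_distrib_left mult_ac)
    also have "\<dots> = (\<Sum>k<n. complex_of_real (c k))" by (intro sum.cong) (auto simp: orth)
    finally have "Re (\<Sum>i<n. A i i) = Re (\<Sum>k<n. complex_of_real (c k))" by simp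
    thus ?thesis by simp
  qed
  have quad: "Re (\<Sum>i<n. \<Sum>j<n. A i j * cnj (y i) * y j) = (\<Sum>k<n. c k * (cmod (ip n (e k) y))\<^sup>2)" for y
  proof -
    have "(\<Sum>i<n. \<Sum>j<n. A i j * cnj (y i) * y j) =
      (\<Sum>i<n. \<Sum>j<n. \<Sum>k<n. complex_of_real (c k) * ((e k i * cnj (y i)) * (cnj (e k j) * y j)))"
      by (simp add: A_def sum_distrib_right sum_distrib_left mult_ac)
    also have "\<dots> = (\<Sum>i<n. \<Sum>k<n. \<Sum>j<n. complex_of_real (c k) * ((e k i * cnj (y i)) * (cnj (e k j) * y j)))"
      by (intro sum.cong refl sum.swap)
    also have "\<dots> = (\<Sum>k<n. \<Sum>i<n. \<Sum>j<n. complex_of_real (c k) * ((e k i * cnj (y i)) * (cnj (e k j) * y j)))"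
      by (rule sum.swap)
    also have "\<dots> = (\<Sum>k<n. complex_of_real (c k) * (cnj (ip n (e k) y) * ip n (e k) y))"
    proof (intro sum.cong refl)
      fix k
      have "cnj (ip n (e k) y) * ip n (e k) y = (\<Sum>i<n. \<Sum>j<n. (e k i * cnj (y i)) * (cnj (e k j) * y j))"
        unfolding ip_def cnj_sum complex_cnj_mult complex_cnj_cnj sum_product ..
      thus "(\<Sum>i<n. \<Sum>j<n. complex_of_real (c k) * ((e k i * cnj (y i)) * (cnj (e k j) * y j))) =
        complex_of_real (c k) * (cnj (ip n (e k) y) * ip n (e k) y)"
        by (simp only: sum_distrib_left)
    qed
    also have "\<dots> = complex_of_real (\<Sum>k<n. c k * (cmod (ip n (e k) y))\<^sup>2)"
      by (simp add: complex_norm_square mult_ac del: of_real_power)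
    finally show ?thesis by simp
  qed
  have qd: "qdev A n y = (\<Sum>k<n. c k * (cmod (ip n (e k) y))\<^sup>2) - (\<Sum>k<n. c k)" for y
    by (simp only: qdev_def quad tr)
  have frob: "frob A n = (\<Sum>k<n. (c k)\<^sup>2)"
  proof -
    \<comment> \<open>Parseval: column j of A is the combination of the e_k with coefficients c_k
      times the conjugate of \<open>e k j\<close>.\<close>
    have col: "sqnorm n (\<lambda>i. A i j) = (\<Sum>k<n. (c k)\<^sup>2 * (cmod (e k j))\<^sup>2)" for j
    proof -
      define d where "d k = complex_of_real (c k) * cnj (e k j)" for k
      define y where "y = (\<lambda>i. \<Sum>k<n. d k * e k i)"
      have y: "ip n (e k) y = d k" if "k < n" for k
        unfolding y_def using that by (subst ip_combination[OF orth]) auto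
      have "complex_of_real (sqnorm n y) = ip n y y" by (rule sqnorm_ip)
      also have "\<dots> = (\<Sum>k<n. d k * ip n y (e k))"
        by (subst (2) y_def) (rule ip_sum_right)
      also have "\<dots> = (\<Sum>k<n. complex_of_real ((cmod (d k))\<^sup>2))"
        by (intro sum.cong) (auto simp: complex_norm_square y simp flip: ip_cnj[of n _ y] simp del: of_real_power)
      finally have "sqnorm n y = (\<Sum>k<n. (cmod (d k))\<^sup>2)" by (simp only: of_real_sum[symmetric] of_real_eq_iff)
      moreover have "y = (\<lambda>i. A i j)" by (simp add: y_def A_def d_def mult_ac)
      ultimately show ?thesis by (simp add: d_def norm_mult power_mult_distrib)
    qed
    have nrm: "sqnorm n (e k) = 1" if "k < n" for k
    proof -
      have "complex_of_real (sqnorm n (e k)) = ip n (e k) (e k)" by (rule sqnorm_ip)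
      also have "\<dots> = complex_of_real 1" using orth[OF that that] by simp
      finally show ?thesis by (simp only: of_real_eq_iff)
    qed
    have "frob A n = (\<Sum>j<n. \<Sum>k<n. (c k)\<^sup>2 * (cmod (e k j))\<^sup>2)"
      by (subst sum.swap) (simp add: col)
    also have "\<dots> = (\<Sum>k<n. (c k)\<^sup>2 * sqnorm n (e k))"
      by (subst sum.swap) (simp add: sum_distrib_left)
    also have "\<dots> = (\<Sum>k<n. (c k)\<^sup>2)" by (intro sum.cong) (auto simp: nrm)
    finally show ?thesis .
  qed
  have rv: "x i \<in> borel_measurable M" if "i < n" for i
    using indep that unfolding M.indep_vars_def by auto
  have law: "distr M (PiM {..<n} (\<lambda>_. borel)) (\<lambda>\<omega>. \<lambda>i\<in>{..<n}. x i \<omega>) = PiM {..<n} (\<lambda>_. \<nu>)"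
  proof -
    have "distr M (PiM {..<n} (\<lambda>_. borel)) (\<lambda>\<omega>. \<lambda>i\<in>{..<n}. x i \<omega>) = PiM {..<n} (\<lambda>i. distr M borel (x i))"
      using indep n rv by (subst (asm) M.indep_vars_iff_distr_eq_PiM') auto
    also have "\<dots> = PiM {..<n} (\<lambda>_. \<nu>)" by (rule PiM_cong) (auto simp: distr)
    finally show ?thesis .
  qed
  have restr: "qdev A n (\<lambda>i\<in>{..<n}. x i \<omega>) = qdev A n (\<lambda>i. x i \<omega>)" for \<omega>
    by (simp add: qdev_def)
  have sb: "sets (PiM {..<n} (\<lambda>_. \<nu>)) = sets (PiM {..<n} (\<lambda>_. borel :: complex measure))"
    by (rule sets_PiM_cong) (auto simp: sets_borel)
  have mt: "(\<lambda>\<omega>. \<lambda>i\<in>{..<n}. x i \<omega>) \<in> measurable M (PiM {..<n} (\<lambda>_. borel))"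
    using rv by (intro measurable_restrict) auto
  have mq: "(\<lambda>y. qdev A n y ^ 4) \<in> borel_measurable (PiM {..<n} (\<lambda>_. borel :: complex measure))"
    using borel_measurable_power[OF measurable_qdev[of A n], of 4] by (simp add: measurable_cong_sets[OF sb refl])
  have int: "integrable M (\<lambda>\<omega>. qdev A n (\<lambda>i. x i \<omega>) ^ 4)"
    using qdev_fourth_moment(1)[where A = A and n = n, OF herm]
    unfolding law[symmetric] by (subst (asm) integrable_distr_eq[OF mt mq]) (simp add: restr)
  have "(\<integral>\<omega>. qdev A n (\<lambda>i. x i \<omega>) ^ 4 \<partial>M) \<le> qconst * (\<Sum>k<n. (c k)\<^sup>2)\<^sup>2"
    using qdev_fourth_moment(2)[where A = A and n = n, OF herm]
    unfolding law[symmetric] frob by (subst (asm) integral_distr[OF mt mq]) (simp add: restr)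
  hence "(\<integral>\<omega>. qdev A n (\<lambda>i. x i \<omega>) ^ 4 \<partial>M) / \<delta> ^ 4 \<le> qconst * (\<Sum>k<n. (c k)\<^sup>2)\<^sup>2 / \<delta> ^ 4"
    using \<delta> by (intro divide_right_mono) auto
  moreover have "measure M {\<omega>\<in>space M. \<delta> ^ 4 \<le> qdev A n (\<lambda>i. x i \<omega>) ^ 4} \<le> (\<integral>\<omega>. qdev A n (\<lambda>i. x i \<omega>) ^ 4 \<partial>M) / \<delta> ^ 4"
    by (rule integral_Markov_inequality_measure[OF int, where A = "{}"]) (use \<delta> in auto)
  moreover have "\<delta> ^ 4 \<le> y ^ 4 \<longleftrightarrow> \<delta> \<le> \<bar>y\<bar>" for y :: real
  proof -
    have "y ^ 4 = \<bar>y\<bar> ^ 4" by (simp add: power_abs)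
    thus ?thesis using \<delta> by (metis abs_ge_zero less_imp_le power_mono power_less_imp_less_base power_strict_mono not_le zero_less_numeral)
  qed
  ultimately show ?thesis by (simp add: qd)
qed

end

section \<open>Convergence in probability\<close>

definition vanishing :: "'s measure \<Rightarrow> (nat \<Rightarrow> 's \<Rightarrow> real) \<Rightarrow> bool" where
  "vanishing M Y \<longleftrightarrow> (\<forall>n. Y n \<in> borel_measurable M) \<and>
     (\<forall>\<delta>>0. (\<lambda>n. measure M {\<omega>\<in>space M. \<delta> \<le> \<bar>Y n \<omega>\<bar>}) \<longlonglongrightarrow> 0)"

text \<open>Convergence to zero in probability of functions that need not be measurable;
  unlike \<^const>\<open>conv_prob_zero\<close> this notion is monotone in \<open>Z\<close>.\<close>

definition outer_vanishing :: "'s measure \<Rightarrow> (nat \<Rightarrow> 's \<Rightarrow> real) \<Rightarrow> bool" where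
  "outer_vanishing M Z \<longleftrightarrow> (\<forall>\<epsilon>>0. \<exists>B. (\<forall>n. B n \<in> sets M) \<and>
     (\<forall>\<^sub>F n in sequentially. {\<omega>\<in>space M. \<epsilon> < \<bar>Z n \<omega>\<bar>} \<subseteq> B n) \<and> (\<lambda>n. measure M (B n)) \<longlonglongrightarrow> 0)"

context prob_space
begin

lemma vanishing_add_null_sequence:
  assumes Y: "vanishing M Y" and c: "c \<longlonglongrightarrow> 0"
  shows "vanishing M (\<lambda>n \<omega>. Y n \<omega> + c n)"
  unfolding vanishing_def
proof (intro conjI allI impI)
  have m: "Y n \<in> borel_measurable M" for n using Y by (simp add: vanishing_def)
  show "(\<lambda>\<omega>. Y n \<omega> + c n) \<in> borel_measurable M" for n using m by simp
  fix \<delta> :: real assume d: "0 < \<delta>"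
  show "(\<lambda>n. prob {\<omega>\<in>space M. \<delta> \<le> \<bar>Y n \<omega> + c n\<bar>}) \<longlonglongrightarrow> 0"
  proof (rule tendsto_sandwich[OF _ _ tendsto_const])
    show "(\<lambda>n. prob {\<omega>\<in>space M. \<delta> / 2 \<le> \<bar>Y n \<omega>\<bar>}) \<longlonglongrightarrow> 0" using Y half_gt_zero[OF d] unfolding vanishing_def by blast
    have "\<forall>\<^sub>F n in sequentially. \<bar>c n\<bar> < \<delta> / 2" using c d by (auto simp: tendsto_iff dist_real_def elim!: allE[of _ "\<delta> / 2"])
    thus "\<forall>\<^sub>F n in sequentially. prob {\<omega>\<in>space M. \<delta> \<le> \<bar>Y n \<omega> + c n\<bar>} \<le> prob {\<omega>\<in>space M. \<delta> / 2 \<le> \<bar>Y n \<omega>\<bar>}"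
      by eventually_elim (use m in \<open>auto intro!: finite_measure_mono\<close>)
  qed auto
qed

text \<open>Turns a deterministic implication, valid for each \<omega> at large n, into a statement
  in probability: the covering set is the union of the measurable events on which some member of F
  is at least \<delta>.\<close>

lemma outer_vanishingI:
  assumes F: "finite F" "\<And>Y. Y \<in> F \<Longrightarrow> vanishing M Y"
    and Z: "\<And>\<epsilon>. 0 < \<epsilon> \<Longrightarrow> \<exists>\<delta>>0. \<forall>\<^sub>F n in sequentially. \<forall>\<omega>\<in>space M. (\<forall>Y\<in>F. \<bar>Y n \<omega>\<bar> < \<delta>) \<longrightarrow> \<bar>Z n \<omega>\<bar> \<le> \<epsilon>"
  shows "outer_vanishing M Z"
  unfolding outer_vanishing_def
proof (intro allI impI)
  fix \<epsilon> :: real assume "0 < \<epsilon>"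
  from Z[OF this] obtain \<delta> where d: "\<delta> > 0"
    and ev: "\<forall>\<^sub>F n in sequentially. \<forall>\<omega>\<in>space M. (\<forall>Y\<in>F. \<bar>Y n \<omega>\<bar> < \<delta>) \<longrightarrow> \<bar>Z n \<omega>\<bar> \<le> \<epsilon>" by auto
  define C where "C Y n = {\<omega>\<in>space M. \<delta> \<le> \<bar>Y n \<omega>\<bar>}" for Y :: "nat \<Rightarrow> 'a \<Rightarrow> real" and n
  have C: "C Y n \<in> sets M" if "Y \<in> F" for Y n
  proof -
    have [measurable]: "Y n \<in> borel_measurable M" using F(2)[OF that] by (simp add: vanishing_def)
    show ?thesis unfolding C_def by measurable
  qed
  define B where "B n = (\<Union>Y\<in>F. C Y n)" for n
  show "\<exists>B. (\<forall>n. B n \<in> sets M) \<and> (\<forall>\<^sub>F n in sequentially. {\<omega>\<in>space M. \<epsilon> < \<bar>Z n \<omega>\<bar>} \<subseteq> B n) \<and> (\<lambda>n. prob (B n)) \<longlonglongrightarrow> 0"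
  proof (intro exI[of _ B] conjI allI)
    show "B n \<in> sets M" for n unfolding B_def using C F(1) by auto
    show "\<forall>\<^sub>F n in sequentially. {\<omega>\<in>space M. \<epsilon> < \<bar>Z n \<omega>\<bar>} \<subseteq> B n"
      using ev
    proof eventually_elim
      case (elim n)
      show ?case
      proof
        fix \<omega> assume w: "\<omega> \<in> {\<omega>\<in>space M. \<epsilon> < \<bar>Z n \<omega>\<bar>}"
        with elim have "\<not> (\<forall>Y\<in>F. \<bar>Y n \<omega>\<bar> < \<delta>)" by fastforce
        thus "\<omega> \<in> B n" using w by (auto simp: B_def C_def not_less)
      qed
    qed
    show "(\<lambda>n. prob (B n)) \<longlonglongrightarrow> 0"
    proof (rule tendsto_sandwich[OF _ _ tendsto_const])
      show "(\<lambda>n. \<Sum>Y\<in>F. prob (C Y n)) \<longlonglongrightarrow> 0"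
        by (rule tendsto_null_sum) (use F(2) d in \<open>auto simp: vanishing_def C_def\<close>)
      show "\<forall>\<^sub>F n in sequentially. prob (B n) \<le> (\<Sum>Y\<in>F. prob (C Y n))"
        unfolding B_def by (intro always_eventually allI finite_measure_subadditive_finite F(1)) (use C in auto)
    qed auto
  qed
qed

lemma outer_vanishing_mono:
  assumes Z: "outer_vanishing M Z"
    and le: "\<forall>\<^sub>F n in sequentially. \<forall>\<omega>\<in>space M. \<bar>Z' n \<omega>\<bar> \<le> \<bar>Z n \<omega>\<bar>"
  shows "outer_vanishing M Z'"
  unfolding outer_vanishing_def
proof (intro allI impI)
  fix \<epsilon> :: real assume "0 < \<epsilon>"
  with Z obtain B where B: "\<And>n. B n \<in> sets M" "(\<lambda>n. measure M (B n)) \<longlonglongrightarrow> 0"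
    "\<forall>\<^sub>F n in sequentially. {\<omega>\<in>space M. \<epsilon> < \<bar>Z n \<omega>\<bar>} \<subseteq> B n" unfolding outer_vanishing_def by meson
  have "\<forall>\<^sub>F n in sequentially. {\<omega>\<in>space M. \<epsilon> < \<bar>Z' n \<omega>\<bar>} \<subseteq> B n"
    using B(3) le
  proof eventually_elim
    case (elim n)
    have "{\<omega>\<in>space M. \<epsilon> < \<bar>Z' n \<omega>\<bar>} \<subseteq> {\<omega>\<in>space M. \<epsilon> < \<bar>Z n \<omega>\<bar>}" using elim(2) by force
    thus ?case using elim(1) by blast
  qed
  thus "\<exists>B. (\<forall>n. B n \<in> sets M) \<and> (\<forall>\<^sub>F n in sequentially. {\<omega>\<in>space M. \<epsilon> < \<bar>Z' n \<omega>\<bar>} \<subseteq> B n) \<and> (\<lambda>n. measure M (B n)) \<longlonglongrightarrow> 0"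
    using B by blast
qed

text \<open>Only the covering sets have to be measurable: \<open>measure\<close> gives a
  nonmeasurable set the value 0, so the comparison holds in either case.\<close>

lemma outer_vanishing_imp_conv_prob_zero:
  assumes Z: "outer_vanishing M Z"
  shows "conv_prob_zero M Z"
  unfolding conv_prob_zero_def
proof (intro allI impI)
  fix \<epsilon> :: real assume "0 < \<epsilon>"
  with Z obtain B where B: "\<And>n. B n \<in> sets M" "(\<lambda>n. measure M (B n)) \<longlonglongrightarrow> 0"
    "\<forall>\<^sub>F n in sequentially. {\<omega>\<in>space M. \<epsilon> < \<bar>Z n \<omega>\<bar>} \<subseteq> B n" unfolding outer_vanishing_def by meson
  show "(\<lambda>n. prob {\<omega> \<in> space M. \<epsilon> < \<bar>Z n \<omega>\<bar>}) \<longlonglongrightarrow> 0"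
  proof (rule tendsto_sandwich[OF _ _ tendsto_const B(2)])
    show "\<forall>\<^sub>F n in sequentially. prob {\<omega> \<in> space M. \<epsilon> < \<bar>Z n \<omega>\<bar>} \<le> prob (B n)"
      using B(3) by eventually_elim (intro finite_measure_mono B(1))
  qed simp
qed

text \<open>Borel-Cantelli at each level 1/(m+1), then a countable intersection. Only the convergent
  half is used, so nothing is asked of the joint law of the Y n.\<close>

lemma AE_tendsto_zero_of_summable:
  fixes Y :: "nat \<Rightarrow> 'a \<Rightarrow> real"
  assumes meas: "\<And>n. Y n \<in> borel_measurable M"
    and sm: "\<And>\<delta>. 0 < \<delta> \<Longrightarrow> summable (\<lambda>n. prob {\<omega>\<in>space M. \<delta> \<le> \<bar>Y n \<omega>\<bar>})"
  shows "AE \<omega> in M. (\<lambda>n. Y n \<omega>) \<longlonglongrightarrow> 0"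
proof -
  define C where "C m n = {\<omega>\<in>space M. 1 / real (Suc m) \<le> \<bar>Y n \<omega>\<bar>}" for m n
  have C: "C m n \<in> sets M" for m n unfolding C_def using meas by measurable
  have "AE \<omega> in M. \<forall>m. eventually (\<lambda>n. \<omega> \<in> space M - C m n) sequentially"
    unfolding AE_all_countable
  proof
    fix m
    show "AE \<omega> in M. eventually (\<lambda>n. \<omega> \<in> space M - C m n) sequentially"
      by (rule borel_cantelli_AE1) (use C sm[of "1 / real (Suc m)"] in \<open>auto simp: C_def emeasure_eq_measure\<close>)
  qed
  thus ?thesis
  proof eventually_elim
    case (elim \<omega>)
    show ?case
    proof (rule tendstoI)
      fix \<epsilon> :: real assume "0 < \<epsilon>"
      then obtain m where m: "1 / real (Suc m) < \<epsilon>" using nat_approx_posE by metis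
      from elim have "eventually (\<lambda>n. \<omega> \<in> space M - C m n) sequentially" by auto
      thus "\<forall>\<^sub>F n in sequentially. dist (Y n \<omega>) 0 < \<epsilon>"
        by eventually_elim (use m in \<open>auto simp: C_def dist_real_def\<close>)
    qed
  qed
qed

end

section \<open>The random model: spectral weights, effective perturbation and sticking from
  below\<close>

locale rank_one_model = standardized_law \<nu> + M: prob_space M for \<nu> and M :: "'s measure" +
  fixes X :: "nat \<Rightarrow> complex mat" and e :: "nat \<Rightarrow> nat \<Rightarrow> nat \<Rightarrow> complex"
    and x :: "nat \<Rightarrow> nat \<Rightarrow> 's \<Rightarrow> complex" and orth :: bool and \<theta> :: real
  assumes herm: "\<And>n. hermitian_n n (X n)"
    and eb: "\<And>n. eigenbasis n (X n) (e n)"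
    and indep: "\<And>n. M.indep_vars (\<lambda>_. borel) (x n) {..<n}"
    and distr_x: "\<And>n i. i < n \<Longrightarrow> distr M borel (x n i) = \<nu>"
    and theta_neg: "\<theta> < 0"
begin

text \<open>Eigenvalues are numbered from 0 below, so \<open>la n k\<close> is the paper's $\lambda^n_{k+1}$.\<close>

definition la :: "nat \<Rightarrow> nat \<Rightarrow> real" where
  "la n k = eig (X n) (Suc k)"

definition lb :: "nat \<Rightarrow> 's \<Rightarrow> nat \<Rightarrow> real" where
  "lb n \<omega> k = eig (X n + rank_one n \<theta> (model_vec orth n (\<lambda>i. x n i \<omega>))) (Suc k)"

definition v :: "nat \<Rightarrow> 's \<Rightarrow> nat \<Rightarrow> complex" where
  "v n \<omega> i = x n i \<omega> / complex_of_real (sqrt (real n))"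

definition W :: "nat \<Rightarrow> 's \<Rightarrow> nat \<Rightarrow> real" where
  "W n \<omega> k = (cmod (ip n (e n k) (v n \<omega>)))\<^sup>2"

definition sumW :: "(nat \<Rightarrow> nat \<Rightarrow> real) \<Rightarrow> nat \<Rightarrow> 's \<Rightarrow> real" where
  "sumW c n \<omega> = (\<Sum>k<n. c n k * W n \<omega> k)"

definition mean :: "(nat \<Rightarrow> nat \<Rightarrow> real) \<Rightarrow> nat \<Rightarrow> real" where
  "mean c n = (\<Sum>k<n. c n k) / real n"

definition dev :: "(nat \<Rightarrow> nat \<Rightarrow> real) \<Rightarrow> nat \<Rightarrow> 's \<Rightarrow> real" where
  "dev c n \<omega> = sumW c n \<omega> - mean c n"

abbreviation N :: "nat \<Rightarrow> 's \<Rightarrow> real" where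
  "N \<equiv> sumW (\<lambda>_ _. 1)"

text \<open>Normalising the vector amounts to replacing \<open>\<theta>\<close> by \<open>\<theta> / N\<close>; \<open>T\<close> is the reciprocal of the modulus
  of the effective perturbation strength.\<close>

definition T :: "nat \<Rightarrow> 's \<Rightarrow> real" where
  "T n \<omega> = (if orth then N n \<omega> else 1) / \<bar>\<theta>\<bar>"

lemma W_nonneg [simp]: "0 \<le> W n \<omega> k" by (simp add: W_def)

lemma la_mono: "k \<le> l \<Longrightarrow> l < n \<Longrightarrow> la n k \<le> la n l"
  using eb[of n] by (simp add: eigenbasis_def la_def)

lemma measurable_x: "i < n \<Longrightarrow> x n i \<in> borel_measurable M"
  using indep[of n] unfolding M.indep_vars_def by auto

lemma measurable_W: "(\<lambda>\<omega>. W n \<omega> k) \<in> borel_measurable M"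
proof -
  have "(\<lambda>\<omega>. ip n (e n k) (v n \<omega>)) \<in> borel_measurable M"
    unfolding ip_def v_def by (intro borel_measurable_sum borel_measurable_times borel_measurable_divide measurable_x) auto
  thus ?thesis unfolding W_def by simp
qed

lemma measurable_dev: "dev c n \<in> borel_measurable M"
  unfolding dev_def sumW_def using measurable_W by simp

lemma dev_concentration:
  assumes n: "0 < n" and \<delta>: "0 < \<delta>"
  shows "M.prob {\<omega>\<in>space M. \<delta> \<le> \<bar>dev c n \<omega>\<bar>} \<le> qconst / \<delta> ^ 4 * ((\<Sum>k<n. (c n k)\<^sup>2) / (real n)\<^sup>2)\<^sup>2"
proof -
  have W: "W n \<omega> k = (cmod (ip n (e n k) (\<lambda>i. x n i \<omega>)))\<^sup>2 / real n" for \<omega> k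
  proof -
    have "ip n (e n k) (v n \<omega>) = ip n (e n k) (\<lambda>i. x n i \<omega>) / complex_of_real (sqrt (real n))"
      by (simp add: ip_def v_def sum_divide_distrib)
    thus ?thesis by (simp add: W_def norm_divide power_divide)
  qed
  have dv: "dev c n \<omega> = ((\<Sum>k<n. c n k * (cmod (ip n (e n k) (\<lambda>i. x n i \<omega>)))\<^sup>2) - (\<Sum>k<n. c n k)) / real n" for \<omega>
    by (simp add: dev_def sumW_def mean_def W sum_divide_distrib diff_divide_distrib)
  have "\<delta> \<le> \<bar>dev c n \<omega>\<bar> \<longleftrightarrow> real n * \<delta> \<le> \<bar>(\<Sum>k<n. c n k * (cmod (ip n (e n k) (\<lambda>i. x n i \<omega>)))\<^sup>2) - (\<Sum>k<n. c n k)\<bar>" for \<omega>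
    unfolding dv using n by (simp add: abs_divide le_divide_eq mult.commute)
  hence "M.prob {\<omega>\<in>space M. \<delta> \<le> \<bar>dev c n \<omega>\<bar>} =
     M.prob {\<omega>\<in>space M. real n * \<delta> \<le> \<bar>(\<Sum>k<n. c n k * (cmod (ip n (e n k) (\<lambda>i. x n i \<omega>)))\<^sup>2) - (\<Sum>k<n. c n k)\<bar>}" by simp
  also have "\<dots> \<le> qconst * (\<Sum>k<n. (c n k)\<^sup>2)\<^sup>2 / (real n * \<delta>) ^ 4"
    by (rule weights_concentration[OF M.prob_space_axioms n indep distr_x])
       (use eb[of n] n \<delta> in \<open>auto simp: eigenbasis_def\<close>)
  also have "\<dots> = qconst / \<delta> ^ 4 * ((\<Sum>k<n. (c n k)\<^sup>2) / (real n)\<^sup>2)\<^sup>2"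
    by (simp add: power_divide power_mult_distrib power_mult[symmetric])
  finally show ?thesis .
qed

lemma vanishing_dev:
  assumes c: "(\<lambda>n. (\<Sum>k<n. (c n k)\<^sup>2) / (real n)\<^sup>2) \<longlonglongrightarrow> 0"
  shows "vanishing M (dev c)"
  unfolding vanishing_def
proof (intro conjI allI impI)
  fix \<delta> :: real assume d: "0 < \<delta>"
  show "(\<lambda>n. M.prob {\<omega>\<in>space M. \<delta> \<le> \<bar>dev c n \<omega>\<bar>}) \<longlonglongrightarrow> 0"
  proof (rule tendsto_sandwich[OF _ _ tendsto_const])
    have "(\<lambda>n. qconst / \<delta> ^ 4 * ((\<Sum>k<n. (c n k)\<^sup>2) / (real n)\<^sup>2)\<^sup>2) \<longlonglongrightarrow> qconst / \<delta> ^ 4 * 0\<^sup>2"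
      by (intro tendsto_intros c)
    thus "(\<lambda>n. qconst / \<delta> ^ 4 * ((\<Sum>k<n. (c n k)\<^sup>2) / (real n)\<^sup>2)\<^sup>2) \<longlonglongrightarrow> 0" by simp
    show "\<forall>\<^sub>F n in sequentially. M.prob {\<omega>\<in>space M. \<delta> \<le> \<bar>dev c n \<omega>\<bar>} \<le> qconst / \<delta> ^ 4 * ((\<Sum>k<n. (c n k)\<^sup>2) / (real n)\<^sup>2)\<^sup>2"
      using eventually_gt_at_top[of 0] by eventually_elim (rule dev_concentration[OF _ d])
  qed simp
qed (rule measurable_dev)

lemma bounded_weights:
  assumes B: "\<And>n k. \<bar>c n k\<bar> \<le> B"
  shows "(\<Sum>k<n. (c n k)\<^sup>2) / (real n)\<^sup>2 \<le> B\<^sup>2 / real n"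
proof -
  have "(\<Sum>k<n. (c n k)\<^sup>2) \<le> (\<Sum>k<n. B\<^sup>2)"
  proof (rule sum_mono)
    fix k
    have "\<bar>c n k\<bar>\<^sup>2 \<le> B\<^sup>2" by (rule power_mono[OF B]) simp
    thus "(c n k)\<^sup>2 \<le> B\<^sup>2" by simp
  qed
  hence "(\<Sum>k<n. (c n k)\<^sup>2) / (real n)\<^sup>2 \<le> real n * B\<^sup>2 / (real n)\<^sup>2" by (intro divide_right_mono) auto
  thus ?thesis by (cases "n = 0") (simp_all add: power2_eq_square)
qed

lemma vanishing_dev_bounded:
  assumes B: "\<And>n k. \<bar>c n k\<bar> \<le> B"
  shows "vanishing M (dev c)"
proof (rule vanishing_dev, rule tendsto_sandwich[OF _ _ tendsto_const])
  show "(\<lambda>n. B\<^sup>2 / real n) \<longlonglongrightarrow> 0" by (rule lim_const_over_n)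
  show "\<forall>\<^sub>F n in sequentially. (\<Sum>k<n. (c n k)\<^sup>2) / (real n)\<^sup>2 \<le> B\<^sup>2 / real n"
    using bounded_weights[where c = c and B = B, OF B] by simp
qed (simp add: sum_nonneg)

lemma AE_dev_bounded:
  assumes B: "\<And>n k. \<bar>c n k\<bar> \<le> B"
  shows "AE \<omega> in M. (\<lambda>n. dev c n \<omega>) \<longlonglongrightarrow> 0"
proof (rule M.AE_tendsto_zero_of_summable[OF measurable_dev])
  fix \<delta> :: real assume d: "0 < \<delta>"
  show "summable (\<lambda>n. M.prob {\<omega>\<in>space M. \<delta> \<le> \<bar>dev c n \<omega>\<bar>})"
  proof (rule summable_comparison_test_ev)
    show "summable (\<lambda>n. qconst / \<delta> ^ 4 * B ^ 4 * (inverse (real n))\<^sup>2)"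
      by (intro summable_mult) (use inverse_power_summable[of 2, where 'a = real] in \<open>simp add: power_inverse\<close>)
    show "\<forall>\<^sub>F n in sequentially. norm (M.prob {\<omega>\<in>space M. \<delta> \<le> \<bar>dev c n \<omega>\<bar>}) \<le> qconst / \<delta> ^ 4 * B ^ 4 * (inverse (real n))\<^sup>2"
      using eventually_gt_at_top[of 0]
    proof eventually_elim
      case (elim n)
      have "M.prob {\<omega>\<in>space M. \<delta> \<le> \<bar>dev c n \<omega>\<bar>} \<le> qconst / \<delta> ^ 4 * ((\<Sum>k<n. (c n k)\<^sup>2) / (real n)\<^sup>2)\<^sup>2"
        by (rule dev_concentration[OF elim d])
      also have "\<dots> \<le> qconst / \<delta> ^ 4 * (B\<^sup>2 / real n)\<^sup>2"
        using qconst_pos d bounded_weights[where c = c and B = B and n = n, OF B] by (intro mult_left_mono power_mono) (auto simp: sum_nonneg)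
      also have "(B\<^sup>2 / real n)\<^sup>2 = B ^ 4 * (inverse (real n))\<^sup>2"
        by (simp add: power_mult_distrib divide_inverse)
      finally show ?case by (simp add: mult.assoc)
    qed
  qed
qed

lemma effective_perturbation:
  obtains \<tau> where "rank_one n \<theta> (model_vec orth n (\<lambda>i. x n i \<omega>)) = rank_one n \<tau> (v n \<omega>)"
    "\<tau> \<le> 0" "0 < N n \<omega> \<Longrightarrow> \<tau> < 0 \<and> 1 / \<bar>\<tau>\<bar> = T n \<omega>"
proof
  \<comment> \<open>Normalising v divides v v* by its squared norm, which is N by Parseval. If N =
    0, both the normalised vector and \<tau> are 0 by the convention x / 0 = 0, so the identity and
    \<tau> \<le> 0 persist; only \<tau> < 0 needs N > 0.\<close>
  define \<tau> where "\<tau> = (if orth then \<theta> / N n \<omega> else \<theta>)"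
  have N: "(\<Sum>j<n. (cmod (v n \<omega> j))\<^sup>2) = N n \<omega>"
    by (simp add: eigenbasis_norm[OF eb, of "v n \<omega>"] sumW_def W_def)
  have N0: "0 \<le> N n \<omega>" by (simp add: sumW_def sum_nonneg)
  have sq: "complex_of_real (sqrt (N n \<omega>)) * complex_of_real (sqrt (N n \<omega>)) = complex_of_real (N n \<omega>)"
    using N0 by (simp only: of_real_mult[symmetric] real_sqrt_mult_self abs_of_nonneg)
  have mv: "model_vec orth n (\<lambda>i. x n i \<omega>) =
    (if orth then (\<lambda>i. v n \<omega> i / complex_of_real (sqrt (N n \<omega>))) else v n \<omega>)"
    unfolding model_vec_def Let_def v_def[symmetric] N by (auto simp: v_def[abs_def])
  show "rank_one n \<theta> (model_vec orth n (\<lambda>i. x n i \<omega>)) = rank_one n \<tau> (v n \<omega>)"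
  proof (rule eq_matI)
    fix i j assume "i < dim_row (rank_one n \<tau> (v n \<omega>))" "j < dim_col (rank_one n \<tau> (v n \<omega>))"
    hence ij: "i < n" "j < n" by (auto simp: rank_one_def)
    have "complex_of_real \<theta> * (v n \<omega> i / complex_of_real (sqrt (N n \<omega>))) * cnj (v n \<omega> j / complex_of_real (sqrt (N n \<omega>))) =
      complex_of_real \<theta> * v n \<omega> i * cnj (v n \<omega> j) / (complex_of_real (sqrt (N n \<omega>)) * complex_of_real (sqrt (N n \<omega>)))"
      by simp
    also have "\<dots> = complex_of_real (\<theta> / N n \<omega>) * v n \<omega> i * cnj (v n \<omega> j)"
      unfolding sq by simp
    finally show "rank_one n \<theta> (model_vec orth n (\<lambda>i. x n i \<omega>)) $$ (i, j) = rank_one n \<tau> (v n \<omega>) $$ (i, j)"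
      using ij unfolding mv by (simp add: rank_one_def \<tau>_def del: of_real_divide complex_cnj_divide)
  qed (auto simp: rank_one_def)
  show "\<tau> \<le> 0" using theta_neg N0 by (simp add: \<tau>_def divide_nonpos_nonneg)
  assume "0 < N n \<omega>"
  thus "\<tau> < 0 \<and> 1 / \<bar>\<tau>\<bar> = T n \<omega>" using theta_neg by (auto simp: \<tau>_def T_def divide_neg_pos)
qed

lemma lb_le: "i < n \<Longrightarrow> lb n \<omega> i \<le> la n i"
  unfolding lb_def la_def using effective_perturbation[of n \<omega>] rank_one_eig_le[OF herm eb] by metis

lemma lb_ge: "Suc i < n \<Longrightarrow> la n i \<le> lb n \<omega> (Suc i)"
  unfolding lb_def la_def using effective_perturbation[of n \<omega>] rank_one_eig_ge[OF herm eb] by metis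

lemma lb_lower:
  assumes "0 < N n \<omega>" "i < n" "z < la n i" "(\<Sum>k=i..<n. W n \<omega> k / (la n k - z)) \<le> T n \<omega>"
  shows "z \<le> lb n \<omega> i"
proof -
  obtain \<tau> where t: "rank_one n \<theta> (model_vec orth n (\<lambda>i. x n i \<omega>)) = rank_one n \<tau> (v n \<omega>)"
    "\<tau> \<le> 0" "\<tau> < 0" "1 / \<bar>\<tau>\<bar> = T n \<omega>" using effective_perturbation[of n \<omega>] assms(1) by metis
  have "\<bar>\<tau>\<bar> * (\<Sum>k=i..<n. W n \<omega> k / (la n k - z)) \<le> \<bar>\<tau>\<bar> * (1 / \<bar>\<tau>\<bar>)"
    using assms(4) unfolding t(4) by (rule mult_left_mono) simp
  thus ?thesis unfolding lb_def t(1)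
    using t(3) assms by (intro rank_one_eig_ge_of_resolvent[OF herm eb t(2)]) (auto simp: la_def W_def)
qed

lemma lb_upper:
  assumes "0 < N n \<omega>" "i < n" "z < la n i" "\<And>k. k < i \<Longrightarrow> la n k < z"
    "T n \<omega> + (\<Sum>k<i. W n \<omega> k / (z - la n k)) \<le> (\<Sum>k=i..<n. W n \<omega> k / (la n k - z))"
  shows "lb n \<omega> i \<le> z"
proof -
  obtain \<tau> where t: "rank_one n \<theta> (model_vec orth n (\<lambda>i. x n i \<omega>)) = rank_one n \<tau> (v n \<omega>)"
    "\<tau> \<le> 0" "\<tau> < 0" "1 / \<bar>\<tau>\<bar> = T n \<omega>" using effective_perturbation[of n \<omega>] assms(1) by metis
  show ?thesis unfolding lb_def t(1)
    using t(3,4) assms by (intro rank_one_eig_le_of_resolvent[OF herm eb t(2)]) (auto simp: la_def W_def)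
qed

lemma T_bounds:
  assumes "0 < n" "\<bar>dev (\<lambda>_ _. 1) n \<omega>\<bar> < \<delta>" "0 < \<delta>" "\<delta> \<le> 1"
  shows "0 < N n \<omega>" "(1 - \<delta>) / \<bar>\<theta>\<bar> \<le> T n \<omega>" "T n \<omega> \<le> (1 + \<delta>) / \<bar>\<theta>\<bar>"
proof -
  have "\<bar>N n \<omega> - 1\<bar> < \<delta>" using assms by (simp add: dev_def mean_def)
  thus "0 < N n \<omega>" "(1 - \<delta>) / \<bar>\<theta>\<bar> \<le> T n \<omega>" "T n \<omega> \<le> (1 + \<delta>) / \<bar>\<theta>\<bar>"
    unfolding T_def using assms by (auto intro!: divide_right_mono)
qed

text \<open>At distance \<epsilon> n^(\<alpha>' - 1) a resolvent term is at most n^(1 - \<alpha>') /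
  \<epsilon> times its weight. \<open>sumW (few Q \<alpha>')\<close> is \<epsilon> times the
  resulting bound for the indices in \<open>Q n\<close>.\<close>

definition few :: "(nat \<Rightarrow> nat set) \<Rightarrow> real \<Rightarrow> nat \<Rightarrow> nat \<Rightarrow> real" where
  "few Q \<alpha>' n k = (if k \<in> Q n then real n powr (1 - \<alpha>') else 0)"

text \<open>With q indices in \<open>Q n\<close>, the mean is q n^(-\<alpha>') and the quantity
  governing the deviation is q n^(-2 \<alpha>'); both tend to 0.\<close>

lemma vanishing_few:
  assumes q: "(\<lambda>n. real (card (Q n \<inter> {..<n})) * real n powr (- \<alpha>')) \<longlonglongrightarrow> 0" and a: "0 < \<alpha>'"
  shows "vanishing M (sumW (few Q \<alpha>'))"
proof -
  let ?q = "\<lambda>n. real (card (Q n \<inter> {..<n}))"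
  have s: "(\<Sum>k<n. h (few Q \<alpha>' n k)) = ?q n * h (real n powr (1 - \<alpha>'))" if "h 0 = 0" for n and h :: "real \<Rightarrow> real"
  proof -
    have "(\<Sum>k<n. h (few Q \<alpha>' n k)) = (\<Sum>k\<in>Q n \<inter> {..<n}. h (real n powr (1 - \<alpha>')))"
      using that by (intro sum.mono_neutral_cong_right) (auto simp: few_def)
    thus ?thesis by simp
  qed
  have m: "mean (few Q \<alpha>') \<longlonglongrightarrow> 0"
  proof (rule Lim_transform_eventually[OF q])
    show "\<forall>\<^sub>F n in sequentially. ?q n * real n powr (- \<alpha>') = mean (few Q \<alpha>') n"
      using eventually_gt_at_top[of 0]
      by eventually_elim (simp add: mean_def s[of "\<lambda>t. t"] powr_diff powr_minus divide_inverse)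
  qed
  have "vanishing M (dev (few Q \<alpha>'))"
  proof (rule vanishing_dev)
    have "(\<lambda>n. (?q n * real n powr (- \<alpha>')) * real n powr (- \<alpha>')) \<longlonglongrightarrow> 0 * 0"
      by (intro tendsto_mult q tendsto_neg_powr filterlim_real_sequentially) (use a in auto)
    hence "(\<lambda>n. (?q n * real n powr (- \<alpha>')) * real n powr (- \<alpha>')) \<longlonglongrightarrow> 0" by simp
    thus "(\<lambda>n. (\<Sum>k<n. (few Q \<alpha>' n k)\<^sup>2) / (real n)\<^sup>2) \<longlonglongrightarrow> 0"
    proof (rule Lim_transform_eventually)
      show "\<forall>\<^sub>F n in sequentially. (?q n * real n powr (- \<alpha>')) * real n powr (- \<alpha>') = (\<Sum>k<n. (few Q \<alpha>' n k)\<^sup>2) / (real n)\<^sup>2"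
        unfolding s[of "\<lambda>t. t\<^sup>2", OF zero_power2] using eventually_gt_at_top[of 0]
        by eventually_elim (simp add: powr_diff powr_minus power2_eq_square field_simps)
    qed
  qed
  from M.vanishing_add_null_sequence[OF this m] show ?thesis by (simp add: dev_def)
qed

lemma card_mult_powr_tendsto_zero:
  assumes "\<And>n. card (Q n \<inter> {..<n}) \<le> q" "0 < \<alpha>'"
  shows "(\<lambda>n. real (card (Q n \<inter> {..<n})) * real n powr (- \<alpha>')) \<longlonglongrightarrow> 0"
proof (rule tendsto_sandwich[OF _ _ tendsto_const])
  have "(\<lambda>n. real q * real n powr (- \<alpha>')) \<longlonglongrightarrow> real q * 0"
    by (intro tendsto_mult tendsto_const tendsto_neg_powr filterlim_real_sequentially) (use assms in auto)
  thus "(\<lambda>n. real q * real n powr (- \<alpha>')) \<longlonglongrightarrow> 0" by simp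
  show "\<forall>\<^sub>F n in sequentially. real (card (Q n \<inter> {..<n})) * real n powr (- \<alpha>') \<le> real q * real n powr (- \<alpha>')"
    by (intro always_eventually allI mult_right_mono) (use assms in auto)
qed auto

text \<open>The index set \<open>Q n\<close> collects the few eigenvalues that may be close to \<open>la n (j n)\<close>; the contribution of
  the others to the resolvent is controlled by \<open>c\<close>, whose mean stays below \<open>1 / \<bar>\<theta>\<bar>\<close>.\<close>

lemma sticking_from_below:
  fixes j :: "nat \<Rightarrow> nat"
  assumes q: "(\<lambda>n. real (card (Q n \<inter> {..<n})) * real n powr (- \<alpha>')) \<longlonglongrightarrow> 0" and a': "0 < \<alpha>'"
    and c: "(\<lambda>n. (\<Sum>k<n. (c n k)\<^sup>2) / (real n)\<^sup>2) \<longlonglongrightarrow> 0"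
    and m0: "\<forall>\<^sub>F n in sequentially. mean c n \<le> \<beta>" "\<beta> < 1 / \<bar>\<theta>\<bar>"
    and far: "\<forall>\<^sub>F n in sequentially. j n < n \<and>
      (\<forall>k<n. 0 \<le> c n k \<and> (j n \<le> k \<longrightarrow> k \<notin> Q n \<longrightarrow> la n (j n) < la n k \<and> 1 / (la n k - la n (j n)) \<le> c n k))"
  shows "outer_vanishing M (\<lambda>n \<omega>. real n powr (1 - \<alpha>') * (lb n \<omega> (j n) - la n (j n)))"
proof (rule M.outer_vanishingI[where F = "{dev c, dev (\<lambda>_ _. 1), sumW (few Q \<alpha>')}"])
  show "vanishing M Y" if "Y \<in> {dev c, dev (\<lambda>_ _. 1), sumW (few Q \<alpha>')}" for Y
    using that vanishing_dev[OF c] vanishing_few[OF q a'] vanishing_dev_bounded[of "\<lambda>_ _. 1" 1] by auto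
  fix \<epsilon> :: real assume eps: "0 < \<epsilon>"
  \<comment> \<open>The gap between \<beta> and 1/|\<theta>| pays for three errors of at most a
    quarter each: the near terms (\<delta>/\<epsilon>), the deviation of the far terms (\<delta>)
    and that of T (\<delta>/|\<theta>|).\<close>
  define \<gamma> where "\<gamma> = 1 / \<bar>\<theta>\<bar> - \<beta>"
  have g: "0 < \<gamma>" using m0(2) by (simp add: \<gamma>_def)
  define \<delta> where "\<delta> = min (\<gamma> * \<epsilon> / 4) (min (\<gamma> / 4) (min (\<gamma> * \<bar>\<theta>\<bar> / 4) 1))"
  have d: "0 < \<delta>" "\<delta> \<le> 1" "\<delta> / \<epsilon> \<le> \<gamma> / 4" "\<delta> \<le> \<gamma> / 4" "\<delta> / \<bar>\<theta>\<bar> \<le> \<gamma> / 4"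
  proof -
    show "0 < \<delta>" "\<delta> \<le> 1" using g eps theta_neg by (auto simp: \<delta>_def mult_pos_neg)
    have "\<delta> \<le> \<gamma> * \<epsilon> / 4" "\<delta> \<le> \<gamma> / 4" "\<delta> \<le> \<gamma> * \<bar>\<theta>\<bar> / 4" unfolding \<delta>_def by linarith+
    thus "\<delta> / \<epsilon> \<le> \<gamma> / 4" "\<delta> \<le> \<gamma> / 4" "\<delta> / \<bar>\<theta>\<bar> \<le> \<gamma> / 4"
      using eps theta_neg by (auto simp: field_simps)
  qed
  show "\<exists>\<delta>>0. \<forall>\<^sub>F n in sequentially. \<forall>\<omega>\<in>space M.
     (\<forall>Y\<in>{dev c, dev (\<lambda>_ _. 1), sumW (few Q \<alpha>')}. \<bar>Y n \<omega>\<bar> < \<delta>) \<longrightarrow>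
       \<bar>real n powr (1 - \<alpha>') * (lb n \<omega> (j n) - la n (j n))\<bar> \<le> \<epsilon>" (is "\<exists>\<delta>>0. ?E \<delta>")
  proof (intro exI[of _ \<delta>] conjI d(1))
    show "?E \<delta>"
      using m0(1) far eventually_gt_at_top[of 0]
    proof eventually_elim
      case (elim n)
      show ?case
      proof (intro ballI impI)
        fix \<omega> assume "\<omega> \<in> space M" and small: "\<forall>Y\<in>{dev c, dev (\<lambda>_ _. 1), sumW (few Q \<alpha>')}. \<bar>Y n \<omega>\<bar> < \<delta>"
        hence s1: "\<bar>dev c n \<omega>\<bar> < \<delta>" and s2: "\<bar>dev (\<lambda>_ _. 1) n \<omega>\<bar> < \<delta>" and s3: "\<bar>sumW (few Q \<alpha>') n \<omega>\<bar> < \<delta>" by auto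
        note Tb = T_bounds[OF elim(3) s2 d(1,2)]
        define P where "P = real n powr (1 - \<alpha>')"
        have P: "0 < P" using elim(3) by (simp add: P_def)
        define z where "z = la n (j n) - \<epsilon> / P"
        have zl: "z < la n (j n)" using eps P by (simp add: z_def)
        have jn: "j n < n" using elim(2) by simp
        have "(\<Sum>k=j n..<n. W n \<omega> k / (la n k - z)) \<le> (\<Sum>k=j n..<n. few Q \<alpha>' n k * W n \<omega> k / \<epsilon> + c n k * W n \<omega> k)"
        proof (rule sum_mono)
          fix k assume k: "k \<in> {j n..<n}"
          have lak: "la n (j n) \<le> la n k" using la_mono[of "j n" k n] k by simp
          show "W n \<omega> k / (la n k - z) \<le> few Q \<alpha>' n k * W n \<omega> k / \<epsilon> + c n k * W n \<omega> k"
          proof (cases "k \<in> Q n")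
            case True
            have "\<epsilon> / P \<le> la n k - z" using lak by (simp add: z_def)
            hence "W n \<omega> k / (la n k - z) \<le> W n \<omega> k / (\<epsilon> / P)"
              using eps P lak zl by (intro divide_left_mono mult_pos_pos) auto
            also have "\<dots> = few Q \<alpha>' n k * W n \<omega> k / \<epsilon>" using True by (simp add: few_def P_def)
            finally show ?thesis using elim(2) k by (simp add: add_increasing2)
          next
            case False
            hence fk: "la n (j n) < la n k" "1 / (la n k - la n (j n)) \<le> c n k" using elim(2) k by auto
            \<comment> \<open>For far indices the shift from \<open>la n (j n)\<close> down to z
              only decreases the term, so coefficients independent of \<epsilon> suffice.\<close>
            have "W n \<omega> k / (la n k - z) \<le> W n \<omega> k / (la n k - la n (j n))"
              using fk(1) zl by (intro divide_left_mono mult_pos_pos) auto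
            also have "\<dots> \<le> c n k * W n \<omega> k" using mult_right_mono[OF fk(2) W_nonneg[of n \<omega> k]] by simp
            finally show ?thesis using False by (simp add: few_def)
          qed
        qed
        also have "\<dots> \<le> (\<Sum>k<n. few Q \<alpha>' n k * W n \<omega> k / \<epsilon> + c n k * W n \<omega> k)"
          by (rule sum_mono2) (use elim(2) eps in \<open>auto simp: few_def intro!: add_nonneg_nonneg\<close>)
        also have "\<dots> = sumW (few Q \<alpha>') n \<omega> / \<epsilon> + sumW c n \<omega>"
          by (simp add: sum.distrib sumW_def sum_divide_distrib)
        also have "\<dots> \<le> \<delta> / \<epsilon> + (\<beta> + \<delta>)"
        proof (rule add_mono)
          show "sumW (few Q \<alpha>') n \<omega> / \<epsilon> \<le> \<delta> / \<epsilon>" using s3 eps by (intro divide_right_mono) auto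
          show "sumW c n \<omega> \<le> \<beta> + \<delta>" using s1 elim(1) by (simp add: dev_def)
        qed
        also have "\<dots> \<le> 1 / \<bar>\<theta>\<bar> - \<delta> / \<bar>\<theta>\<bar>" using d g \<gamma>_def by linarith
        also have "\<dots> \<le> T n \<omega>" using Tb(2) by (simp add: diff_divide_distrib)
        finally have "z \<le> lb n \<omega> (j n)" by (rule lb_lower[OF Tb(1) jn zl])
        hence "la n (j n) - lb n \<omega> (j n) \<le> \<epsilon> / P" by (simp add: z_def)
        hence "P * (la n (j n) - lb n \<omega> (j n)) \<le> \<epsilon>" using P by (simp add: field_simps)
        moreover have "lb n \<omega> (j n) \<le> la n (j n)" by (rule lb_le[OF jn])
        ultimately show "\<bar>real n powr (1 - \<alpha>') * (lb n \<omega> (j n) - la n (j n))\<bar> \<le> \<epsilon>"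
          using P unfolding P_def[symmetric] abs_mult by simp
      qed
    qed
  qed
qed simp

end

section \<open>Limits of the perturbed eigenvalues\<close>

locale rank_one_limit = rank_one_model \<nu> M X e x orth \<theta>
  for \<nu> and M :: "'s measure" and X e x orth \<theta> +
  fixes \<mu>X :: "real measure" and a b :: real
  assumes muX: "prob_space \<mu>X" "sets \<mu>X = sets borel"
    and weak: "\<And>f :: real \<Rightarrow> real. continuous_on UNIV f \<Longrightarrow> bounded (range f) \<Longrightarrow>
      (\<lambda>n. (\<Sum>k<n. f (la n k)) / real n) \<longlonglongrightarrow> (\<integral>t. f t \<partial>\<mu>X)"
    and la_bot: "(\<lambda>n. la n 0) \<longlonglongrightarrow> a"
    and la_top: "(\<lambda>n. la n (n - 1)) \<longlonglongrightarrow> b"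
begin

lemma AE_zero_of_eventually_zero:
  fixes f :: "real \<Rightarrow> real"
  assumes f: "continuous_on UNIV f" "\<And>t. 0 \<le> f t" "\<And>t. f t \<le> 1"
    and z: "\<forall>\<^sub>F n in sequentially. \<forall>k<n. f (la n k) = 0"
  shows "AE t in \<mu>X. f t = 0"
proof -
  interpret mu: prob_space \<mu>X by (rule muX)
  have bd: "\<bar>f t\<bar> \<le> 1" for t using f(2,3)[of t] by simp
  have "(\<lambda>n. (\<Sum>k<n. f (la n k)) / real n) \<longlonglongrightarrow> (\<integral>t. f t \<partial>\<mu>X)"
    by (rule weak[OF f(1)]) (use bd in \<open>auto intro!: boundedI[where B = 1]\<close>)
  moreover have "(\<lambda>n. (\<Sum>k<n. f (la n k)) / real n) \<longlonglongrightarrow> 0"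
    by (rule tendsto_eventually) (use z in \<open>eventually_elim, simp\<close>)
  ultimately have i0: "(\<integral>t. f t \<partial>\<mu>X) = 0" by (rule LIMSEQ_unique)
  have fm: "f \<in> borel_measurable \<mu>X"
    using borel_measurable_continuous_onI[OF f(1)] by (simp add: measurable_cong_sets[OF muX(2) refl])
  have "integrable \<mu>X f" by (rule mu.integrable_const_bound[where B = 1]) (use bd fm in auto)
  thus ?thesis using i0 f(2) integral_nonneg_eq_0_iff_AE[of \<mu>X f] by simp
qed

text \<open>Weak convergence is tested with the excess of g over 1/(m+1), cut off to [0, 1]: this
  continuous function eventually vanishes at all eigenvalues, so its integral is 0. Letting m vary
  covers the whole set where g > 0.\<close>

lemma AE_nonpos_of_eventually_le:
  fixes g :: "real \<Rightarrow> real"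
  assumes g: "continuous_on UNIV g"
    and ev: "\<And>d. 0 < d \<Longrightarrow> \<forall>\<^sub>F n in sequentially. \<forall>k<n. g (la n k) \<le> d"
  shows "AE t in \<mu>X. g t \<le> 0"
proof -
  have "AE t in \<mu>X. min 1 (max 0 (g t - 1 / real (Suc m))) = 0" for m
  proof (rule AE_zero_of_eventually_zero)
    have "0 < 1 / real (Suc m)" by simp
    from ev[OF this] show "\<forall>\<^sub>F n in sequentially. \<forall>k<n. min 1 (max 0 (g (la n k) - 1 / real (Suc m))) = 0"
      by eventually_elim auto
  qed (auto intro!: continuous_intros g)
  hence "AE t in \<mu>X. \<forall>m. min 1 (max 0 (g t - 1 / real (Suc m))) = 0" by (simp add: AE_all_countable)
  thus ?thesis
  proof eventually_elim
    case (elim t)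
    show ?case
    proof (rule ccontr)
      assume "\<not> g t \<le> 0"
      then obtain m where "1 / real (Suc m) < g t" using nat_approx_posE[of "g t"] by auto
      with elim[rule_format, of m] show False by (auto simp: min_def max_def split: if_splits)
    qed
  qed
qed

lemma AE_above: "AE t in \<mu>X. a \<le> t"
proof -
  have "AE t in \<mu>X. a - t \<le> 0"
  proof (rule AE_nonpos_of_eventually_le)
    fix d :: real assume "0 < d"
    with order_tendstoD(1)[OF la_bot, of "a - d"] have "\<forall>\<^sub>F n in sequentially. a - d < la n 0" by simp
    thus "\<forall>\<^sub>F n in sequentially. \<forall>k<n. a - la n k \<le> d"
    proof eventually_elim
      case (elim n)
      show ?case
      proof (intro allI impI)
        fix k assume "k < n"
        hence "la n 0 \<le> la n k" by (intro la_mono) auto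
        thus "a - la n k \<le> d" using elim by simp
      qed
    qed
  qed (intro continuous_intros)
  thus ?thesis by simp
qed

lemma AE_below: "AE t in \<mu>X. t \<le> b"
proof -
  have "AE t in \<mu>X. t - b \<le> 0"
  proof (rule AE_nonpos_of_eventually_le)
    fix d :: real assume "0 < d"
    with order_tendstoD(2)[OF la_top, of "b + d"] have "\<forall>\<^sub>F n in sequentially. la n (n - 1) < b + d" by simp
    thus "\<forall>\<^sub>F n in sequentially. \<forall>k<n. la n k - b \<le> d"
    proof eventually_elim
      case (elim n)
      show ?case
      proof (intro allI impI)
        fix k assume "k < n"
        hence "la n k \<le> la n (n - 1)" by (intro la_mono) auto
        thus "la n k - b \<le> d" using elim by simp
      qed
    qed
  qed (intro continuous_intros)
  thus ?thesis by simp
qed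

text \<open>The resolvent kernel at \<open>z < a\<close>, truncated below the spectrum so that it is bounded and continuous.\<close>

definition hker :: "real \<Rightarrow> real \<Rightarrow> real" where
  "hker z t = 1 / (max t ((z + a) / 2) - z)"

abbreviation hres :: "real \<Rightarrow> nat \<Rightarrow> nat \<Rightarrow> real" where
  "hres z \<equiv> \<lambda>n k. hker z (la n k)"

lemma hker_bounds:
  assumes "z < a"
  shows "0 < hker z t" "hker z t \<le> 2 / (a - z)" "\<bar>hker z t\<bar> \<le> 2 / (a - z)"
proof -
  have p: "0 < (a - z) / 2" "(a - z) / 2 \<le> max t ((z + a) / 2) - z" using assms by (auto simp: field_simps)
  show "0 < hker z t" unfolding hker_def using p by simp
  moreover have "hker z t \<le> 1 / ((a - z) / 2)" unfolding hker_def
    using p by (intro divide_left_mono mult_pos_pos) auto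
  ultimately show "hker z t \<le> 2 / (a - z)" "\<bar>hker z t\<bar> \<le> 2 / (a - z)" by simp_all
qed

lemma mean_hres:
  assumes "z < a"
  shows "mean (hres z) \<longlonglongrightarrow> - stieltjes \<mu>X z"
proof -
  have ne: "max t ((z + a) / 2) - z \<noteq> 0" for t using assms by (auto simp: max_def field_simps)
  have "(\<lambda>n. (\<Sum>k<n. hker z (la n k)) / real n) \<longlonglongrightarrow> (\<integral>t. hker z t \<partial>\<mu>X)"
  proof (rule weak)
    show "continuous_on UNIV (hker z)" unfolding hker_def by (intro continuous_intros) (use ne in auto)
    show "bounded (range (hker z))" by (rule boundedI) (use hker_bounds(3)[OF assms] in auto)
  qed
  also have "(\<integral>t. hker z t \<partial>\<mu>X) = (\<integral>t. 1 / (t - z) \<partial>\<mu>X)"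
  proof (rule integral_cong_AE)
    have "hker z \<in> borel_measurable borel" unfolding hker_def by measurable
    thus "hker z \<in> borel_measurable \<mu>X" by (simp add: measurable_cong_sets[OF muX(2) refl])
    show "(\<lambda>t. 1 / (t - z)) \<in> borel_measurable \<mu>X" by (simp add: measurable_cong_sets[OF muX(2) refl])
    show "AE t in \<mu>X. hker z t = 1 / (t - z)"
      using AE_above
    proof eventually_elim
      case (elim t)
      hence "max t ((z + a) / 2) = t" using assms by (simp add: max_def field_simps)
      thus ?case by (simp add: hker_def)
    qed
  qed
  finally show ?thesis unfolding mean_def by (simp add: stieltjes_minus[OF muX AE_above])
qed

lemma eventually_hres:
  assumes "z < a"
  shows "\<forall>\<^sub>F n in sequentially. \<forall>k<n. z < la n k \<and> hres z n k = 1 / (la n k - z)"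
proof -
  \<comment> \<open>The truncation level of \<open>hker\<close> lies strictly below a, so the
    smallest eigenvalue eventually exceeds it and the truncation is inactive on the whole
    spectrum.\<close>
  have "(z + a) / 2 < a" "z < (z + a) / 2" using assms by simp_all
  from order_tendstoD(1)[OF la_bot this(1)] show ?thesis
  proof eventually_elim
    case (elim n)
    show ?case
    proof (intro allI impI)
      fix k assume "k < n"
      hence "la n 0 \<le> la n k" by (intro la_mono) auto
      with elim have "(z + a) / 2 < la n k" by simp
      thus "z < la n k \<and> hres z n k = 1 / (la n k - z)" using \<open>z < (z + a) / 2\<close> by (simp add: hker_def max_def)
    qed
  qed
qed

lemma AE_sumW_hres:
  assumes "z < a"
  shows "AE \<omega> in M. (\<lambda>n. sumW (hres z) n \<omega>) \<longlonglongrightarrow> - stieltjes \<mu>X z"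
proof -
  have "AE \<omega> in M. (\<lambda>n. dev (hres z) n \<omega>) \<longlonglongrightarrow> 0"
    by (rule AE_dev_bounded) (rule hker_bounds(3)[OF assms])
  thus ?thesis
  proof eventually_elim
    case (elim \<omega>)
    from tendsto_add[OF this mean_hres[OF assms]] show ?case by (simp add: dev_def)
  qed
qed

lemma AE_T:
  "AE \<omega> in M. (\<lambda>n. T n \<omega>) \<longlonglongrightarrow> 1 / \<bar>\<theta>\<bar> \<and> (\<forall>\<^sub>F n in sequentially. 0 < N n \<omega>)"
proof -
  have "AE \<omega> in M. (\<lambda>n. dev (\<lambda>_ _. 1) n \<omega>) \<longlonglongrightarrow> 0"
    by (rule AE_dev_bounded[where B = 1]) simp
  thus ?thesis
  proof eventually_elim
    case (elim \<omega>)
    have "(\<lambda>n. dev (\<lambda>_ _. 1) n \<omega> + 1) \<longlonglongrightarrow> 0 + 1" by (intro tendsto_add elim tendsto_const)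
    hence N: "(\<lambda>n. N n \<omega>) \<longlonglongrightarrow> 0 + 1"
    proof (rule Lim_transform_eventually)
      show "\<forall>\<^sub>F n in sequentially. dev (\<lambda>_ _. 1) n \<omega> + 1 = N n \<omega>"
        using eventually_gt_at_top[of 0] by eventually_elim (simp add: dev_def mean_def)
    qed
    have "(\<lambda>n. if orth then N n \<omega> else 1) \<longlonglongrightarrow> 1" using N by (cases orth) simp_all
    from tendsto_divide[OF this tendsto_const, of "\<bar>\<theta>\<bar>"]
    have "(\<lambda>n. T n \<omega>) \<longlonglongrightarrow> 1 / \<bar>\<theta>\<bar>" using theta_neg by (simp add: T_def)
    thus ?case using order_tendstoD(1)[OF N, of 0] by simp
  qed
qed

text \<open>G is strictly decreasing below a, so the limit -G(z) of the resolvent sum lies below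
  1/|\<theta>| for z < r and above it for r < z < a. An intermediate y separates the sum from T at
  large n, and the two resolvent criteria apply at index 0, where no eigenvalue lies below.\<close>

lemma AE_smallest_eigenvalue:
  assumes r: "r < a" "stieltjes \<mu>X r = 1 / \<theta>"
  shows "AE \<omega> in M. (\<lambda>n. lb n \<omega> 0) \<longlonglongrightarrow> r"
proof -
  have gr: "- stieltjes \<mu>X r = 1 / \<bar>\<theta>\<bar>" using r theta_neg by simp
  have sum0: "(\<Sum>k=0..<n. W n \<omega> k / (la n k - z)) = sumW (hres z) n \<omega>"
    if "\<forall>k<n. z < la n k \<and> hres z n k = 1 / (la n k - z)" for n \<omega> z
    unfolding sumW_def lessThan_atLeast0 using that by (intro sum.cong) auto
  have lower: "AE \<omega> in M. \<forall>\<^sub>F n in sequentially. z \<le> lb n \<omega> 0" if z: "z < r" for z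
    using AE_sumW_hres[OF less_trans[OF z r(1)]] AE_T
  proof eventually_elim
    case (elim \<omega>)
    have "- stieltjes \<mu>X z < 1 / \<bar>\<theta>\<bar>"
      using stieltjes_strict_antimono[OF muX AE_above z r(1)] gr by simp
    then obtain y where y: "- stieltjes \<mu>X z < y" "y < 1 / \<bar>\<theta>\<bar>" using dense by blast
    have "\<forall>\<^sub>F n in sequentially. sumW (hres z) n \<omega> < y" by (rule order_tendstoD(2)[OF elim(1) y(1)])
    moreover have "\<forall>\<^sub>F n in sequentially. y < T n \<omega>" by (rule order_tendstoD(1)[OF conjunct1[OF elim(2)] y(2)])
    ultimately show ?case
      using conjunct2[OF elim(2)] eventually_hres[OF less_trans[OF z r(1)]] eventually_gt_at_top[of 0]
    proof eventually_elim
      case (elim n)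
      show ?case by (rule lb_lower) (use elim sum0[OF elim(4)] in auto)
    qed
  qed
  have upper: "AE \<omega> in M. \<forall>\<^sub>F n in sequentially. lb n \<omega> 0 \<le> z" if z: "r < z" "z < a" for z
    using AE_sumW_hres[OF z(2)] AE_T
  proof eventually_elim
    case (elim \<omega>)
    have "1 / \<bar>\<theta>\<bar> < - stieltjes \<mu>X z"
      using stieltjes_strict_antimono[OF muX AE_above z] gr by simp
    then obtain y where y: "1 / \<bar>\<theta>\<bar> < y" "y < - stieltjes \<mu>X z" using dense by blast
    have "\<forall>\<^sub>F n in sequentially. y < sumW (hres z) n \<omega>" by (rule order_tendstoD(1)[OF elim(1) y(2)])
    moreover have "\<forall>\<^sub>F n in sequentially. T n \<omega> < y" by (rule order_tendstoD(2)[OF conjunct1[OF elim(2)] y(1)])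
    ultimately show ?case
      using conjunct2[OF elim(2)] eventually_hres[OF z(2)] eventually_gt_at_top[of 0]
    proof eventually_elim
      case (elim n)
      show ?case by (rule lb_upper) (use elim sum0[OF elim(4)] in auto)
    qed
  qed
  \<comment> \<open>The preceding bounds hold almost surely for one z at a time, so r is approached
    along two sequences. The denominator m + 2 keeps \<open>zu\<close> below a from m = 0
    on.\<close>
  define zl where "zl m = r - 1 / real (Suc m)" for m
  define zu where "zu m = r + (a - r) / real (Suc (Suc m))" for m
  have zl: "zl m < r" for m by (simp add: zl_def)
  have zu: "r < zu m" "zu m < a" for m
  proof -
    have "(a - r) / real (Suc (Suc m)) < (a - r) / 1" using r(1) by (intro divide_strict_left_mono) auto
    thus "r < zu m" "zu m < a" using r(1) by (auto simp: zu_def)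
  qed
  have "zl \<longlonglongrightarrow> r - 0" unfolding zl_def
    by (intro tendsto_diff tendsto_const) (use LIMSEQ_inverse_real_of_nat in \<open>simp add: inverse_eq_divide\<close>)
  hence zl_lim: "zl \<longlonglongrightarrow> r" by simp
  have "(\<lambda>m. (a - r) / real (Suc (Suc m))) \<longlonglongrightarrow> 0"
    using LIMSEQ_Suc[OF LIMSEQ_Suc[OF lim_const_over_n[of "a - r"]]] by simp
  from tendsto_add[OF tendsto_const[of r] this] have zu_lim: "zu \<longlonglongrightarrow> r" by (simp add: zu_def[abs_def])
  have "AE \<omega> in M. \<forall>m. \<forall>\<^sub>F n in sequentially. zl m \<le> lb n \<omega> 0"
    unfolding AE_all_countable using lower[OF zl] by simp
  moreover have "AE \<omega> in M. \<forall>m. \<forall>\<^sub>F n in sequentially. lb n \<omega> 0 \<le> zu m"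
    unfolding AE_all_countable using upper[OF zu] by simp
  ultimately show ?thesis
  proof eventually_elim
    case (elim \<omega>)
    show ?case
    proof (rule order_tendstoI)
      fix y assume "y < r"
      then obtain m where "y < zl m" using order_tendstoD(1)[OF zl_lim] eventually_happens by fastforce
      thus "\<forall>\<^sub>F n in sequentially. y < lb n \<omega> 0"
        using elim(1)[rule_format, of m] by (auto elim!: eventually_mono)
    next
      fix y assume "r < y"
      then obtain m where "zu m < y" using order_tendstoD(2)[OF zu_lim] eventually_happens by fastforce
      thus "\<forall>\<^sub>F n in sequentially. lb n \<omega> 0 < y"
        using elim(2)[rule_format, of m] by (auto elim!: eventually_mono)
    qed
  qed
qed

text \<open>Beyond \<open>la n (i - 1)\<close> the terms with k \<ge> i are at least those at the
  fixed point z0, since each increases in z up to its pole. Their sum is close to -G(z0) >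
  1/|\<theta>|, while the terms k < i are negligible already at distance of order n^(\<alpha>' - 1).
  So the i-th perturbed eigenvalue cannot lie much higher.\<close>

lemma sticking_from_above:
  assumes z0: "z0 < a" "stieltjes \<mu>X z0 < 1 / \<theta>" and i: "1 \<le> i" and a'0: "0 < \<alpha>'"
  shows "outer_vanishing M (\<lambda>n \<omega>. real n powr (1 - \<alpha>') * (lb n \<omega> i - la n (i - 1)))"
proof -
  \<comment> \<open>Replacing \<alpha>' by its minimum with 1 makes the scale n^(1 - \<beta>) at
    least 1. Then smallness of \<open>sumW few0\<close> also bounds the unscaled weights of the
    first i indices, which have to be removed from the sum at z0. The smaller exponent gives the
    stronger claim.\<close>
  define \<beta> where "\<beta> = min \<alpha>' 1"
  have b: "0 < \<beta>" "\<beta> \<le> 1" "\<beta> \<le> \<alpha>'" using a'0 by (auto simp: \<beta>_def)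
  define few0 where "few0 = few (\<lambda>_. {..<i}) \<beta>"
  have "outer_vanishing M (\<lambda>n \<omega>. real n powr (1 - \<beta>) * (lb n \<omega> i - la n (i - 1)))"
  proof (rule M.outer_vanishingI[where F = "{dev (hres z0), dev (\<lambda>_ _. 1), sumW few0}"])
    have "card ({..<i} \<inter> {..<n}) \<le> i" for n using card_mono[of "{..<i}" "{..<i} \<inter> {..<n}"] by simp
    hence "vanishing M (sumW few0)" unfolding few0_def
      by (intro vanishing_few card_mult_powr_tendsto_zero b(1)) auto
    thus "vanishing M Y" if "Y \<in> {dev (hres z0), dev (\<lambda>_ _. 1), sumW few0}" for Y
      using that vanishing_dev_bounded[of "hres z0", OF hker_bounds(3)[OF z0(1)]] vanishing_dev_bounded[of "\<lambda>_ _. 1" 1] by auto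
    fix \<epsilon> :: real assume eps: "0 < \<epsilon>"
    define g0 where "g0 = - stieltjes \<mu>X z0"
    define \<gamma> where "\<gamma> = g0 - 1 / \<bar>\<theta>\<bar>"
    have g: "0 < \<gamma>" using z0(2) theta_neg by (simp add: \<gamma>_def g0_def)
    define \<kappa> where "\<kappa> = 2 / (a - z0)"
    have k0: "0 < \<kappa>" using z0(1) by (simp add: \<kappa>_def)
    \<comment> \<open>Besides the loss \<gamma>/4 in the mean there are four errors of at most
      \<gamma>/8: terms below i, deviation at z0, fluctuation of T, and the removed first i terms,
      each with kernel at most \<kappa>. Together they stay below \<gamma>.\<close>
    define \<delta> where "\<delta> = min (\<gamma> * \<epsilon> / 8) (min (\<gamma> / 8) (min (\<gamma> * \<bar>\<theta>\<bar> / 8) (min (\<gamma> / (8 * \<kappa>)) 1)))"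
    have d: "0 < \<delta>" "\<delta> \<le> 1" using g eps theta_neg k0 by (auto simp: \<delta>_def mult_pos_neg)
    have "\<delta> \<le> \<gamma> * \<epsilon> / 8" "\<delta> \<le> \<gamma> / 8" "\<delta> \<le> \<gamma> * \<bar>\<theta>\<bar> / 8" "\<delta> \<le> \<gamma> / (8 * \<kappa>)" unfolding \<delta>_def by linarith+
    hence d': "\<delta> / \<epsilon> \<le> \<gamma> / 8" "\<delta> \<le> \<gamma> / 8" "\<delta> / \<bar>\<theta>\<bar> \<le> \<gamma> / 8" "\<kappa> * \<delta> \<le> \<gamma> / 8"
      using eps theta_neg k0 by (auto simp: field_simps)
    have mean: "\<forall>\<^sub>F n in sequentially. g0 - \<gamma> / 4 < mean (hres z0) n"
      by (rule order_tendstoD(1)[OF mean_hres[OF z0(1)]]) (use g in \<open>simp add: g0_def\<close>)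
    show "\<exists>\<delta>>0. \<forall>\<^sub>F n in sequentially. \<forall>\<omega>\<in>space M.
      (\<forall>Y\<in>{dev (hres z0), dev (\<lambda>_ _. 1), sumW few0}. \<bar>Y n \<omega>\<bar> < \<delta>) \<longrightarrow>
      \<bar>real n powr (1 - \<beta>) * (lb n \<omega> i - la n (i - 1))\<bar> \<le> \<epsilon>" (is "\<exists>\<delta>>0. ?E \<delta>")
    proof (intro exI[of _ \<delta>] conjI d(1))
      show "?E \<delta>"
        using mean eventually_hres[OF z0(1)] eventually_gt_at_top[of i]
      proof eventually_elim
        case (elim n)
        show ?case
        proof (intro ballI impI)
          fix \<omega> assume "\<omega> \<in> space M" and small: "\<forall>Y\<in>{dev (hres z0), dev (\<lambda>_ _. 1), sumW few0}. \<bar>Y n \<omega>\<bar> < \<delta>"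
          hence s1: "\<bar>dev (hres z0) n \<omega>\<bar> < \<delta>" and s2: "\<bar>dev (\<lambda>_ _. 1) n \<omega>\<bar> < \<delta>" and s3: "\<bar>sumW few0 n \<omega>\<bar> < \<delta>" by auto
          have n0: "0 < n" using elim(3) by simp
          note Tb = T_bounds[OF n0 s2 d]
          define P where "P = real n powr (1 - \<beta>)"
          have P1: "1 \<le> P" using n0 b by (simp add: P_def ge_one_powr_ge_zero)
          hence P: "0 < P" by simp
          define z where "z = la n (i - 1) + \<epsilon> / P"
          have zl: "la n (i - 1) < z" using eps P by (simp add: z_def)
          have S: "sumW few0 n \<omega> = (\<Sum>k<i. P * W n \<omega> k)"
            unfolding sumW_def few0_def few_def P_def using elim(3)
            by (intro sum.mono_neutral_cong_right) auto
          have "lb n \<omega> i \<le> z"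
          proof (rule ccontr)
            assume "\<not> lb n \<omega> i \<le> z"
            moreover have "lb n \<omega> i \<le> la n i" by (rule lb_le[OF elim(3)])
            \<comment> \<open>If z were at or above \<open>la n i\<close>, interlacing would already
              give \<open>lb n \<omega> i \<le> z\<close>; hence z may be taken inside the gap,
              where the criterion applies.\<close>
            ultimately have zi: "z < la n i" "\<not> lb n \<omega> i \<le> z" by simp_all
            have lo: "la n k \<le> la n (i - 1)" if "k < i" for k using that elim(3) by (intro la_mono) auto
            have zz: "z0 < z" using elim(2) elim(3) zl i by (metis less_imp_diff_less less_trans)
            have A: "(\<Sum>k<i. W n \<omega> k / (z - la n k)) \<le> \<delta> / \<epsilon>"
            proof -
              have "(\<Sum>k<i. W n \<omega> k / (z - la n k)) \<le> (\<Sum>k<i. W n \<omega> k / (\<epsilon> / P))"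
              proof (intro sum_mono divide_left_mono mult_pos_pos)
                fix k assume "k \<in> {..<i}"
                hence l: "la n k \<le> la n (i - 1)" by (intro lo) simp
                thus "\<epsilon> / P \<le> z - la n k" by (simp add: z_def)
                show "0 < z - la n k" using l zl by simp
              qed (use eps P in auto)
              also have "\<dots> = sumW few0 n \<omega> / \<epsilon>" by (simp add: S sum_divide_distrib mult.commute)
              also have "\<dots> \<le> \<delta> / \<epsilon>" using s3 eps by (intro divide_right_mono) auto
              finally show ?thesis .
            qed
            have B: "sumW (hres z0) n \<omega> - \<kappa> * \<delta> \<le> (\<Sum>k=i..<n. W n \<omega> k / (la n k - z))"
            proof -
              have "sumW (hres z0) n \<omega> = (\<Sum>k<i. hres z0 n k * W n \<omega> k) + (\<Sum>k=i..<n. hres z0 n k * W n \<omega> k)"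
                unfolding sumW_def using elim(3) sum.atLeastLessThan_concat[of 0 i n "\<lambda>k. hres z0 n k * W n \<omega> k"]
                by (simp add: lessThan_atLeast0)
              also have "(\<Sum>k<i. hres z0 n k * W n \<omega> k) \<le> (\<Sum>k<i. \<kappa> * (P * W n \<omega> k))"
              proof (intro sum_mono mult_mono)
                show "hres z0 n k \<le> \<kappa>" for k unfolding \<kappa>_def by (rule hker_bounds(2)[OF z0(1)])
                show "W n \<omega> k \<le> P * W n \<omega> k" for k using mult_right_mono[OF P1 W_nonneg[of n \<omega> k]] by simp
              qed (use k0 in auto)
              also have "\<dots> = \<kappa> * sumW few0 n \<omega>" by (simp add: S sum_distrib_left)
              also have "\<dots> \<le> \<kappa> * \<delta>" using s3 k0 by (intro mult_left_mono) auto
              also have "(\<Sum>k=i..<n. hres z0 n k * W n \<omega> k) \<le> (\<Sum>k=i..<n. W n \<omega> k / (la n k - z))"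
              proof (rule sum_mono)
                fix k assume k: "k \<in> {i..<n}"
                hence "la n i \<le> la n k" by (intro la_mono) auto
                hence zk: "z < la n k" using zi by simp
                have "hres z0 n k * W n \<omega> k = W n \<omega> k / (la n k - z0)" using elim(2) k by simp
                also have "\<dots> \<le> W n \<omega> k / (la n k - z)"
                  using zk zz by (intro divide_left_mono mult_pos_pos) auto
                finally show "hres z0 n k * W n \<omega> k \<le> W n \<omega> k / (la n k - z)" .
              qed
              finally show ?thesis by simp
            qed
            have "T n \<omega> + (\<Sum>k<i. W n \<omega> k / (z - la n k)) \<le> (\<Sum>k=i..<n. W n \<omega> k / (la n k - z))"
            proof -
              have "T n \<omega> \<le> 1 / \<bar>\<theta>\<bar> + \<delta> / \<bar>\<theta>\<bar>" using Tb(3) by (simp add: add_divide_distrib)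
              moreover have "g0 - \<gamma> / 4 - \<delta> < sumW (hres z0) n \<omega>" using s1 elim(1) by (simp add: dev_def)
              ultimately show ?thesis using A B d' g \<gamma>_def by linarith
            qed
            from lb_upper[OF Tb(1) elim(3) zi(1) _ this] lo zl zi(2) show False by fastforce
          qed
          hence "P * (lb n \<omega> i - la n (i - 1)) \<le> \<epsilon>" using P by (simp add: z_def field_simps)
          moreover have "la n (i - 1) \<le> lb n \<omega> i" using lb_ge[of "i - 1" n \<omega>] i elim(3) by simp
          ultimately show "\<bar>real n powr (1 - \<beta>) * (lb n \<omega> i - la n (i - 1))\<bar> \<le> \<epsilon>"
            using P unfolding P_def[symmetric] abs_mult by simp
        qed
      qed
    qed
  qed simp
  thus ?thesis
  proof (rule M.outer_vanishing_mono)
    show "\<forall>\<^sub>F n in sequentially. \<forall>\<omega>\<in>space M. \<bar>real n powr (1 - \<alpha>') * (lb n \<omega> i - la n (i - 1))\<bar>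
        \<le> \<bar>real n powr (1 - \<beta>) * (lb n \<omega> i - la n (i - 1))\<bar>"
      using eventually_gt_at_top[of 0]
      by eventually_elim (use b in \<open>auto simp: abs_mult intro!: mult_right_mono powr_mono\<close>)
  qed
qed

end

section \<open>From the spacing conditions to sticking\<close>

lemma sum_shift_one:
  "(\<Sum>i\<in>{m + 1..n}. g i) = (\<Sum>k<n. if m \<le> k then g (Suc k) else (0::'b::comm_monoid_add))"
proof -
  have "(\<Sum>i\<in>{m + 1..n}. g i) = (\<Sum>k\<in>{m..<n}. g (Suc k))"
    by (rule sum.reindex_bij_witness[of _ Suc "\<lambda>i. i - 1"]) auto
  also have "\<dots> = (\<Sum>k<n. if m \<le> k then g (Suc k) else 0)"
    by (intro sum.mono_neutral_cong_left) auto
  finally show ?thesis .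
qed

context rank_one_limit
begin

text \<open>One family of coefficients, the resolvent at \<open>la n (p - 1)\<close> on indices from
  \<open>m n\<close> on, serves every j < p: \<open>la n j\<close> lies further from these
  eigenvalues, so its terms are smaller. (C1) bounds the mean of the family, (C2) its squares, and
  the O(n^\<alpha>) remaining indices form \<open>Q n\<close>.\<close>

lemma sticking_below_edge_a:
  assumes H3: "H3_a (\<lambda>n i. eig (X n) i) (ereal L) p \<alpha>" and L: "1 / \<theta> < L" and p: "1 \<le> p"
    and al: "\<alpha> < \<alpha>'" "0 < \<alpha>" and j: "j < p"
  shows "outer_vanishing M (\<lambda>n \<omega>. real n powr (1 - \<alpha>') * (lb n \<omega> j - la n j))"
proof -
  obtain m :: "nat \<Rightarrow> nat" and \<eta> where m: "filterlim m at_top sequentially"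
    and mO: "(\<lambda>n. real (m n)) \<in> O(\<lambda>n. real n powr \<alpha>)"
    and lim: "ereal L \<le> liminf (\<lambda>n. ereal ((\<Sum>i\<in>{m n + 1..n}. 1 / (eig (X n) p - eig (X n) i)) / real n))"
    and eta: "\<eta> > 0" and ev: "\<forall>\<^sub>F n in sequentially. (\<forall>i\<in>{m n + 1..n}. eig (X n) p \<noteq> eig (X n) i) \<and>
        (\<Sum>i\<in>{m n + 1..n}. 1 / (eig (X n) p - eig (X n) i)\<^sup>2) \<le> real n powr (2 - \<eta>)"
    using H3 unfolding H3_a_def by auto
  have lap: "eig (X n) p = la n (p - 1)" for n using p by (simp add: la_def)
  define c where "c n k = (if m n \<le> k then 1 / (la n k - la n (p - 1)) else 0)" for n k
  have csum: "(\<Sum>k<n. c n k) = - (\<Sum>i\<in>{m n + 1..n}. 1 / (eig (X n) p - eig (X n) i))" for n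
  proof -
    have "1 / (la n k - la n (p - 1)) = - (1 / (la n (p - 1) - la n k))" for k
      by (metis minus_diff_eq minus_divide_right)
    thus ?thesis unfolding sum_shift_one sum_negf[symmetric] c_def by (intro sum.cong) (auto simp: lap la_def)
  qed
  have csq: "(\<Sum>k<n. (c n k)\<^sup>2) = (\<Sum>i\<in>{m n + 1..n}. 1 / (eig (X n) p - eig (X n) i)\<^sup>2)" for n
    unfolding sum_shift_one c_def by (intro sum.cong) (auto simp: lap la_def power_divide power2_commute)
  \<comment> \<open>Midpoint of -L and 1/|\<theta>|, in this order because L > 1/\<theta> =
    -1/|\<theta>|.\<close>
  define m0 where "m0 = (1 / \<bar>\<theta>\<bar> - L) / 2"
  have m0: "- m0 < L" "m0 < 1 / \<bar>\<theta>\<bar>" using L theta_neg by (auto simp: m0_def field_simps)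
  show ?thesis
  proof (rule sticking_from_below[where Q = "\<lambda>n. {..<m n}" and c = c and \<beta> = m0 and j = "\<lambda>_. j", OF _ _ _ _ m0(2)])
    show "0 < \<alpha>'" using al by simp
    show "(\<lambda>n. real (card ({..<m n} \<inter> {..<n})) * real n powr - \<alpha>') \<longlonglongrightarrow> 0"
    proof -
      obtain C where C: "\<forall>\<^sub>F n in sequentially. norm (real (m n)) \<le> C * norm (real n powr \<alpha>)"
        using mO by (elim landau_o.bigE)
      show ?thesis
      proof (rule tendsto_sandwich[OF _ _ tendsto_const])
        have "(\<lambda>n. C * real n powr (- (\<alpha>' - \<alpha>))) \<longlonglongrightarrow> C * 0"
          by (intro tendsto_mult tendsto_const tendsto_neg_powr filterlim_real_sequentially) (use al in auto)
        thus "(\<lambda>n. C * real n powr (- (\<alpha>' - \<alpha>))) \<longlonglongrightarrow> 0" by simp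
        show "\<forall>\<^sub>F n in sequentially. real (card ({..<m n} \<inter> {..<n})) * real n powr - \<alpha>' \<le> C * real n powr (- (\<alpha>' - \<alpha>))"
          using C
        proof eventually_elim
          case (elim n)
          have "card ({..<m n} \<inter> {..<n}) \<le> m n" using card_mono[of "{..<m n}" "{..<m n} \<inter> {..<n}"] by simp
          hence "real (card ({..<m n} \<inter> {..<n})) \<le> C * real n powr \<alpha>" using elim by simp
          hence "real (card ({..<m n} \<inter> {..<n})) * real n powr - \<alpha>' \<le> C * real n powr \<alpha> * real n powr - \<alpha>'"
            by (rule mult_right_mono) simp
          thus ?case by (simp add: powr_add[symmetric] mult.assoc)
        qed
      qed auto
    qed
    show "(\<lambda>n. (\<Sum>k<n. (c n k)\<^sup>2) / (real n)\<^sup>2) \<longlonglongrightarrow> 0"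
    proof (rule tendsto_sandwich[OF _ _ tendsto_const])
      show "(\<lambda>n. real n powr (- \<eta>)) \<longlonglongrightarrow> 0"
        by (intro tendsto_neg_powr filterlim_real_sequentially) (use eta in simp)
      show "\<forall>\<^sub>F n in sequentially. (\<Sum>k<n. (c n k)\<^sup>2) / (real n)\<^sup>2 \<le> real n powr (- \<eta>)"
        using ev eventually_gt_at_top[of 0]
      proof eventually_elim
        case (elim n)
        have "(\<Sum>k<n. (c n k)\<^sup>2) / (real n)\<^sup>2 \<le> real n powr (2 - \<eta>) / (real n)\<^sup>2"
          using elim unfolding csq by (intro divide_right_mono) auto
        also have "\<dots> = real n powr (- \<eta>)"
          using elim by (simp add: powr_diff powr_minus divide_inverse)
        finally show ?case .
      qed
    qed (simp add: sum_nonneg)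
    have "ereal (- m0) < liminf (\<lambda>n. ereal ((\<Sum>i\<in>{m n + 1..n}. 1 / (eig (X n) p - eig (X n) i)) / real n))"
      by (rule less_le_trans[OF _ lim]) (use m0 in simp)
    from less_LiminfD[OF this]
    show "\<forall>\<^sub>F n in sequentially. mean c n \<le> m0"
      by eventually_elim (simp add: mean_def csum)
    have "\<forall>\<^sub>F n in sequentially. p \<le> m n" using m unfolding filterlim_at_top by blast
    thus "\<forall>\<^sub>F n in sequentially. j < n \<and> (\<forall>k<n. 0 \<le> c n k \<and>
        (j \<le> k \<longrightarrow> k \<notin> {..<m n} \<longrightarrow> la n j < la n k \<and> 1 / (la n k - la n j) \<le> c n k))"
      using ev eventually_gt_at_top[of p]
    proof eventually_elim
      case (elim n)
      \<comment> \<open>\<open>p \<le> m n\<close> gives the weak inequality by ordering; strictness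
        comes from the clause of \<open>H3_a\<close> that excludes zero denominators.\<close>
      have gt: "la n (p - 1) < la n k" if "m n \<le> k" "k < n" for k
      proof -
        have "la n (p - 1) \<le> la n k" using that elim(1) by (intro la_mono) auto
        moreover have "Suc k \<in> {m n + 1..n}" using that by simp
        hence "eig (X n) p \<noteq> eig (X n) (Suc k)" using elim(2) by blast
        ultimately show ?thesis by (simp add: lap la_def)
      qed
      have jp: "la n j \<le> la n (p - 1)" using j elim(3) by (intro la_mono) auto
      show ?case
      proof (intro conjI allI impI)
        show "j < n" using j elim(3) by simp
        fix k assume k: "k < n"
        show "0 \<le> c n k" using gt[OF _ k] by (simp add: c_def less_imp_le)
        assume "k \<notin> {..<m n}"
        hence mk: "m n \<le> k" by simp
        show "la n j < la n k" using gt[OF mk k] jp by simp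
        show "1 / (la n k - la n j) \<le> c n k"
          unfolding c_def using gt[OF mk k] jp mk by (auto intro!: divide_left_mono mult_pos_pos)
      qed
    qed
  qed
qed

text \<open>For \<theta> < 0 the lower criterion at index n - 1 - i sees only the indices above it.
  These are at most p and all lie in \<open>Q n\<close>, so the far part is 0, below
  1/|\<theta>|.\<close>

lemma sticking_below_edge_b:
  assumes i: "i < p" and al: "0 < \<alpha>'"
  shows "outer_vanishing M (\<lambda>n \<omega>. real n powr (1 - \<alpha>') * (lb n \<omega> (n - 1 - i) - la n (n - 1 - i)))"
proof (rule sticking_from_below[where Q = "\<lambda>n. {k. n \<le> k + p}" and c = "\<lambda>_ _. 0" and \<beta> = 0 and j = "\<lambda>n. n - 1 - i"])
  have "card ({k. n \<le> k + p} \<inter> {..<n}) \<le> p" for n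
  proof -
    have "card ({k. n \<le> k + p} \<inter> {..<n}) \<le> card {n - p..<n}" by (rule card_mono) auto
    thus ?thesis by simp
  qed
  thus "(\<lambda>n. real (card ({k. n \<le> k + p} \<inter> {..<n})) * real n powr - \<alpha>') \<longlonglongrightarrow> 0"
    by (rule card_mult_powr_tendsto_zero) (rule al)
  show "\<forall>\<^sub>F n in sequentially. n - 1 - i < n \<and> (\<forall>k<n. 0 \<le> (0::real) \<and>
      (n - 1 - i \<le> k \<longrightarrow> k \<notin> {k. n \<le> k + p} \<longrightarrow> la n (n - 1 - i) < la n k \<and> 1 / (la n k - la n (n - 1 - i)) \<le> 0))"
    using eventually_gt_at_top[of 0] by eventually_elim (use i in auto)
qed (use al theta_neg in \<open>auto simp: mean_def\<close>)

end

theorem theorem4p2: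
  fixes X :: "nat \<Rightarrow> complex mat"
    and \<mu>X :: "real measure"
    and a b :: real
    and \<nu> :: "complex measure"
    and M :: "'s measure"
    and x :: "nat \<Rightarrow> nat \<Rightarrow> 's \<Rightarrow> complex"
    and orth :: bool
    and \<theta> \<alpha> :: real
    and p :: nat
  defines "lam \<equiv> (\<lambda>n i. eig (X n) i)"
      and "lt \<equiv> (\<lambda>n \<omega> i. eig (X n + rank_one n \<theta> (model_vec orth n (\<lambda>i. x n i \<omega>))) i)"
  assumes herm: "\<And>n. hermitian_n n (X n)"
    \<comment> \<open>Hypothesis (H1)\<close>
      and muX: "prob_space \<mu>X" "sets \<mu>X = sets borel"
      and weak: "\<And>f :: real \<Rightarrow> real. continuous_on UNIV f \<Longrightarrow> bounded (range f) \<Longrightarrow>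
                   (\<lambda>n. (\<Sum>i=1..n. f (lam n i)) / real n) \<longlonglongrightarrow> (\<integral>t. f t \<partial>\<mu>X)"
      and supp_compact: "compact (measure_support \<mu>X)"
      and a_def: "a = Inf (measure_support \<mu>X)"
      and b_def: "b = Sup (measure_support \<mu>X)"
      and lam_min: "(\<lambda>n. lam n 1) \<longlonglongrightarrow> a"
      and lam_max: "(\<lambda>n. lam n n) \<longlonglongrightarrow> b"
    \<comment> \<open>Assumption (A1) and the random vector model\<close>
      and A1: "assumption_A1 \<nu>"
      and M: "prob_space M"
      and indep: "\<And>n. prob_space.indep_vars M (\<lambda>_. borel) (x n) {..<n}"
      and distr_x: "\<And>n i. i < n \<Longrightarrow> distr M borel (x n i) = \<nu>"
      and theta_neg: "\<theta> < 0"
      and alpha: "0 < \<alpha>" "\<alpha> < 1"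
      and p_pos: "p \<ge> 1"
  shows "(H3_a lam (G_left \<mu>X a) p \<alpha> \<longrightarrow>
            (\<theta> < theta_under \<mu>X a \<longrightarrow>
               (AE \<omega> in M. (\<lambda>n. lt n \<omega> 1) \<longlonglongrightarrow> rho \<mu>X a b \<theta>) \<and> rho \<mu>X a b \<theta> < a \<and>
               (\<forall>\<alpha>'>\<alpha>. \<forall>i\<in>{1..p - 1}.
                  conv_prob_zero M (\<lambda>n \<omega>. real n powr (1 - \<alpha>') * (lt n \<omega> (i + 1) - lam n i))))
          \<and> (theta_under \<mu>X a < \<theta> \<longrightarrow>
               (\<forall>\<alpha>'>\<alpha>. \<forall>i\<in>{1..p}.
                  conv_prob_zero M (\<lambda>n \<omega>. real n powr (1 - \<alpha>') * (lt n \<omega> i - lam n i)))))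
       \<and> (H3_b lam (G_right \<mu>X b) p \<alpha> \<longrightarrow>
            (\<forall>\<alpha>'>\<alpha>. \<forall>i<p.
               conv_prob_zero M (\<lambda>n \<omega>. real n powr (1 - \<alpha>') * (lt n \<omega> (n - i) - lam n (n - i)))))"
proof -
  have "\<exists>e. \<forall>n. eigenbasis n (X n) (e n)"
    by (rule choice) (use hermitian_eigenbasis[OF herm] in blast)
  then obtain e where e: "\<And>n. eigenbasis n (X n) (e n)" by blast
  interpret M: prob_space M by (rule M)
  interpret standardized_law \<nu> by (rule standardized_law_of_A1[OF A1])
  interpret rank_one_model \<nu> M X e x orth \<theta>
    by unfold_locales (use herm e indep distr_x theta_neg in auto)
  have lam_la: "lam n (Suc k) = la n k" for n k by (simp add: lam_def la_def)
  have lt_lb: "lt n \<omega> (Suc k) = lb n \<omega> k" for n \<omega> k by (simp add: lt_def lb_def)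
  interpret rank_one_limit \<nu> M X e x orth \<theta> \<mu>X a b
  proof (intro rank_one_limit.intro rank_one_limit_axioms.intro rank_one_model_axioms muX)
    fix f :: "real \<Rightarrow> real" assume "continuous_on UNIV f" "bounded (range f)"
    from weak[OF this] show "(\<lambda>n. (\<Sum>k<n. f (la n k)) / real n) \<longlonglongrightarrow> (\<integral>t. f t \<partial>\<mu>X)"
      by (simp add: sum.atLeast1_atMost_eq lam_la)
  next
    show "(\<lambda>n. la n 0) \<longlonglongrightarrow> a" using lam_min by (simp add: lam_la)
    show "(\<lambda>n. la n (n - 1)) \<longlonglongrightarrow> b"
    proof (rule Lim_transform_eventually[OF lam_max])
      show "\<forall>\<^sub>F n in sequentially. lam n n = la n (n - 1)"
        using eventually_gt_at_top[of 0] by eventually_elim (simp add: lam_la[symmetric])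
    qed
  qed
  show ?thesis
  proof (intro conjI impI allI ballI)
    assume th: "\<theta> < theta_under \<mu>X a"
    note rho = rho_properties[OF muX AE_above th theta_neg AE_below]
    show "AE \<omega> in M. (\<lambda>n. lt n \<omega> 1) \<longlonglongrightarrow> rho \<mu>X a b \<theta>"
      using AE_smallest_eigenvalue[OF rho] by (simp add: lt_lb)
    show "rho \<mu>X a b \<theta> < a" by (rule rho(1))
    fix \<alpha>' i assume "\<alpha> < \<alpha>'" "i \<in> {1..p - 1}"
    moreover from this obtain k where k: "i = Suc k" by (cases i) auto
    moreover obtain z0 where "z0 < a" "stieltjes \<mu>X z0 < 1 / \<theta>"
      using theta_under_less_imp[OF muX AE_above th theta_neg] by auto
    \<comment> \<open>In one-based numbering \<open>lt n \<omega> (i + 1)\<close> is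
      \<open>lb n \<omega> i\<close>, while \<open>lam n i\<close> is
      \<open>la n (i - 1)\<close>.\<close>
    ultimately have "outer_vanishing M (\<lambda>n \<omega>. real n powr (1 - \<alpha>') * (lb n \<omega> i - la n (i - 1)))"
      using alpha by (intro sticking_from_above) auto
    thus "conv_prob_zero M (\<lambda>n \<omega>. real n powr (1 - \<alpha>') * (lt n \<omega> (i + 1) - lam n i))"
      using M.outer_vanishing_imp_conv_prob_zero by (simp add: k lt_lb lam_la)
  next
    fix \<alpha>' i
    assume H3: "H3_a lam (G_left \<mu>X a) p \<alpha>" and th: "theta_under \<mu>X a < \<theta>" and "\<alpha> < \<alpha>'" "i \<in> {1..p}"
    moreover from this obtain k where k: "i = Suc k" by (cases i) auto
    moreover obtain L where "G_left \<mu>X a = ereal L" "1 / \<theta> < L"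
      using less_theta_under_imp[OF muX AE_above th theta_neg] by auto
    ultimately have "outer_vanishing M (\<lambda>n \<omega>. real n powr (1 - \<alpha>') * (lb n \<omega> k - la n k))"
      using alpha p_pos unfolding lam_def by (intro sticking_below_edge_a) auto
    thus "conv_prob_zero M (\<lambda>n \<omega>. real n powr (1 - \<alpha>') * (lt n \<omega> i - lam n i))"
      using M.outer_vanishing_imp_conv_prob_zero by (simp add: k lt_lb lam_la)
  next
    fix \<alpha>' i assume al: "\<alpha> < \<alpha>'" and i: "i < p"
    have "outer_vanishing M (\<lambda>n \<omega>. real n powr (1 - \<alpha>') * (lb n \<omega> (n - 1 - i) - la n (n - 1 - i)))"
      by (rule sticking_below_edge_b[OF i]) (use al alpha in simp)
    hence "outer_vanishing M (\<lambda>n \<omega>. real n powr (1 - \<alpha>') * (lt n \<omega> (n - i) - lam n (n - i)))"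
    proof (rule M.outer_vanishing_mono)
      show "\<forall>\<^sub>F n in sequentially. \<forall>\<omega>\<in>space M. \<bar>real n powr (1 - \<alpha>') * (lt n \<omega> (n - i) - lam n (n - i))\<bar>
          \<le> \<bar>real n powr (1 - \<alpha>') * (lb n \<omega> (n - 1 - i) - la n (n - 1 - i))\<bar>"
        using eventually_gt_at_top[of i]
      proof eventually_elim
        case (elim n)
        hence "n - i = Suc (n - 1 - i)" by simp
        thus ?case by (simp add: lt_lb lam_la)
      qed
    qed
    thus "conv_prob_zero M (\<lambda>n \<omega>. real n powr (1 - \<alpha>') * (lt n \<omega> (n - i) - lam n (n - i)))"
      by (rule M.outer_vanishing_imp_conv_prob_zero)
  qed
qed

end
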